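(* Let $(M,g,\Phi)$ be a locally conformal parallel ${\rm Spin}(7)$-structure on a compact $8$-dimensional Riemannian manifold. Then it cannot have parallel intrinsic torsion, i.e. its intrinsic torsion $\xi$ does not satisfy $\nabla^{{\rm Spin}(7)}\xi=0$, where $\nabla^{{\rm Spin}(7)}$ is the minimal ${\rm Spin}(7)$-connection.
   Context: A ${\rm Spin}(7)$-structure on an $8$-dimensional Riemannian manifold $(M,g)$ is a global $4$-form $\Phi$ such that around each point there is a local orthonormal frame $e_0,\dots,e_7$ with dual coframe $e^0,\dots,e^7$ in which (writing $e^{ijkl}=e^i\wedge e^j\wedge e^k\wedge e^l$) $$\Phi=e^{0123}-e^{0145}-e^{0167}-e^{0246}+e^{0257}-e^{0347}-e^{0356}+e^{4567}-e^{2367}-e^{2345}-e^{1357}+e^{1346}-e^{1256}-e^{1247}.$$ $M$ is oriented by $e^{01234567}$, $\star$ is the Hodge star, $\star\Phi=\Phi$, and $\delta\Phi=-\star d\star\Phi$ is the codifferential. ${\rm Spin}(7)\subset SO(8)$ is the stabilizer of $\Phi$. Pointwise, $\Lambda^2=\Lambda^2_7\oplus\Lambda^2_{21}$ with $\Lambda^2_7=\{\omega:\star(\Phi\wedge\omega)=3\omega\}$ and $\Lambda^2_{21}=\{\omega:\star(\Phi\wedge\omega)=-\omega\}$. Skew endomorphisms $A$ of $TM$ are identified with $2$-forms via $(Y,Z)\mapsto g(AY,Z)$; with this identification $\mathfrak{so}(8)=\mathfrak{spin}(7)\oplus\mathfrak{spin}(7)^{\perp}$ corresponds to $\Lambda^2=\Lambda^2_{21}\oplus\Lambda^2_7$.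 Lee form: $\theta=\frac{1}{7}\star(\delta\Phi\wedge\Phi)$. The structure is locally conformal parallel (type $\mathcal{W}_8$) if $d\Phi=\theta\wedge\Phi$; equivalently, its intrinsic torsion is $\xi_X=\frac14(X^\flat\wedge\theta)_7$, where the subscript $7$ denotes the $\Lambda^2_7$-component. Let $\nabla$ be the Levi-Civita connection. The minimal ${\rm Spin}(7)$-connection $\nabla^{{\rm Spin}(7)}$ is the connection given by the $\mathfrak{spin}(7)$-component of the Levi-Civita connection form; the intrinsic torsion is the $(1,2)$-tensor $\xi=\nabla^{{\rm Spin}(7)}-\nabla$. Equivalently, $\nabla^{{\rm Spin}(7)}=\nabla+\xi$ is the unique metric connection with $\nabla^{{\rm Spin}(7)}\Phi=0$ and $\xi_X\in\Lambda^2_7$ for all $X$.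
   Formalization: The intrinsic torsion ξ is assumed not to vanish identically; without this the claim is false, e.g. a flat torus T^8 with constant Φ has θ = 0 and ξ = 0, which is parallel. *)

theory Defs
  imports "HOL-Analysis.Analysis"
begin

text \<open>
  Manifolds are given by an atlas of charts into \<^typ>\<open>real^8\<close>, and a tensor field is a family of
  local representations, one for each chart, related by the differentials of the transition maps.
  The value of a local representation at a point of the chart image is a tensor on the
  vector space \<^typ>\<open>real^8\<close>; values outside the chart image are irrelevant.
\<close>

section \<open>Multilinear algebra on an eight-dimensional space\<close>

type_synonym vec8 = "real ^ 8"

text \<open>A \<open>k\<close>-form is evaluated on a sequence of vectors and depends only on entries \<open>0, ..., k - 1\<close>.\<close>

type_synonym form = "(nat \<Rightarrow> vec8) \<Rightarrow> real"
type_synonym metric = "vec8 \<Rightarrow> vec8 \<Rightarrow> real"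

definition is_form :: "nat \<Rightarrow> form \<Rightarrow> bool" where
  "is_form k \<alpha> \<longleftrightarrow>
     (\<forall>v w. (\<forall>i<k. v i = w i) \<longrightarrow> \<alpha> v = \<alpha> w) \<and>
     (\<forall>v. \<forall>i<k. linear (\<lambda>y. \<alpha> (v(i := y)))) \<and>
     (\<forall>v i j. i < j \<and> j < k \<and> v i = v j \<longrightarrow> \<alpha> v = 0)"

text \<open>Wedge product of a \<open>p\<close>-form and a \<open>q\<close>-form, normalised so that it agrees with the
  determinant convention of \<open>wedge1\<close> below.\<close>

definition wedge :: "nat \<Rightarrow> nat \<Rightarrow> form \<Rightarrow> form \<Rightarrow> form" where
  "wedge p q \<alpha> \<beta> = (\<lambda>v. (\<Sum>\<sigma> | \<sigma> permutes {..<p + q}.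
      of_int (sign \<sigma>) * \<alpha> (\<lambda>i. v (\<sigma> i)) * \<beta> (\<lambda>i. v (\<sigma> (p + i)))) / (fact p * fact q))"

text \<open>\<open>wedge1 \<epsilon> [i\<^sub>1, ..., i\<^sub>k]\<close> is the wedge product of the one-forms \<open>\<epsilon> i\<^sub>1, ..., \<epsilon> i\<^sub>k\<close>.\<close>

definition wedge1 :: "(nat \<Rightarrow> vec8 \<Rightarrow> real) \<Rightarrow> nat list \<Rightarrow> form" where
  "wedge1 \<epsilon> I = (\<lambda>v. \<Sum>\<sigma> | \<sigma> permutes {..<length I}.
      of_int (sign \<sigma>) * (\<Prod>m<length I. \<epsilon> (I ! m) (v (\<sigma> m))))"

definition orthonormal_frame :: "metric \<Rightarrow> (nat \<Rightarrow> vec8) \<Rightarrow> bool" where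
  "orthonormal_frame g e \<longleftrightarrow> (\<forall>i<8. \<forall>j<8. g (e i) (e j) = (if i = j then 1 else 0))"

text \<open>The dual coframe of an orthonormal frame.\<close>

definition coframe :: "metric \<Rightarrow> (nat \<Rightarrow> vec8) \<Rightarrow> nat \<Rightarrow> vec8 \<Rightarrow> real" where
  "coframe g e i v = g (e i) v"

definition spin7_terms :: "(real \<times> nat list) list" where
  "spin7_terms =
    [( 1, [0,1,2,3]), (-1, [0,1,4,5]), (-1, [0,1,6,7]), (-1, [0,2,4,6]), ( 1, [0,2,5,7]),
     (-1, [0,3,4,7]), (-1, [0,3,5,6]), ( 1, [4,5,6,7]), (-1, [2,3,6,7]), (-1, [2,3,4,5]),
     (-1, [1,3,5,7]), ( 1, [1,3,4,6]), (-1, [1,2,5,6]), (-1, [1,2,4,7])]"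

definition spin7_model :: "(nat \<Rightarrow> vec8 \<Rightarrow> real) \<Rightarrow> form" where
  "spin7_model \<epsilon> = (\<lambda>v. \<Sum>(s, I)\<leftarrow>spin7_terms. s * wedge1 \<epsilon> I v)"

definition adapted_frame :: "metric \<Rightarrow> form \<Rightarrow> (nat \<Rightarrow> vec8) \<Rightarrow> bool" where
  "adapted_frame g \<Phi> e \<longleftrightarrow> orthonormal_frame g e \<and> \<Phi> = spin7_model (coframe g e)"

text \<open>
  Hodge star of a \<open>k\<close>-form with respect to an orthonormal frame and the volume form
  \<open>e\<^sup>0 \<and> ... \<and> e\<^sup>7\<close>: contraction of the form with the first \<open>k\<close> slots of the volume form.
  With this convention \<open>\<alpha> \<and> \<star>\<alpha> = |\<alpha>|\<^sup>2 vol\<close>.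
\<close>

definition hodge_frame :: "metric \<Rightarrow> (nat \<Rightarrow> vec8) \<Rightarrow> nat \<Rightarrow> form \<Rightarrow> form" where
  "hodge_frame g e k \<alpha> = (\<lambda>v. (\<Sum>i \<in> {..<k} \<rightarrow>\<^sub>E {..<8}. \<alpha> (\<lambda>m. e (i m)) *
      wedge1 (coframe g e) [0..<8] (\<lambda>m. if m < k then e (i m) else v (m - k))) / fact k)"

text \<open>The choice of the adapted frame is immaterial: any two adapted frames differ by an element
  of \<open>Spin(7)\<close>, hence by an element of \<open>SO(8)\<close>.\<close>

definition hodge :: "metric \<Rightarrow> form \<Rightarrow> nat \<Rightarrow> form \<Rightarrow> form" where
  "hodge g \<Phi> = hodge_frame g (SOME e. adapted_frame g \<Phi> e)"

definition Lambda2_7 :: "metric \<Rightarrow> form \<Rightarrow> form set" where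
  "Lambda2_7 g \<Phi> =
     {\<omega>. is_form 2 \<omega> \<and> hodge g \<Phi> 6 (wedge 4 2 \<Phi> \<omega>) = (\<lambda>v. 3 * \<omega> v)}"

definition Lambda2_21 :: "metric \<Rightarrow> form \<Rightarrow> form set" where
  "Lambda2_21 g \<Phi> =
     {\<omega>. is_form 2 \<omega> \<and> hodge g \<Phi> 6 (wedge 4 2 \<Phi> \<omega>) = (\<lambda>v. - \<omega> v)}"

definition endo_form :: "metric \<Rightarrow> (vec8 \<Rightarrow> vec8) \<Rightarrow> form" where
  "endo_form g A = (\<lambda>v. g (A (v 0)) (v 1))"


section \<open>Calculus in a chart image\<close>

text \<open>\<open>C\<^sup>k\<close> and smooth maps on an open subset of \<^typ>\<open>real^8\<close>.\<close>

primrec Ck_on :: "nat \<Rightarrow> vec8 set \<Rightarrow> (vec8 \<Rightarrow> 'b::real_normed_vector) \<Rightarrow> bool" where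
  "Ck_on 0 S f \<longleftrightarrow> continuous_on S f"
| "Ck_on (Suc k) S f \<longleftrightarrow> (\<forall>x\<in>S. f differentiable (at x)) \<and>
     (\<forall>v. Ck_on k S (\<lambda>x. frechet_derivative f (at x) v))"

definition smooth_on :: "vec8 set \<Rightarrow> (vec8 \<Rightarrow> 'b::real_normed_vector) \<Rightarrow> bool" where
  "smooth_on S f \<longleftrightarrow> (\<forall>k. Ck_on k S f)"

text \<open>Exterior derivative of a field of \<open>k\<close>-forms. The arguments are constant vector fields of the
  coordinate domain, so the bracket terms of the invariant formula vanish.\<close>

definition ext_deriv :: "nat \<Rightarrow> (vec8 \<Rightarrow> form) \<Rightarrow> vec8 \<Rightarrow> form" where
  "ext_deriv k \<omega> x = (\<lambda>v. \<Sum>i\<le>k. (-1) ^ i *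
      frechet_derivative (\<lambda>y. \<omega> y (\<lambda>m. if m < i then v m else v (Suc m))) (at x) (v i))"

definition codiff :: "(vec8 \<Rightarrow> metric) \<Rightarrow> (vec8 \<Rightarrow> form) \<Rightarrow> nat \<Rightarrow> (vec8 \<Rightarrow> form) \<Rightarrow> vec8 \<Rightarrow> form"
  where
  "codiff g \<Phi> k \<omega> x =
     (\<lambda>v. - hodge (g x) (\<Phi> x) (9 - k) (ext_deriv (8 - k) (\<lambda>y. hodge (g y) (\<Phi> y) k (\<omega> y)) x) v)"

definition lee_form :: "(vec8 \<Rightarrow> metric) \<Rightarrow> (vec8 \<Rightarrow> form) \<Rightarrow> vec8 \<Rightarrow> form" where
  "lee_form g \<Phi> x =
     (\<lambda>v. hodge (g x) (\<Phi> x) 7 (wedge 3 4 (codiff g \<Phi> 4 \<Phi> x) (\<Phi> x)) v / 7)"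

definition adapted_local_frame ::
  "vec8 set \<Rightarrow> (vec8 \<Rightarrow> metric) \<Rightarrow> (vec8 \<Rightarrow> form) \<Rightarrow> (vec8 \<Rightarrow> nat \<Rightarrow> vec8) \<Rightarrow> bool" where
  "adapted_local_frame W g \<Phi> e \<longleftrightarrow>
     open W \<and> (\<forall>i<8. smooth_on W (\<lambda>x. e x i)) \<and> (\<forall>x\<in>W. adapted_frame (g x) (\<Phi> x) (e x))"

text \<open>
  A connection is given in a chart by its Christoffel tensor \<open>\<Gamma>\<close>: the covariant derivative of a
  vector field \<open>Y\<close> in direction \<open>u\<close> is the directional derivative of \<open>Y\<close> plus \<open>\<Gamma> u Y\<close>.
\<close>

type_synonym connection = "vec8 \<Rightarrow> vec8 \<Rightarrow> vec8 \<Rightarrow> vec8"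

definition cov_deriv :: "connection \<Rightarrow> (vec8 \<Rightarrow> vec8) \<Rightarrow> vec8 \<Rightarrow> vec8 \<Rightarrow> vec8" where
  "cov_deriv \<Gamma> Y x u = frechet_derivative Y (at x) u + \<Gamma> x u (Y x)"

text \<open>Covariant derivative, in direction \<open>u\<close>, of a \<open>(1,2)\<close>-tensor field \<open>T\<close>, evaluated on constant
  vector fields \<open>v\<close> and \<open>w\<close> of the chart.\<close>

definition cov_deriv12 ::
  "connection \<Rightarrow> (vec8 \<Rightarrow> vec8 \<Rightarrow> vec8 \<Rightarrow> vec8) \<Rightarrow> vec8 \<Rightarrow> vec8 \<Rightarrow> vec8 \<Rightarrow> vec8 \<Rightarrow> vec8" where
  "cov_deriv12 \<Gamma> T x u v w =
     cov_deriv \<Gamma> (\<lambda>y. T y v w) x u - T x (\<Gamma> x u v) w - T x v (\<Gamma> x u w)"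

definition levi_civita_on :: "vec8 set \<Rightarrow> (vec8 \<Rightarrow> metric) \<Rightarrow> connection \<Rightarrow> bool" where
  "levi_civita_on D g \<Gamma> \<longleftrightarrow> (\<forall>x\<in>D. bilinear (\<Gamma> x) \<and>
     (\<forall>u v. \<Gamma> x u v = \<Gamma> x v u) \<and>
     (\<forall>u v w. frechet_derivative (\<lambda>y. g y v w) (at x) u = g x (\<Gamma> x u v) w + g x v (\<Gamma> x u w)))"

text \<open>Connection form in a local orthonormal frame \<open>e\<close>, as the endomorphism
  \<open>e\<^sub>j \<mapsto> \<nabla>\<^sub>u e\<^sub>j\<close>.\<close>

definition connection_form ::
  "(vec8 \<Rightarrow> metric) \<Rightarrow> connection \<Rightarrow> (vec8 \<Rightarrow> nat \<Rightarrow> vec8) \<Rightarrow> vec8 \<Rightarrow> vec8 \<Rightarrow> vec8 \<Rightarrow> vec8" where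
  "connection_form g \<Gamma> e x u =
     (\<lambda>Y. \<Sum>j<8. coframe (g x) (e x) j Y *\<^sub>R cov_deriv \<Gamma> (\<lambda>y. e y j) x u)"

text \<open>
  \<open>\<Gamma>'\<close> is the minimal connection if its connection form is the \<open>spin(7)\<close>-component of the
  connection form of the Levi-Civita connection \<open>\<Gamma>\<close> in every adapted local frame, where
  \<open>spin(7)\<close> and its orthogonal complement in \<open>so(8)\<close> are \<open>Lambda2_21\<close> and \<open>Lambda2_7\<close>.
\<close>

definition minimal_connection_on ::
  "vec8 set \<Rightarrow> (vec8 \<Rightarrow> metric) \<Rightarrow> (vec8 \<Rightarrow> form) \<Rightarrow> connection \<Rightarrow> connection \<Rightarrow> bool" where
  "minimal_connection_on D g \<Phi> \<Gamma> \<Gamma>' \<longleftrightarrow> (\<forall>x\<in>D. bilinear (\<Gamma>' x)) \<and>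
     (\<forall>W e. W \<subseteq> D \<and> adapted_local_frame W g \<Phi> e \<longrightarrow> (\<forall>x\<in>W. \<forall>u.
        endo_form (g x) (connection_form g \<Gamma>' e x u) \<in> Lambda2_21 (g x) (\<Phi> x) \<and>
        endo_form (g x) (\<lambda>Y. connection_form g \<Gamma> e x u Y - connection_form g \<Gamma>' e x u Y)
          \<in> Lambda2_7 (g x) (\<Phi> x)))"


section \<open>Spin(7)-structures on manifolds\<close>

text \<open>A chart is a coordinate domain together with its coordinate map.\<close>

type_synonym 'a chart = "'a set \<times> ('a \<Rightarrow> vec8)"

definition chart_image :: "'a chart \<Rightarrow> vec8 set" where
  "chart_image c = snd c ` fst c"

definition is_chart :: "'a topology \<Rightarrow> 'a chart \<Rightarrow> bool" where
  "is_chart X c \<longleftrightarrow> openin X (fst c) \<and> open (chart_image c) \<and>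
     homeomorphic_map (subtopology X (fst c)) (top_of_set (chart_image c)) (snd c)"

definition transition :: "'a chart \<Rightarrow> 'a chart \<Rightarrow> vec8 \<Rightarrow> vec8" where
  "transition c c' x = snd c' (inv_into (fst c) (snd c) x)"

definition smooth_manifold :: "'a topology \<Rightarrow> 'a chart set \<Rightarrow> bool" where
  "smooth_manifold X \<A> \<longleftrightarrow> Hausdorff_space X \<and> second_countable X \<and>
     (\<forall>c\<in>\<A>. is_chart X c) \<and> topspace X = (\<Union>c\<in>\<A>. fst c) \<and>
     (\<forall>c\<in>\<A>. \<forall>c'\<in>\<A>. smooth_on (snd c ` (fst c \<inter> fst c')) (transition c c'))"

definition riemannian_metric :: "'a chart set \<Rightarrow> ('a chart \<Rightarrow> vec8 \<Rightarrow> metric) \<Rightarrow> bool" where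
  "riemannian_metric \<A> g \<longleftrightarrow>
     (\<forall>c\<in>\<A>. \<forall>x\<in>chart_image c. bilinear (g c x) \<and> (\<forall>v w. g c x v w = g c x w v) \<and>
        (\<forall>v. v \<noteq> 0 \<longrightarrow> g c x v v > 0)) \<and>
     (\<forall>c\<in>\<A>. \<forall>v w. smooth_on (chart_image c) (\<lambda>x. g c x v w)) \<and>
     (\<forall>c\<in>\<A>. \<forall>c'\<in>\<A>. \<forall>p\<in>fst c \<inter> fst c'. \<forall>v w.
        let J = frechet_derivative (transition c c') (at (snd c p))
        in g c (snd c p) v w = g c' (snd c' p) (J v) (J w))"

definition differential_form :: "'a chart set \<Rightarrow> nat \<Rightarrow> ('a chart \<Rightarrow> vec8 \<Rightarrow> form) \<Rightarrow> bool" where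
  "differential_form \<A> k \<omega> \<longleftrightarrow>
     (\<forall>c\<in>\<A>. \<forall>x\<in>chart_image c. is_form k (\<omega> c x)) \<and>
     (\<forall>c\<in>\<A>. \<forall>v. smooth_on (chart_image c) (\<lambda>x. \<omega> c x v)) \<and>
     (\<forall>c\<in>\<A>. \<forall>c'\<in>\<A>. \<forall>p\<in>fst c \<inter> fst c'. \<forall>v.
        let J = frechet_derivative (transition c c') (at (snd c p))
        in \<omega> c (snd c p) v = \<omega> c' (snd c' p) (\<lambda>i. J (v i)))"

definition spin7_structure ::
  "'a topology \<Rightarrow> 'a chart set \<Rightarrow> ('a chart \<Rightarrow> vec8 \<Rightarrow> metric) \<Rightarrow> ('a chart \<Rightarrow> vec8 \<Rightarrow> form) \<Rightarrow> bool"
  where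
  "spin7_structure X \<A> g \<Phi> \<longleftrightarrow>
     smooth_manifold X \<A> \<and> riemannian_metric \<A> g \<and> differential_form \<A> 4 \<Phi> \<and>
     (\<forall>c\<in>\<A>. \<forall>x\<in>chart_image c. \<exists>W e. x \<in> W \<and> W \<subseteq> chart_image c \<and>
        adapted_local_frame W (g c) (\<Phi> c) e)"

definition locally_conformal_parallel ::
  "'a chart set \<Rightarrow> ('a chart \<Rightarrow> vec8 \<Rightarrow> metric) \<Rightarrow> ('a chart \<Rightarrow> vec8 \<Rightarrow> form) \<Rightarrow> bool" where
  "locally_conformal_parallel \<A> g \<Phi> \<longleftrightarrow> (\<forall>c\<in>\<A>. \<forall>x\<in>chart_image c.
     ext_deriv 4 (\<Phi> c) x = wedge 1 4 (lee_form (g c) (\<Phi> c) x) (\<Phi> c x))"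

text \<open>
  The following two predicates determine the connection uniquely on each chart image and are
  invariant under changes of coordinates, so the transformation law of the Christoffel tensors
  on overlaps is a consequence and need not be imposed.
\<close>

definition levi_civita_connection ::
  "'a chart set \<Rightarrow> ('a chart \<Rightarrow> vec8 \<Rightarrow> metric) \<Rightarrow> ('a chart \<Rightarrow> connection) \<Rightarrow> bool" where
  "levi_civita_connection \<A> g \<Gamma> \<longleftrightarrow> (\<forall>c\<in>\<A>. levi_civita_on (chart_image c) (g c) (\<Gamma> c))"

definition minimal_spin7_connection ::
  "'a chart set \<Rightarrow> ('a chart \<Rightarrow> vec8 \<Rightarrow> metric) \<Rightarrow> ('a chart \<Rightarrow> vec8 \<Rightarrow> form) \<Rightarrow>
   ('a chart \<Rightarrow> connection) \<Rightarrow> ('a chart \<Rightarrow> connection) \<Rightarrow> bool" where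
  "minimal_spin7_connection \<A> g \<Phi> \<Gamma> \<Gamma>' \<longleftrightarrow>
     (\<forall>c\<in>\<A>. minimal_connection_on (chart_image c) (g c) (\<Phi> c) (\<Gamma> c) (\<Gamma>' c))"

definition intrinsic_torsion ::
  "('a chart \<Rightarrow> connection) \<Rightarrow> ('a chart \<Rightarrow> connection) \<Rightarrow> 'a chart \<Rightarrow> vec8 \<Rightarrow> vec8 \<Rightarrow> vec8 \<Rightarrow> vec8"
  where
  "intrinsic_torsion \<Gamma> \<Gamma>' c x u v = \<Gamma>' c x u v - \<Gamma> c x u v"

definition vanishes12 :: "'a chart set \<Rightarrow> ('a chart \<Rightarrow> vec8 \<Rightarrow> vec8 \<Rightarrow> vec8 \<Rightarrow> vec8) \<Rightarrow> bool" where
  "vanishes12 \<A> T \<longleftrightarrow> (\<forall>c\<in>\<A>. \<forall>x\<in>chart_image c. \<forall>v w. T c x v w = 0)"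

definition parallel12 ::
  "'a chart set \<Rightarrow> ('a chart \<Rightarrow> connection) \<Rightarrow>
   ('a chart \<Rightarrow> vec8 \<Rightarrow> vec8 \<Rightarrow> vec8 \<Rightarrow> vec8) \<Rightarrow> bool" where
  "parallel12 \<A> \<Gamma> T \<longleftrightarrow>
     (\<forall>c\<in>\<A>. \<forall>x\<in>chart_image c. \<forall>u v w. cov_deriv12 (\<Gamma> c) (T c) x u v w = 0)"

end

theory Submission
  imports Defs
begin

text \<open>
  The obstruction is local and algebraic. Let \<open>\<theta>\<close> be the Lee form, \<open>V\<close> its metric dual and \<open>\<nabla>'\<close> the
  minimal connection. Solving \<open>d\<Phi> = \<theta> \<and> \<Phi>\<close> for the intrinsic torsion gives
  \<open>16 g(\<xi>\<^sub>u v, w) = g(u, v) \<theta>(w) - g(u, w) \<theta>(v) - \<Phi>(V, u, v, w)\<close>, so if \<open>\<nabla>'\<xi> = 0\<close> then also \<open>\<nabla>'\<theta> = 0\<close>, and the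
  three-form \<open>\<phi> = \<Phi>(V, \<cdot>, \<cdot>, \<cdot>)\<close> is parallel. The exterior derivative of a \<open>\<nabla>'\<close>-parallel form is the
  contraction with the torsion of \<open>\<nabla>'\<close>, which gives \<open>d\<phi> = 15/16 \<theta> \<and> \<phi> - 3/4 |\<theta>|\<^sup>2 \<Phi>\<close>, again a parallel
  form. Its exterior derivative is \<open>- 3/64 |\<theta>|\<^sup>2 \<theta> \<and> \<Phi>\<close>, and \<open>d(d\<phi>) = 0\<close> forces \<open>\<theta> = 0\<close>, hence \<open>\<xi> = 0\<close>.
\<close>

subsection \<open>Forms and permutations\<close>

text \<open>The constant 16 is 4 * 4. The torsion of a locally conformal parallel structure is a
  quarter of the \<open>\<Lambda>\<^sup>2\<^sub>7\<close>-part of \<open>X \<and> \<theta>\<close>,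
  and since \<open>\<star>(\<Phi> \<and> \<omega>)\<close> has eigenvalues 3 and -1, the projection
  onto that part is a quarter of \<open>\<omega> + \<star>(\<Phi> \<and> \<omega>)\<close>.

  Whether \<open>d(d\<phi>)\<close> vanishes identically is decided by constants alone: the two
  parts of \<open>d\<phi>\<close> contribute 45/64 and -48/64 of
  \<open>|\<theta>|\<^sup>2 \<theta> \<and> \<Phi>\<close>, which almost cancel.

  Regularity is the other obstacle. The Hodge star, and with it the Lee form, goes through a frame
  chosen separately at each point, and the connections come without smoothness. The equation
  \<open>d\<Phi> = \<theta> \<and> \<Phi>\<close> repairs this: wedging with \<open>\<Phi>\<close>
  is injective on one-forms, so the components of \<open>\<theta>\<close> in a smooth adapted frame
  are components of \<open>d\<Phi>\<close>.

  The algebra takes place in components, where each identity is a finite check; multilinearity and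
  skewness carry it to arbitrary vectors.\<close>

lemma is_form_cong: "is_form k \<alpha> \<Longrightarrow> (\<And>i. i < k \<Longrightarrow> v i = w i) \<Longrightarrow> \<alpha> v = \<alpha> w"
  unfolding is_form_def by blast

lemma is_form_linear: "is_form k \<alpha> \<Longrightarrow> i < k \<Longrightarrow> linear (\<lambda>y. \<alpha> (v(i := y)))"
  unfolding is_form_def by blast

lemma is_form_eq: "is_form k \<alpha> \<Longrightarrow> i < j \<Longrightarrow> j < k \<Longrightarrow> v i = v j \<Longrightarrow> \<alpha> v = 0"
  unfolding is_form_def by blast

lemma is_form_transpose:
  assumes \<alpha>: "is_form k \<alpha>" and ij: "i < k" "j < k" "i \<noteq> j"
  shows "\<alpha> (\<lambda>m. v (Transposition.transpose i j m)) = - \<alpha> v"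
proof -
  define F where "F = (\<lambda>x y. \<alpha> (v(i := x, j := y)))"
  have z: "F x x = 0" for x
    using is_form_eq[OF \<alpha>, of "min i j" "max i j"] ij by (auto simp: F_def min_def max_def)
  have l2: "F x (y + y') = F x y + F x y'" for x y y'
    unfolding F_def using linear_add[OF is_form_linear[OF \<alpha> ij(2)]] .
  have F': "F x y = \<alpha> ((v(j := y))(i := x))" for x y
    unfolding F_def using ij by (simp add: fun_upd_twist)
  have l1: "F (x + x') y = F x y + F x' y" for x x' y
    unfolding F' using linear_add[OF is_form_linear[OF \<alpha> ij(1)]] .
  have "F (v i + v j) (v i + v j) = 0" by (rule z)
  then have "F (v i) (v j) + F (v j) (v i) = 0"
    unfolding l1 l2 by (simp add: z)
  moreover have "F (v i) (v j) = \<alpha> v" by (simp add: F_def)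
  moreover have "v(i := v j, j := v i) = (\<lambda>m. v (Transposition.transpose i j m))"
    using ij by (auto simp: transpose_def)
  ultimately show ?thesis by (simp add: F_def)
qed

lemma is_form_permute:
  assumes \<alpha>: "is_form k \<alpha>" and "\<sigma> permutes {..<k}"
  shows "\<alpha> (\<lambda>i. v (\<sigma> i)) = of_int (sign \<sigma>) * \<alpha> v"
proof -
  have fin: "finite {..<k}" by simp
  have "\<forall>v. \<alpha> (\<lambda>i. v (\<sigma> i)) = of_int (sign \<sigma>) * \<alpha> v"
    using assms(2) fin
  proof (induction rule: permutes_induct)
    case id
    then show ?case by simp
  next
    case (swap a b p)
    have "permutation p" using swap.hyps by (auto simp: permutation_permutes)
    then have s: "sign (Transposition.transpose a b \<circ> p) = - sign p"
      using \<open>a \<noteq> b\<close> by (simp add: sign_compose permutation_swap_id sign_swap_id)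
    show ?case
    proof
      fix v
      have "\<alpha> (\<lambda>i. v ((Transposition.transpose a b \<circ> p) i)) = \<alpha> (\<lambda>i. (\<lambda>m. v (Transposition.transpose a b m)) (p i))" by simp
      also have "\<dots> = of_int (sign p) * \<alpha> (\<lambda>m. v (Transposition.transpose a b m))"
        by (rule swap.IH[rule_format])
      also have "\<dots> = - of_int (sign p) * \<alpha> v"
        using is_form_transpose[OF \<alpha>] swap.hyps by simp
      finally show "\<alpha> (\<lambda>i. v ((Transposition.transpose a b \<circ> p) i)) = of_int (sign (Transposition.transpose a b \<circ> p)) * \<alpha> v"
        by (simp add: s)
    qed
  qed
  then show ?thesis by blast
qed

section \<open>Expansion of wedge products along the first factor\<close>

text \<open>A permutation \<open>\<sigma>\<close> of \<open>{..n}\<close> factors uniquely as the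
  transposition of 0 and \<open>b = \<sigma> 0\<close> after a permutation fixing 0. Compared with a
  Laplace expansion, column 0 moves into the place of column \<open>b\<close>, so every term with
  \<open>b \<noteq> 0\<close> carries the sign -1 instead of alternating signs.\<close>

lemma sum_permutes_Suc:
  "(\<Sum>\<sigma> | \<sigma> permutes {..<Suc n}. h \<sigma>) =
    (\<Sum>b\<le>n. \<Sum>\<tau> | \<tau> permutes {..<n}. h (Transposition.transpose 0 b \<circ> map_permutation {..<n} Suc \<tau>))"
proof -
  have bij: "bij_betw Suc {..<n} (Suc ` {..<n})" by (simp add: bij_betw_def)
  have ins: "{..<Suc n} = insert 0 (Suc ` {..<n})"
    by (auto simp: image_iff less_Suc_eq_0_disj)
  have "bij_betw (map_permutation {..<n} Suc) {\<tau>. \<tau> permutes {..<n}} {q. q permutes Suc ` {..<n}}"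
  proof (rule bij_betw_byWitness[where f' = "map_permutation (Suc ` {..<n}) (\<lambda>i. i - 1)"])
    have bij': "bij_betw (\<lambda>i. i - 1) (Suc ` {..<n}) {..<n}"
      by (rule bij_betw_byWitness[where f' = Suc]) auto
    show "\<forall>a\<in>{\<tau>. \<tau> permutes {..<n}}.
        map_permutation (Suc ` {..<n}) (\<lambda>i. i - 1) (map_permutation {..<n} Suc a) = a"
      using map_permutation_compose_inv[OF bij] by auto
    show "\<forall>a'\<in>{q. q permutes Suc ` {..<n}}.
        map_permutation {..<n} Suc (map_permutation (Suc ` {..<n}) (\<lambda>i. i - 1) a') = a'"
      by (intro ballI map_permutation_compose_inv[OF bij']) auto
    show "map_permutation {..<n} Suc ` {\<tau>. \<tau> permutes {..<n}} \<subseteq> {q. q permutes Suc ` {..<n}}"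
      using map_permutation_permutes[OF bij] by auto
    show "map_permutation (Suc ` {..<n}) (\<lambda>i. i - 1) ` {q. q permutes Suc ` {..<n}} \<subseteq> {\<tau>. \<tau> permutes {..<n}}"
      using map_permutation_permutes[OF bij'] by auto
  qed
  then have re: "(\<Sum>q | q permutes Suc ` {..<n}. k q) =
      (\<Sum>\<tau> | \<tau> permutes {..<n}. k (map_permutation {..<n} Suc \<tau>))" for k :: "_ \<Rightarrow> 'a"
    by (rule sum.reindex_bij_betw[symmetric])
  have "{..n} = insert 0 (Suc ` {..<n})"
    using ins by (simp add: lessThan_Suc_atMost)
  then show ?thesis
    using sum_over_permutations_insert[of "Suc ` {..<n}" 0 h] by (simp only: ins re) simp
qed

lemma
  assumes "\<tau> permutes {..<n}"
  shows map_permutation_Suc_0: "map_permutation {..<n} Suc \<tau> 0 = 0"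
    and map_permutation_Suc_Suc: "map_permutation {..<n} Suc \<tau> (Suc i) = Suc (\<tau> i)"
    and sign_transpose_map_permutation_Suc: "sign (Transposition.transpose 0 b \<circ> map_permutation {..<n} Suc \<tau>)
           = (if b = 0 then 1 else - 1) * sign \<tau>"
proof -
  show "map_permutation {..<n} Suc \<tau> 0 = 0"
    by (auto simp: map_permutation_def restrict_id_def)
  show "map_permutation {..<n} Suc \<tau> (Suc i) = Suc (\<tau> i)"
  proof (cases "i < n")
    case True
    then show ?thesis using map_permutation_apply[of Suc "{..<n}" i \<tau>] by simp
  next
    case False
    then show ?thesis using assms by (auto simp: map_permutation_def restrict_id_def permutes_def)
  qed
  have "map_permutation {..<n} Suc \<tau> permutes Suc ` {..<n}"
    using assms by (intro map_permutation_permutes) (auto simp: bij_betw_def)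
  then have "permutation (map_permutation {..<n} Suc \<tau>)"
    by (auto simp: permutation_permutes)
  moreover have "sign (map_permutation {..<n} Suc \<tau>) = sign \<tau>"
    using assms by (intro sign_map_permutation) auto
  ultimately show "sign (Transposition.transpose 0 b \<circ> map_permutation {..<n} Suc \<tau>)
           = (if b = 0 then 1 else - 1) * sign \<tau>"
    by (simp add: sign_compose permutation_swap_id sign_swap_id)
qed

text \<open>Among the permutations with \<open>b = \<sigma> 0\<close>, the \<open>q!\<close>
  arrangements of the other slots give equal summands, because the sign of \<open>\<tau>\<close>
  cancels the one produced by the alternating \<open>\<beta>\<close>. This absorbs the division by
  \<open>fact q\<close>.\<close>

lemma wedge_one_form:
  assumes \<alpha>: "is_form 1 \<alpha>" and \<beta>: "is_form q \<beta>"
  shows "wedge 1 q \<alpha> \<beta> v = (\<Sum>b\<le>q. (if b = 0 then 1 else - 1) *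
     \<alpha> (\<lambda>_. v b) * \<beta> (\<lambda>i. v (Transposition.transpose 0 b (Suc i))))"
proof -
  have "wedge 1 q \<alpha> \<beta> v = (\<Sum>b\<le>q. \<Sum>\<tau> | \<tau> permutes {..<q}. (if b = 0 then 1 else - 1) *
     \<alpha> (\<lambda>_. v b) * \<beta> (\<lambda>i. v (Transposition.transpose 0 b (Suc i)))) / fact q"
  proof -
    have *: "of_int (sign (Transposition.transpose 0 b \<circ> map_permutation {..<q} Suc \<tau>)) *
         \<alpha> (\<lambda>i. v ((Transposition.transpose 0 b \<circ> map_permutation {..<q} Suc \<tau>) i)) *
         \<beta> (\<lambda>i. v ((Transposition.transpose 0 b \<circ> map_permutation {..<q} Suc \<tau>) (Suc i)))
      = (if b = 0 then 1 else - 1) * \<alpha> (\<lambda>_. v b) * \<beta> (\<lambda>i. v (Transposition.transpose 0 b (Suc i)))"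
      if \<tau>: "\<tau> permutes {..<q}" for b \<tau>
    proof -
      have a: "\<alpha> (\<lambda>i. v ((Transposition.transpose 0 b \<circ> map_permutation {..<q} Suc \<tau>) i)) = \<alpha> (\<lambda>_. v b)"
        by (rule is_form_cong[OF \<alpha>]) (simp add: map_permutation_Suc_0[OF \<tau>])
      have b: "\<beta> (\<lambda>i. v ((Transposition.transpose 0 b \<circ> map_permutation {..<q} Suc \<tau>) (Suc i)))
         = of_int (sign \<tau>) * \<beta> (\<lambda>i. v (Transposition.transpose 0 b (Suc i)))"
        using is_form_permute[OF \<beta> \<tau>, of "\<lambda>i. v (Transposition.transpose 0 b (Suc i))"]
        by (simp add: map_permutation_Suc_Suc[OF \<tau>])
      have "real_of_int (sign \<tau>) * real_of_int (sign \<tau>) = 1"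
        by (metis of_int_1 of_int_mult sign_idempotent)
      then show ?thesis
        unfolding a b sign_transpose_map_permutation_Suc[OF \<tau>] by simp
    qed
    show ?thesis
      unfolding wedge_def by (simp add: sum_permutes_Suc * del: comp_apply)
  qed
  also have "\<dots> = (\<Sum>b\<le>q. (if b = 0 then 1 else - 1) *
     \<alpha> (\<lambda>_. v b) * \<beta> (\<lambda>i. v (Transposition.transpose 0 b (Suc i))))"
    by (simp add: card_permutations sum_divide_distrib)
  finally show ?thesis .
qed

text \<open>Determinant expansion phrased on lists: exchanging positions 0 and \<open>Suc b\<close>
  puts the head \<open>a\<close> into position \<open>b\<close> of the tail, whence
  \<open>as[b := a]\<close>.\<close>

lemma wedge1_Cons:
  assumes "length as = length T"
  shows "wedge1 \<epsilon> (t # T) (nth (a # as)) = \<epsilon> t a * wedge1 \<epsilon> T (nth as)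
      - (\<Sum>b<length as. \<epsilon> t (as ! b) * wedge1 \<epsilon> T (nth (as[b := a])))"
proof -
  let ?n = "length T"
  define G where "G b = (if b = 0 then 1 else - 1) * \<epsilon> t ((a # as) ! b) *
     wedge1 \<epsilon> T (\<lambda>i. (a # as) ! Transposition.transpose 0 b (Suc i))" for b
  have *: "of_int (sign (Transposition.transpose 0 b \<circ> map_permutation {..<?n} Suc \<tau>)) *
     (\<Prod>m<length (t # T). \<epsilon> ((t # T) ! m)
        ((a # as) ! (Transposition.transpose 0 b \<circ> map_permutation {..<?n} Suc \<tau>) m))
     = (if b = 0 then 1 else - 1) * \<epsilon> t ((a # as) ! b) * (of_int (sign \<tau>) *
        (\<Prod>m<?n. \<epsilon> (T ! m) ((a # as) ! Transposition.transpose 0 b (Suc (\<tau> m)))))"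
    if \<tau>: "\<tau> permutes {..<?n}" for b \<tau>
    unfolding sign_transpose_map_permutation_Suc[OF \<tau>]
    by (simp add: prod.lessThan_Suc_shift map_permutation_Suc_0[OF \<tau>] map_permutation_Suc_Suc[OF \<tau>]
        del: prod.lessThan_Suc)
  have "wedge1 \<epsilon> (t # T) (nth (a # as)) = (\<Sum>b\<le>?n. G b)"
    unfolding wedge1_def G_def list.size(4) add_Suc_right add_0_right sum_permutes_Suc
    using * by (simp add: sum_distrib_left del: comp_apply prod.lessThan_Suc)
  also have "\<dots> = G 0 + (\<Sum>b<?n. G (Suc b))"
    by (simp add: lessThan_Suc_atMost[symmetric] sum.lessThan_Suc_shift del: sum.lessThan_Suc)
  also have "G 0 = \<epsilon> t a * wedge1 \<epsilon> T (nth as)"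
    by (simp add: G_def)
  also have "(\<Sum>b<?n. G (Suc b)) = (\<Sum>b<?n. - (\<epsilon> t (as ! b) * wedge1 \<epsilon> T (nth (as[b := a]))))"
  proof (rule sum.cong[OF refl])
    fix b assume "b \<in> {..<?n}"
    have "wedge1 \<epsilon> T (\<lambda>i. (a # as) ! Transposition.transpose 0 (Suc b) (Suc i)) = wedge1 \<epsilon> T (nth (as[b := a]))"
      unfolding wedge1_def
    proof (intro sum.cong[OF refl] arg_cong2[where f = "(*)"] prod.cong refl)
      fix \<sigma> m assume "\<sigma> \<in> {\<sigma>. \<sigma> permutes {..<?n}}" "m \<in> {..<?n}"
      then have "\<sigma> m < length as"
        using assms permutes_in_image[of \<sigma> "{..<?n}" m] by simp
      then show "\<epsilon> (T ! m) ((a # as) ! Transposition.transpose 0 (Suc b) (Suc (\<sigma> m))) =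
          \<epsilon> (T ! m) (as[b := a] ! \<sigma> m)"
        by (auto simp: Transposition.transpose_def nth_list_update)
    qed
    then show "G (Suc b) = - (\<epsilon> t (as ! b) * wedge1 \<epsilon> T (nth (as[b := a])))"
      by (simp add: G_def)
  qed
  finally show ?thesis
    using assms by (simp add: sum_negf)
qed

lemma wedge1_Nil: "wedge1 \<epsilon> [] v = 1"
  by (simp add: wedge1_def)

lemma wedge1_permute:
  assumes \<sigma>: "\<sigma> permutes {..<length T}"
  shows "wedge1 \<epsilon> T (\<lambda>i. v (\<sigma> i)) = of_int (sign \<sigma>) * wedge1 \<epsilon> T v"
proof -
  have "wedge1 \<epsilon> T v = (\<Sum>\<tau> | \<tau> permutes {..<length T}.
      of_int (sign (\<sigma> \<circ> \<tau>)) * (\<Prod>m<length T. \<epsilon> (T ! m) (v ((\<sigma> \<circ> \<tau>) m))))"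
    unfolding wedge1_def
    by (rule setum_permutations_compose_left[OF \<sigma>, where f = "\<lambda>\<tau>. of_int (sign \<tau>) * (\<Prod>m<length T. \<epsilon> (T ! m) (v (\<tau> m)))"])
  also have "\<dots> = of_int (sign \<sigma>) * wedge1 \<epsilon> T (\<lambda>i. v (\<sigma> i))"
    unfolding wedge1_def sum_distrib_left
  proof (rule sum.cong[OF refl])
    fix \<tau> assume "\<tau> \<in> {\<tau>. \<tau> permutes {..<length T}}"
    then have "sign (\<sigma> \<circ> \<tau>) = sign \<sigma> * sign \<tau>"
      using \<sigma> by (auto intro!: sign_compose simp: permutation_permutes)
    then show "of_int (sign (\<sigma> \<circ> \<tau>)) * (\<Prod>m<length T. \<epsilon> (T ! m) (v ((\<sigma> \<circ> \<tau>) m))) =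
        of_int (sign \<sigma>) * (of_int (sign \<tau>) * (\<Prod>m<length T. \<epsilon> (T ! m) (v (\<sigma> (\<tau> m)))))"
      by simp
  qed
  finally show ?thesis by (cases \<sigma> rule: sign_cases) auto
qed

section \<open>Hodge star of a wedge product\<close>

lemma sum_PiE_permute:
  fixes A :: "'a set" and B :: "'b set"
  assumes "\<sigma> permutes A"
  shows "(\<Sum>I\<in>A \<rightarrow>\<^sub>E B. h (\<lambda>i. I (\<sigma> i))) = (\<Sum>I\<in>A \<rightarrow>\<^sub>E B. h I)"
proof (rule sum.reindex_bij_betw)
  have mem: "(\<lambda>i. I (\<tau> i)) \<in> A \<rightarrow>\<^sub>E B" if "I \<in> A \<rightarrow>\<^sub>E B" "\<tau> permutes A" for I :: "'a \<Rightarrow> 'b" and \<tau>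
    using that permutes_in_image[OF that(2)] permutes_not_in[OF that(2)]
    by (auto simp: PiE_iff extensional_def)
  show "bij_betw (\<lambda>I i. I (\<sigma> i)) (A \<rightarrow>\<^sub>E B) (A \<rightarrow>\<^sub>E B)"
    by (rule bij_betw_byWitness[where f' = "\<lambda>I i. I (inv \<sigma> i)"])
       (use mem assms permutes_inv[OF assms] permutes_inverses[OF assms] in \<open>auto simp: image_subset_iff\<close>)
qed

text \<open>Reindexing \<open>I\<close> by \<open>\<sigma>\<close> changes the volume form by
  \<open>sign \<sigma>\<close>, which cancels the sign in the wedge product. Hence all
  \<open>(p + q)!\<close> permutations contribute the same and cancel the factorial of the Hodge
  star.\<close>

lemma hodge_frame_wedge:
  assumes pq: "p + q \<le> 8"
  shows "hodge_frame g e (p + q) (wedge p q \<alpha> \<beta>) v = (\<Sum>I \<in> {..<p + q} \<rightarrow>\<^sub>E {..<8}.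
      \<alpha> (\<lambda>m. e (I m)) * \<beta> (\<lambda>m. e (I (p + m))) *
      wedge1 (coframe g e) [0..<8] (\<lambda>m. if m < p + q then e (I m) else v (m - (p + q)))) / (fact p * fact q)"
proof -
  let ?S = "{..<p + q} \<rightarrow>\<^sub>E {..<8::nat}"
  define vol where "vol I = wedge1 (coframe g e) [0..<8] (\<lambda>m. if m < p + q then e (I m) else v (m - (p + q)))" for I
  define H where "H I = \<alpha> (\<lambda>m. e (I m)) * \<beta> (\<lambda>m. e (I (p + m))) * vol I" for I
  have *: "(\<Sum>I\<in>?S. of_int (sign \<sigma>) * \<alpha> (\<lambda>m. e (I (\<sigma> m))) * \<beta> (\<lambda>m. e (I (\<sigma> (p + m)))) * vol I) = (\<Sum>I\<in>?S. H I)"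
    if \<sigma>: "\<sigma> permutes {..<p + q}" for \<sigma>
  proof -
    have "\<sigma> permutes {..<length [0..<8::nat]}"
      by (rule permutes_subset[OF \<sigma>]) (use pq in auto)
    from wedge1_permute[OF this, of "coframe g e" "\<lambda>m. if m < p + q then e (I m) else v (m - (p + q))" for I]
    have "wedge1 (coframe g e) [0..<8] (\<lambda>m. if \<sigma> m < p + q then e (I (\<sigma> m)) else v (\<sigma> m - (p + q))) = of_int (sign \<sigma>) * vol I" for I
      by (simp add: vol_def)
    moreover have "(if \<sigma> m < p + q then e (I (\<sigma> m)) else v (\<sigma> m - (p + q))) = (if m < p + q then e (I (\<sigma> m)) else v (m - (p + q)))" for I m
      using permutes_in_image[OF \<sigma>, of m] permutes_not_in[OF \<sigma>, of m] by auto
    ultimately have "vol (\<lambda>m. I (\<sigma> m)) = of_int (sign \<sigma>) * vol I" for I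
      by (simp add: vol_def)
    then have "(\<Sum>I\<in>?S. of_int (sign \<sigma>) * \<alpha> (\<lambda>m. e (I (\<sigma> m))) * \<beta> (\<lambda>m. e (I (\<sigma> (p + m)))) * vol I) = (\<Sum>I\<in>?S. H (\<lambda>m. I (\<sigma> m)))"
      by (simp add: H_def mult_ac)
    also have "\<dots> = (\<Sum>I\<in>?S. H I)" by (rule sum_PiE_permute[OF \<sigma>])
    finally show ?thesis .
  qed
  have "hodge_frame g e (p + q) (wedge p q \<alpha> \<beta>) v = (\<Sum>I\<in>?S. (\<Sum>\<sigma> | \<sigma> permutes {..<p + q}.
      of_int (sign \<sigma>) * \<alpha> (\<lambda>m. e (I (\<sigma> m))) * \<beta> (\<lambda>m. e (I (\<sigma> (p + m)))) * vol I)) / (fact p * fact q) / fact (p + q)"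
    unfolding hodge_frame_def wedge_def vol_def
    by (simp add: sum_divide_distrib sum_distrib_right)
  also have "\<dots> = (\<Sum>\<sigma> | \<sigma> permutes {..<p + q}. \<Sum>I\<in>?S.
      of_int (sign \<sigma>) * \<alpha> (\<lambda>m. e (I (\<sigma> m))) * \<beta> (\<lambda>m. e (I (\<sigma> (p + m)))) * vol I) / (fact p * fact q) / fact (p + q)"
    by (subst sum.swap) simp
  also have "\<dots> = (\<Sum>I\<in>?S. H I) / (fact p * fact q)"
    by (simp add: * card_permutations)
  finally show ?thesis by (simp add: H_def vol_def)
qed

lemma sum_list_mult_sum:
  fixes W :: "'a \<Rightarrow> 'b \<Rightarrow> real"
  shows "(\<Sum>I\<in>A. (\<Sum>(s, T)\<leftarrow>L. s * W T I) * X I) = (\<Sum>(s, T)\<leftarrow>L. s * (\<Sum>I\<in>A. W T I * X I))"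
  by (induction L) (auto simp: distrib_right sum.distrib sum_distrib_left mult.assoc)

text \<open>The same reindexing makes the \<open>4! = 24\<close> permutations in the monomial
  contribute equally. Orthonormality then forces the first four indices of \<open>I\<close> to be
  \<open>T\<close>, so that of the \<open>8^6\<close> index families only 64, the choices of
  \<open>k\<close> and \<open>l\<close>, survive.\<close>

lemma hodge_frame_wedge_wedge1:
  assumes on: "orthonormal_frame g e" and T: "length T = 4" "set T \<subseteq> {..<8}"
    and \<beta>: "is_form 2 \<beta>"
  shows "(\<Sum>I \<in> {..<6} \<rightarrow>\<^sub>E {..<8}. wedge1 (coframe g e) T (\<lambda>m. e (I m)) * (\<beta> (\<lambda>m. e (I (4 + m))) *
      wedge1 (coframe g e) [0..<8] (\<lambda>m. if m < 6 then e (I m) else nth [a, b] (m - 6))))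
    = 24 * (\<Sum>k<8. \<Sum>l<8. \<beta> (nth [e k, e l]) * wedge1 (coframe g e) [0..<8] (nth (map e T @ [e k, e l, a, b])))"
proof -
  let ?S = "{..<6::nat} \<rightarrow>\<^sub>E {..<8::nat}"
  define R where "R I = \<beta> (\<lambda>m. e (I (4 + m))) *
      wedge1 (coframe g e) [0..<8] (\<lambda>m. if m < 6 then e (I m) else nth [a, b] (m - 6))" for I :: "nat \<Rightarrow> nat"
  define K where "K I = (\<Prod>m<4. if T ! m = I m then 1 else 0) * R I" for I
  have on': "coframe g e i (e j) = (if i = j then 1 else 0)" if "i < 8" "j < 8" for i j
    using on that by (auto simp: orthonormal_frame_def coframe_def)
  have Tm: "T ! m < 8" if "m < 4" for m
    using that T nth_mem[of m T] by (metis lessThan_iff subsetD)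
  have step: "(\<Sum>I\<in>?S. of_int (sign \<sigma>) * (\<Prod>m<4. coframe g e (T ! m) (e (I (\<sigma> m)))) * R I) = (\<Sum>I\<in>?S. K I)"
    if \<sigma>: "\<sigma> permutes {..<4}" for \<sigma>
  proof -
    have \<sigma>6: "\<sigma> permutes {..<6}"
      by (rule permutes_subset[OF \<sigma>]) auto
    have \<sigma>8: "\<sigma> permutes {..<length [0..<8::nat]}"
      by (rule permutes_subset[OF \<sigma>]) auto
    have fx: "\<sigma> (4 + m) = 4 + m" for m
      using permutes_not_in[OF \<sigma>, of "4 + m"] by simp
    have lt6: "\<sigma> m < 6 \<longleftrightarrow> m < 6" for m
      using permutes_in_image[OF \<sigma>6, of m] by simp
    have ge6: "\<sigma> m = m" if "\<not> m < 6" for m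
      using permutes_not_in[OF \<sigma>6, of m] that by simp
    have vol: "wedge1 (coframe g e) [0..<8] (\<lambda>m. if m < 6 then e (I (\<sigma> m)) else nth [a, b] (m - 6))
      = of_int (sign \<sigma>) * wedge1 (coframe g e) [0..<8] (\<lambda>m. if m < 6 then e (I m) else nth [a, b] (m - 6))" for I :: "nat \<Rightarrow> nat"
    proof -
      have "(\<lambda>m. if m < 6 then e (I (\<sigma> m)) else nth [a, b] (m - 6)) =
         (\<lambda>m. if \<sigma> m < 6 then e (I (\<sigma> m)) else nth [a, b] (\<sigma> m - 6))"
        using lt6 ge6 by auto
      then show ?thesis
        using wedge1_permute[OF \<sigma>8, of "coframe g e" "\<lambda>m. if m < 6 then e (I m) else nth [a, b] (m - 6)"] by simp
    qed
    have R: "R (\<lambda>m. I (\<sigma> m)) = of_int (sign \<sigma>) * R I" for I :: "nat \<Rightarrow> nat"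
      unfolding R_def vol fx by simp
    have "(\<Sum>I\<in>?S. of_int (sign \<sigma>) * (\<Prod>m<4. coframe g e (T ! m) (e (I (\<sigma> m)))) * R I) = (\<Sum>I\<in>?S. K (\<lambda>m. I (\<sigma> m)))"
    proof (rule sum.cong[OF refl])
      fix I :: "nat \<Rightarrow> nat" assume I: "I \<in> ?S"
      have "(\<Prod>m<4. coframe g e (T ! m) (e (I (\<sigma> m)))) = (\<Prod>m<4. if T ! m = I (\<sigma> m) then 1 else 0)"
      proof (rule prod.cong[OF refl])
        fix m :: nat assume "m \<in> {..<4}"
        then have "\<sigma> m < 6" "T ! m < 8" using permutes_in_image[OF \<sigma>6, of m] Tm by auto
        moreover have "I (\<sigma> m) < 8" using I \<open>\<sigma> m < 6\<close> by (auto simp: PiE_iff)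
        ultimately show "coframe g e (T ! m) (e (I (\<sigma> m))) = (if T ! m = I (\<sigma> m) then 1 else 0)"
          by (simp add: on')
      qed
      then show "of_int (sign \<sigma>) * (\<Prod>m<4. coframe g e (T ! m) (e (I (\<sigma> m)))) * R I = K (\<lambda>m. I (\<sigma> m))"
        unfolding K_def R by simp
    qed
    also have "\<dots> = (\<Sum>I\<in>?S. K I)" by (rule sum_PiE_permute[OF \<sigma>6])
    finally show ?thesis .
  qed
  have "(\<Sum>I\<in>?S. wedge1 (coframe g e) T (\<lambda>m. e (I m)) * R I) = (\<Sum>I\<in>?S. (\<Sum>\<sigma> | \<sigma> permutes {..<4}.
      of_int (sign \<sigma>) * (\<Prod>m<4. coframe g e (T ! m) (e (I (\<sigma> m)))) * R I))"
    unfolding wedge1_def T(1) by (simp add: sum_distrib_right)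
  also have "\<dots> = (\<Sum>\<sigma> | \<sigma> permutes {..<4}. \<Sum>I\<in>?S. of_int (sign \<sigma>) * (\<Prod>m<4. coframe g e (T ! m) (e (I (\<sigma> m)))) * R I)"
    by (rule sum.swap)
  also have "\<dots> = 24 * (\<Sum>I\<in>?S. K I)"
    by (simp add: step card_permutations fact_numeral)
  also have "(\<Sum>I\<in>?S. K I) = (\<Sum>I\<in>{I\<in>?S. \<forall>m<4. I m = T ! m}. R I)"
  proof (rule sum.mono_neutral_cong_right)
    show "finite ?S" by (intro finite_PiE) auto
    show "\<forall>I\<in>?S - {I \<in> ?S. \<forall>m<4. I m = T ! m}. K I = 0"
    proof
      fix I assume "I \<in> ?S - {I \<in> ?S. \<forall>m<4. I m = T ! m}"
      then obtain m :: nat where "m < 4" "T ! m \<noteq> I m" by force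
      then have "(\<Prod>m<4. if T ! m = I m then 1 else (0::real)) = 0"
        by (intro prod_zero) auto
      then show "K I = 0" by (simp add: K_def)
    qed
  qed (auto simp: K_def)
  also have "\<dots> = (\<Sum>(k, l)\<in>{..<8}\<times>{..<8}. R (\<lambda>m\<in>{..<6}. (T @ [k, l]) ! m))"
  proof (rule sum.reindex_bij_witness[where
        j = "\<lambda>I. (I 4, I 5)" and i = "\<lambda>(k, l). \<lambda>m\<in>{..<6}. (T @ [k, l]) ! m"])
    fix I assume I: "I \<in> {I \<in> ?S. \<forall>m<4. I m = T ! m}"
    have "(T @ [I 4, I 5]) ! m = I m" if "m < 6" for m
    proof -
      have "m < 4 \<or> m = 4 \<or> m = 5" using that by auto
      then show ?thesis using I T(1) by (auto simp: nth_append)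
    qed
    then show *: "(case (I 4, I 5) of (k, l) \<Rightarrow> \<lambda>m\<in>{..<6}. (T @ [k, l]) ! m) = I"
      using I by (auto simp: PiE_iff restrict_def extensional_def fun_eq_iff)
    then show "(case (I 4, I 5) of (k, l) \<Rightarrow> R (\<lambda>m\<in>{..<6}. (T @ [k, l]) ! m)) = R I"
      by simp
    show "(I 4, I 5) \<in> {..<8} \<times> {..<8}" using I by (auto simp: PiE_iff)
  next
    fix kl :: "nat \<times> nat" assume kl: "kl \<in> {..<8} \<times> {..<8}"
    obtain k l where [simp]: "kl = (k, l)" by (cases kl)
    show "((case kl of (k, l) \<Rightarrow> \<lambda>m\<in>{..<6}. (T @ [k, l]) ! m) 4, (case kl of (k, l) \<Rightarrow> \<lambda>m\<in>{..<6}. (T @ [k, l]) ! m) 5) = kl"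
      using T(1) by (simp add: nth_append)
    have "(T @ [k, l]) ! m < 8" if "m < 6" for m
    proof -
      have "(T @ [k, l]) ! m \<in> set (T @ [k, l])" by (rule nth_mem) (use that T(1) in simp)
      then show ?thesis using T(2) kl by auto
    qed
    then show "(case kl of (k, l) \<Rightarrow> \<lambda>m\<in>{..<6}. (T @ [k, l]) ! m) \<in> {I \<in> ?S. \<forall>m<4. I m = T ! m}"
      using T(1) by (auto simp: nth_append)
  qed
  also have "\<dots> = (\<Sum>k<8. \<Sum>l<8. R (\<lambda>m\<in>{..<6}. (T @ [k, l]) ! m))"
    by (simp add: sum.cartesian_product)
  also have "\<dots> = (\<Sum>k<8. \<Sum>l<8. \<beta> (nth [e k, e l]) * wedge1 (coframe g e) [0..<8] (nth (map e T @ [e k, e l, a, b])))"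
  proof (intro sum.cong refl)
    fix k l :: nat
    have "\<beta> (\<lambda>m. e ((\<lambda>m\<in>{..<6}. (T @ [k, l]) ! m) (4 + m))) = \<beta> (nth [e k, e l])"
      by (rule is_form_cong[OF \<beta>]) (use T(1) in \<open>auto simp: less_2_cases_iff nth_append\<close>)
    moreover have "wedge1 (coframe g e) [0..<8] (\<lambda>m. if m < 6 then e ((\<lambda>m\<in>{..<6}. (T @ [k, l]) ! m) m) else nth [a, b] (m - 6))
       = wedge1 (coframe g e) [0..<8] (nth (map e T @ [e k, e l, a, b]))"
    proof -
      have *: "(if m < 6 then e ((\<lambda>m\<in>{..<6}. (T @ [k, l]) ! m) m) else nth [a, b] (m - 6)) = (map e T @ [e k, e l, a, b]) ! m" if "m < 8" for m
      proof -
        have "m < 4 \<or> m = 4 \<or> m = 5 \<or> m = 6 \<or> m = 7" using that by auto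
        then show ?thesis using T(1) by (auto simp: nth_append)
      qed
      show ?thesis
        unfolding wedge1_def
      proof (intro sum.cong[OF refl] arg_cong2[where f = "(*)"] prod.cong refl)
        fix \<sigma> m assume "\<sigma> \<in> {\<sigma>. \<sigma> permutes {..<length [0..<8::nat]}}" "m \<in> {..<length [0..<8::nat]}"
        then have "\<sigma> m < 8" using permutes_in_image[of \<sigma> "{..<8}" m] by simp
        from *[OF this]
        show "coframe g e ([0..<8] ! m) (if \<sigma> m < 6 then e ((\<lambda>m\<in>{..<6}. (T @ [k, l]) ! m) (\<sigma> m)) else nth [a, b] (\<sigma> m - 6)) =
          coframe g e ([0..<8] ! m) ((map e T @ [e k, e l, a, b]) ! \<sigma> m)" by (rule arg_cong)
      qed
    qed
    ultimately show "R (\<lambda>m\<in>{..<6}. (T @ [k, l]) ! m) = \<beta> (nth [e k, e l]) * wedge1 (coframe g e) [0..<8] (nth (map e T @ [e k, e l, a, b]))"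
      unfolding R_def by simp
  qed
  finally show ?thesis by (simp add: R_def)
qed

subsection \<open>Algebra of the Cayley form in coordinates\<close>

lemma sum_lessThan_8: "(\<Sum>i<8. h i) = h 0 + h 1 + h 2 + h 3 + h 4 + h 5 + h 6 + h (7::nat)"
  by (simp add: eval_nat_numeral add.assoc)

lemma all_less_numeral:
  "(\<forall>i<(0::nat). Q i) = True" "(\<forall>i<(1::nat). Q i) = Q 0"
  "(\<forall>i<(2::nat). Q i) = (Q 0 \<and> Q 1)"
  "(\<forall>i<(3::nat). Q i) = (Q 0 \<and> Q 1 \<and> Q 2)"
  "(\<forall>i<(4::nat). Q i) = (Q 0 \<and> Q 1 \<and> Q 2 \<and> Q 3)"
  "(\<forall>i<(5::nat). Q i) = (Q 0 \<and> Q 1 \<and> Q 2 \<and> Q 3 \<and> Q 4)"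
  "(\<forall>i<(6::nat). Q i) = (Q 0 \<and> Q 1 \<and> Q 2 \<and> Q 3 \<and> Q 4 \<and> Q 5)"
  "(\<forall>i<(7::nat). Q i) = (Q 0 \<and> Q 1 \<and> Q 2 \<and> Q 3 \<and> Q 4 \<and> Q 5 \<and> Q 6)"
  "(\<forall>i<(8::nat). Q i) = (Q 0 \<and> Q 1 \<and> Q 2 \<and> Q 3 \<and> Q 4 \<and> Q 5 \<and> Q 6 \<and> Q 7)"
  by (auto simp: numeral_eq_Suc All_less_Suc)

text \<open>Insertion sort by adjacent swaps: the last index is inserted into an increasing triple,
  then the third into an increasing pair, and finally the first two are ordered. A repeated index
  makes the value its own negative.\<close>

lemma skew4_eq_0:
  fixes G :: "nat \<Rightarrow> nat \<Rightarrow> nat \<Rightarrow> nat \<Rightarrow> real"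
  assumes s12: "\<And>a b c d. G b a c d = - G a b c d"
    and s23: "\<And>a b c d. G a c b d = - G a b c d"
    and s34: "\<And>a b c d. G a b d c = - G a b c d"
    and 0: "\<And>a b c d. a < b \<Longrightarrow> b < c \<Longrightarrow> c < d \<Longrightarrow> d < n \<Longrightarrow> G a b c d = 0"
    and n: "a < n" "b < n" "c < n" "d < n"
  shows "G a b c d = 0"
proof -
  have e12: "G a a c d = 0" for a c d using s12[of a a c d] by simp
  have e23: "G a b b d = 0" for a b d using s23[of a b b d] by simp
  have e34: "G a b c c = 0" for a b c using s34[of a b c c] by simp
  have 1: "G a b c d = 0" if "a < b" "b < c" "c < n" "d < n" for a b c d
  proof -
    consider "c < d" | "d = c" | "b < d" "d < c" | "d = b" | "a < d" "d < b" | "d = a" | "d < a"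
      by linarith
    then show ?thesis
      using that 0[of a b c d] 0[of a b d c] 0[of a d b c] 0[of d a b c]
        s34[of a b c d] s23[of a b d c] s12[of a d b c] e12 e23 e34
      by cases auto
  qed
  have 2: "G a b c d = 0" if "a < b" "b < n" "c < n" "d < n" for a b c d
  proof -
    consider "b < c" | "c = b" | "a < c" "c < b" | "c = a" | "c < a"
      by linarith
    then show ?thesis
      using that 1[of a b c d] 1[of a c b d] 1[of c a b d] s23[of a b c d] s12[of a c b d] e12 e23
      by cases auto
  qed
  consider "a < b" | "a = b" | "b < a" by linarith
  then show ?thesis
    using n 2[of a b c d] 2[of b a c d] s12[of a b c d] e12 by cases auto
qed

section \<open>Components of the Cayley form in an adapted frame\<close>

text \<open>The Cayley form stripped of vectors and forms. Skewness and the 70 values on increasing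
  quadruples turn the identities below into finite computations for the simplifier.\<close>

locale spin7_tensor =
  fixes P :: "nat \<Rightarrow> nat \<Rightarrow> nat \<Rightarrow> nat \<Rightarrow> real"
  assumes skew12: "P b a c d = - P a b c d"
    and skew23: "P a c b d = - P a b c d"
    and skew34: "P a b d c = - P a b c d"
    and ordered: "a < b \<Longrightarrow> b < c \<Longrightarrow> c < d \<Longrightarrow> d < 8 \<Longrightarrow>
      P a b c d = (\<Sum>(s, I)\<leftarrow>spin7_terms. if I = [a, b, c, d] then s else 0)"
begin

lemma same: "P a a c d = 0" "P a b b d = 0" "P a b c c = 0"
  using skew12[of a a c d] skew23[of a b b d] skew34[of a b c c] by simp_all

text \<open>The side conditions orient skewness towards increasing indices, so that it terminates as
  a rewrite rule.\<close>

lemma sort: "a < b \<Longrightarrow> P b a c d = - P a b c d"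
  "b < c \<Longrightarrow> P a c b d = - P a b c d"
  "c < d \<Longrightarrow> P a b d c = - P a b c d"
  by (rule skew12, rule skew23, rule skew34)

lemma table:
  "P 0 1 2 3 = 1" "P 0 1 2 4 = 0" "P 0 1 2 5 = 0" "P 0 1 2 6 = 0" "P 0 1 2 7 = 0"
  "P 0 1 3 4 = 0" "P 0 1 3 5 = 0" "P 0 1 3 6 = 0" "P 0 1 3 7 = 0" "P 0 1 4 5 = - 1"
  "P 0 1 4 6 = 0" "P 0 1 4 7 = 0" "P 0 1 5 6 = 0" "P 0 1 5 7 = 0" "P 0 1 6 7 = - 1"
  "P 0 2 3 4 = 0" "P 0 2 3 5 = 0" "P 0 2 3 6 = 0" "P 0 2 3 7 = 0" "P 0 2 4 5 = 0"
  "P 0 2 4 6 = - 1" "P 0 2 4 7 = 0" "P 0 2 5 6 = 0" "P 0 2 5 7 = 1" "P 0 2 6 7 = 0"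
  "P 0 3 4 5 = 0" "P 0 3 4 6 = 0" "P 0 3 4 7 = - 1" "P 0 3 5 6 = - 1" "P 0 3 5 7 = 0"
  "P 0 3 6 7 = 0" "P 0 4 5 6 = 0" "P 0 4 5 7 = 0" "P 0 4 6 7 = 0" "P 0 5 6 7 = 0"
  "P 1 2 3 4 = 0" "P 1 2 3 5 = 0" "P 1 2 3 6 = 0" "P 1 2 3 7 = 0" "P 1 2 4 5 = 0"
  "P 1 2 4 6 = 0" "P 1 2 4 7 = - 1" "P 1 2 5 6 = - 1" "P 1 2 5 7 = 0" "P 1 2 6 7 = 0"
  "P 1 3 4 5 = 0" "P 1 3 4 6 = 1" "P 1 3 4 7 = 0" "P 1 3 5 6 = 0" "P 1 3 5 7 = - 1"
  "P 1 3 6 7 = 0" "P 1 4 5 6 = 0" "P 1 4 5 7 = 0" "P 1 4 6 7 = 0" "P 1 5 6 7 = 0"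
  "P 2 3 4 5 = - 1" "P 2 3 4 6 = 0" "P 2 3 4 7 = 0" "P 2 3 5 6 = 0" "P 2 3 5 7 = 0"
  "P 2 3 6 7 = - 1" "P 2 4 5 6 = 0" "P 2 4 5 7 = 0" "P 2 4 6 7 = 0" "P 2 5 6 7 = 0"
  "P 3 4 5 6 = 0" "P 3 4 5 7 = 0" "P 3 4 6 7 = 0" "P 3 5 6 7 = 0" "P 4 5 6 7 = 1"
  by (simp_all add: ordered spin7_terms_def)

lemmas eval = same sort table sum_lessThan_8

text \<open>The sum runs over ordered pairs, so the eigenvalue -1 of
  \<open>\<star>(\<Phi> \<and> w)\<close> appears as -2. The seven equations with
  \<open>i = 0\<close> express \<open>w 0 j\<close> through the 21 other entries, the dimension of
  \<open>spin(7)\<close>; after this substitution the infinitesimal invariance of the Cayley form is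
  an identity.\<close>

lemma stabilizer:
  assumes w: "\<And>i j. w j i = - w i j"
    and eig: "\<And>i j. i < 8 \<Longrightarrow> j < 8 \<Longrightarrow> (\<Sum>k<8. \<Sum>l<8. P k l i j * w k l) = - 2 * w i j"
    and "a < b" "b < c" "c < d" "d < 8"
  shows "(\<Sum>m<8. w a m * P m b c d + w b m * P a m c d + w c m * P a b m d + w d m * P a b c m) = 0"
proof -
  have w': "j < i \<Longrightarrow> w i j = - w j i" "w i i = 0" for i j
    using w[of i j] w[of i i] by simp_all
  have eqs: "w 0 1 = - w 2 3 + w 4 5 + w 6 7" "w 0 2 = w 1 3 + w 4 6 - w 5 7" "w 0 3 = - w 1 2 + w 4 7 + w 5 6" "w 0 4 = - w 1 5 - w 2 6 - w 3 7"
    "w 0 5 = w 1 4 + w 2 7 - w 3 6" "w 0 6 = - w 1 7 + w 2 4 + w 3 5" "w 0 7 = w 1 6 - w 2 5 + w 3 4"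
    using eig[of 0 1] eig[of 0 2] eig[of 0 3] eig[of 0 4] eig[of 0 5] eig[of 0 6] eig[of 0 7]
    by (simp_all add: eval w' del: One_nat_def)
  have "\<forall>d<8. \<forall>c<d. \<forall>b<c. \<forall>a<b.
     (\<Sum>m<8. w a m * P m b c d + w b m * P a m c d + w c m * P a b m d + w d m * P a b c m) = 0"
    unfolding all_less_numeral by (simp add: eval w' eqs del: One_nat_def)
  then show ?thesis using assms by blast
qed

text \<open>An element of \<open>\<Lambda>\<^sup>2\<^sub>7\<close> is determined by its components \<open>w 0 k\<close>.\<close>

lemma complement_values:
  assumes w: "\<And>i j. w j i = - w i j"
    and eig: "\<And>i j. i < 8 \<Longrightarrow> j < 8 \<Longrightarrow> (\<Sum>k<8. \<Sum>l<8. P k l i j * w k l) = 6 * w i j"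
  shows "w 1 2 = w 0 3" "w 1 3 = - w 0 2" "w 1 4 = - w 0 5" "w 1 5 = w 0 4" "w 1 6 = - w 0 7"
    "w 1 7 = w 0 6" "w 2 3 = w 0 1" "w 2 4 = - w 0 6" "w 2 5 = w 0 7" "w 2 6 = w 0 4"
    "w 2 7 = - w 0 5" "w 3 4 = - w 0 7" "w 3 5 = - w 0 6" "w 3 6 = w 0 5" "w 3 7 = w 0 4"
    "w 4 5 = - w 0 1" "w 4 6 = - w 0 2" "w 4 7 = - w 0 3" "w 5 6 = - w 0 3" "w 5 7 = w 0 2"
    "w 6 7 = - w 0 1"
proof -
  have w': "j < i \<Longrightarrow> w i j = - w j i" "w i i = 0" for i j
    using w[of i j] w[of i i] by simp_all
  show "w 2 3 = w 0 1" "w 4 5 = - w 0 1" "w 6 7 = - w 0 1"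
    using eig[of 2 3] eig[of 4 5] eig[of 6 7]
    by (simp_all (no_asm_use) add: eval w' del: One_nat_def, (linarith+)?)
  show "w 1 3 = - w 0 2" "w 4 6 = - w 0 2" "w 5 7 = w 0 2"
    using eig[of 1 3] eig[of 4 6] eig[of 5 7]
    by (simp_all (no_asm_use) add: eval w' del: One_nat_def, (linarith+)?)
  show "w 1 2 = w 0 3" "w 4 7 = - w 0 3" "w 5 6 = - w 0 3"
    using eig[of 1 2] eig[of 4 7] eig[of 5 6]
    by (simp_all (no_asm_use) add: eval w' del: One_nat_def, (linarith+)?)
  show "w 1 5 = w 0 4" "w 2 6 = w 0 4" "w 3 7 = w 0 4"
    using eig[of 1 5] eig[of 2 6] eig[of 3 7]
    by (simp_all (no_asm_use) add: eval w' del: One_nat_def, (linarith+)?)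
  show "w 1 4 = - w 0 5" "w 2 7 = - w 0 5" "w 3 6 = w 0 5"
    using eig[of 1 4] eig[of 2 7] eig[of 3 6]
    by (simp_all (no_asm_use) add: eval w' del: One_nat_def, (linarith+)?)
  show "w 1 7 = w 0 6" "w 2 4 = - w 0 6" "w 3 5 = - w 0 6"
    using eig[of 1 7] eig[of 2 4] eig[of 3 5]
    by (simp_all (no_asm_use) add: eval w' del: One_nat_def, (linarith+)?)
  show "w 1 6 = - w 0 7" "w 2 5 = w 0 7" "w 3 4 = - w 0 7"
    using eig[of 1 6] eig[of 2 5] eig[of 3 4]
    by (simp_all (no_asm_use) add: eval w' del: One_nat_def, (linarith+)?)
qed

text \<open>Hypothesis \<open>d\<close> is \<open>d\<Phi> = \<theta> \<and> \<Phi>\<close> with the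
  left side written as a contraction with the torsion. It can determine \<open>x\<close> because
  \<open>complement_values\<close> leaves \<open>8 * 7\<close> unknowns \<open>x u 0 k\<close>, as
  many as a five-form in dimension 8 has components; the linear system turns out to be
  regular.\<close>

lemma torsion_eq:
  assumes x: "\<And>u i j. x u j i = - x u i j"
    and eig: "\<And>u i j. u < 8 \<Longrightarrow> i < 8 \<Longrightarrow> j < 8 \<Longrightarrow>
      (\<Sum>k<8. \<Sum>l<8. P k l i j * x u k l) = 6 * x u i j"
    and d: "\<And>p q r s t. p < 8 \<Longrightarrow> q < 8 \<Longrightarrow> r < 8 \<Longrightarrow> s < 8 \<Longrightarrow> t < 8 \<Longrightarrow>
      (\<Sum>m<8. (x p q m - x q p m) * P m r s t - (x p r m - x r p m) * P m q s t
        + (x p s m - x s p m) * P m q r t - (x p t m - x t p m) * P m q r s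
        + (x q r m - x r q m) * P m p s t - (x q s m - x s q m) * P m p r t
        + (x q t m - x t q m) * P m p r s + (x r s m - x s r m) * P m p q t
        - (x r t m - x t r m) * P m p q s + (x s t m - x t s m) * P m p q r)
      = \<theta> p * P q r s t - \<theta> q * P p r s t + \<theta> r * P p q s t - \<theta> s * P p q r t + \<theta> t * P p q r s"
    and u: "u < 8" "i < 8" "j < 8"
  shows "x u i j = ((if u = i then \<theta> j else 0) - (if u = j then \<theta> i else 0)
    - (\<Sum>k<8. \<theta> k * P k u i j)) / 16"
proof -
  have x': "j < i \<Longrightarrow> x u i j = - x u j i" "x u i i = 0" for u i j
    using x[of u i j] x[of u i i] by simp_all
  \<comment> \<open>The Cayley form is supported on index sets with vanishing bitwise exclusive or, so the 56 equations
    split into eight systems of seven equations in seven unknowns, one for each value of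
    \<open>u XOR i\<close>: the facts \<open>w0\<close>, ..., \<open>w7\<close>.\<close>
  note cv = complement_values[of "x u" for u, OF x eig]
  note ev = eval x' cv
  have w0: "x 1 0 1 = - \<theta> 0 / 16" "x 2 0 2 = - \<theta> 0 / 16" "x 3 0 3 = - \<theta> 0 / 16" "x 4 0 4 = - \<theta> 0 / 16" "x 5 0 5 = - \<theta> 0 / 16" "x 6 0 6 = - \<theta> 0 / 16" "x 7 0 7 = - \<theta> 0 / 16"
    using d[of 0 1 2 4 7] d[of 0 1 2 5 6] d[of 0 1 3 4 6] d[of 0 1 3 5 7] d[of 0 2 3 4 5] d[of 0 2 3 6 7] d[of 0 4 5 6 7]
    by (simp_all (no_asm_use) add: ev del: One_nat_def, (linarith+)?)
  have w1: "x 0 0 1 = \<theta> 1 / 16" "x 3 0 2 = \<theta> 1 / 16" "x 2 0 3 = - \<theta> 1 / 16" "x 5 0 4 = - \<theta> 1 / 16" "x 4 0 5 = \<theta> 1 / 16" "x 7 0 6 = - \<theta> 1 / 16" "x 6 0 7 = \<theta> 1 / 16"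
    using d[of 0 1 2 4 6] d[of 0 1 2 5 7] d[of 0 1 3 4 7] d[of 0 1 3 5 6] d[of 1 2 3 4 5] d[of 1 2 3 6 7] d[of 1 4 5 6 7]
    by (simp_all (no_asm_use) add: ev del: One_nat_def, (linarith+)?)
  have w2: "x 3 0 1 = - \<theta> 2 / 16" "x 0 0 2 = \<theta> 2 / 16" "x 1 0 3 = \<theta> 2 / 16" "x 6 0 4 = - \<theta> 2 / 16" "x 7 0 5 = \<theta> 2 / 16" "x 4 0 6 = \<theta> 2 / 16" "x 5 0 7 = - \<theta> 2 / 16"
    using d[of 0 1 2 4 5] d[of 0 1 2 6 7] d[of 0 2 3 4 7] d[of 0 2 3 5 6] d[of 1 2 3 4 6] d[of 1 2 3 5 7] d[of 2 4 5 6 7]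
    by (simp_all (no_asm_use) add: ev del: One_nat_def, (linarith+)?)
  have w3: "x 2 0 1 = \<theta> 3 / 16" "x 1 0 2 = - \<theta> 3 / 16" "x 0 0 3 = \<theta> 3 / 16" "x 7 0 4 = - \<theta> 3 / 16" "x 6 0 5 = - \<theta> 3 / 16" "x 5 0 6 = \<theta> 3 / 16" "x 4 0 7 = \<theta> 3 / 16"
    using d[of 0 1 3 4 5] d[of 0 1 3 6 7] d[of 0 2 3 4 6] d[of 0 2 3 5 7] d[of 1 2 3 4 7] d[of 1 2 3 5 6] d[of 3 4 5 6 7]
    by (simp_all (no_asm_use) add: ev del: One_nat_def, (linarith+)?)
  have w4: "x 5 0 1 = \<theta> 4 / 16" "x 6 0 2 = \<theta> 4 / 16" "x 7 0 3 = \<theta> 4 / 16" "x 0 0 4 = \<theta> 4 / 16" "x 1 0 5 = - \<theta> 4 / 16" "x 2 0 6 = - \<theta> 4 / 16" "x 3 0 7 = - \<theta> 4 / 16"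
    using d[of 0 1 2 3 4] d[of 0 1 4 6 7] d[of 0 2 4 5 7] d[of 0 3 4 5 6] d[of 1 2 4 5 6] d[of 1 3 4 5 7] d[of 2 3 4 6 7]
    by (simp_all (no_asm_use) add: ev del: One_nat_def, (linarith+)?)
  have w5: "x 4 0 1 = - \<theta> 5 / 16" "x 7 0 2 = - \<theta> 5 / 16" "x 6 0 3 = \<theta> 5 / 16" "x 1 0 4 = \<theta> 5 / 16" "x 0 0 5 = \<theta> 5 / 16" "x 3 0 6 = - \<theta> 5 / 16" "x 2 0 7 = \<theta> 5 / 16"
    using d[of 0 1 2 3 5] d[of 0 1 5 6 7] d[of 0 2 4 5 6] d[of 0 3 4 5 7] d[of 1 2 4 5 7] d[of 1 3 4 5 6] d[of 2 3 5 6 7]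
    by (simp_all (no_asm_use) add: ev del: One_nat_def, (linarith+)?)
  have w6: "x 7 0 1 = \<theta> 6 / 16" "x 4 0 2 = - \<theta> 6 / 16" "x 5 0 3 = - \<theta> 6 / 16" "x 2 0 4 = \<theta> 6 / 16" "x 3 0 5 = \<theta> 6 / 16" "x 0 0 6 = \<theta> 6 / 16" "x 1 0 7 = - \<theta> 6 / 16"
    using d[of 0 1 2 3 6] d[of 0 1 4 5 6] d[of 0 2 5 6 7] d[of 0 3 4 6 7] d[of 1 2 4 6 7] d[of 1 3 5 6 7] d[of 2 3 4 5 6]
    by (simp_all (no_asm_use) add: ev del: One_nat_def, (linarith+)?)
  have w7: "x 6 0 1 = - \<theta> 7 / 16" "x 5 0 2 = \<theta> 7 / 16" "x 4 0 3 = - \<theta> 7 / 16" "x 3 0 4 = \<theta> 7 / 16" "x 2 0 5 = - \<theta> 7 / 16" "x 1 0 6 = \<theta> 7 / 16" "x 0 0 7 = \<theta> 7 / 16"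
    using d[of 0 1 2 3 7] d[of 0 1 4 5 7] d[of 0 2 4 6 7] d[of 0 3 5 6 7] d[of 1 2 5 6 7] d[of 1 3 4 6 7] d[of 2 3 4 5 7]
    by (simp_all (no_asm_use) add: ev del: One_nat_def, (linarith+)?)
  have "\<forall>u<8. \<forall>i<8. \<forall>j<8. x u i j = ((if u = i then \<theta> j else 0) - (if u = j then \<theta> i else 0)
    - (\<Sum>k<8. \<theta> k * P k u i j)) / 16"
    unfolding all_less_numeral
    by (simp add: ev w0 w1 w2 w3 w4 w5 w6 w7 del: One_nat_def)
  then show ?thesis using u by blast
qed

text \<open>The blocks 0123 and 4567 both occur in the Cayley form, and no two of its terms share
  exactly three indices. Evaluating on one block together with an index \<open>i\<close> of the
  other therefore isolates \<open>\<theta> i\<close>.\<close>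

lemma wedge_eq_0D:
  assumes d: "\<And>p q r s t. p < 8 \<Longrightarrow> q < 8 \<Longrightarrow> r < 8 \<Longrightarrow> s < 8 \<Longrightarrow> t < 8 \<Longrightarrow>
      \<theta> p * P q r s t - \<theta> q * P p r s t + \<theta> r * P p q s t - \<theta> s * P p q r t + \<theta> t * P p q r s = 0"
    and "i < 8"
  shows "\<theta> i = 0"
proof -
  have "\<forall>i<8. \<theta> i = 0"
    unfolding all_less_numeral
    using d[of 4 5 6 7 0] d[of 4 5 6 7 1] d[of 4 5 6 7 2] d[of 4 5 6 7 3]
      d[of 0 1 2 3 4] d[of 0 1 2 3 5] d[of 0 1 2 3 6] d[of 0 1 2 3 7]
    by (simp add: eval del: One_nat_def)
  then show ?thesis using assms(2) by blast
qed

section \<open>Contraction of the Cayley form with a vector\<close>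

text \<open>For \<open>\<theta>\<close> of unit length, \<open>f\<close> is the G2 three-form on the
  orthogonal complement, and \<open>\<Phi> = \<theta> \<and> f + \<psi>\<close> with
  \<open>\<psi>\<close> its dual four-form. There
  \<open>f_abm f_cdm = g_ac g_bd - g_ad g_bc + \<psi>_abcd\<close>; in the skew combination taken
  here the metric terms cancel and \<open>3 * \<psi>\<close> remains.\<close>

lemma contraction_square:
  fixes \<theta> :: "nat \<Rightarrow> real"
  defines "f \<equiv> \<lambda>a b c. \<Sum>k<8. \<theta> k * P k a b c"
  assumes "a < b" "b < c" "c < d" "d < 8"
  shows "(\<Sum>m<8. f a b m * f c d m - f a c m * f b d m + f a d m * f b c m)
    = 3 * (\<Sum>k<8. \<theta> k * \<theta> k) * P a b c d
      - 3 * (\<theta> a * f b c d - \<theta> b * f a c d + \<theta> c * f a b d - \<theta> d * f a b c)"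
proof -
  have f_same: "f a a c = 0" "f a b b = 0" for a b c
    by (simp_all add: f_def same)
  have f_sort: "b < a \<Longrightarrow> f a b c = - f b a c" "c < b \<Longrightarrow> f a b c = - f a c b" for a b c
    by (simp_all add: f_def skew23[of _ b a] skew34[of _ _ c b] sum_negf)
  have f_table:
    "f 0 1 2 = - \<theta> 3" "f 0 1 3 = \<theta> 2" "f 0 1 4 = \<theta> 5" "f 0 1 5 = - \<theta> 4" "f 0 1 6 = \<theta> 7"
    "f 0 1 7 = - \<theta> 6" "f 0 2 3 = - \<theta> 1" "f 0 2 4 = \<theta> 6" "f 0 2 5 = - \<theta> 7" "f 0 2 6 = - \<theta> 4"
    "f 0 2 7 = \<theta> 5" "f 0 3 4 = \<theta> 7" "f 0 3 5 = \<theta> 6" "f 0 3 6 = - \<theta> 5" "f 0 3 7 = - \<theta> 4"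
    "f 0 4 5 = \<theta> 1" "f 0 4 6 = \<theta> 2" "f 0 4 7 = \<theta> 3" "f 0 5 6 = \<theta> 3" "f 0 5 7 = - \<theta> 2"
    "f 0 6 7 = \<theta> 1" "f 1 2 3 = \<theta> 0" "f 1 2 4 = \<theta> 7" "f 1 2 5 = \<theta> 6" "f 1 2 6 = - \<theta> 5"
    "f 1 2 7 = - \<theta> 4" "f 1 3 4 = - \<theta> 6" "f 1 3 5 = \<theta> 7" "f 1 3 6 = \<theta> 4" "f 1 3 7 = - \<theta> 5"
    "f 1 4 5 = - \<theta> 0" "f 1 4 6 = - \<theta> 3" "f 1 4 7 = \<theta> 2" "f 1 5 6 = \<theta> 2" "f 1 5 7 = \<theta> 3"
    "f 1 6 7 = - \<theta> 0" "f 2 3 4 = \<theta> 5" "f 2 3 5 = - \<theta> 4" "f 2 3 6 = \<theta> 7" "f 2 3 7 = - \<theta> 6"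
    "f 2 4 5 = \<theta> 3" "f 2 4 6 = - \<theta> 0" "f 2 4 7 = - \<theta> 1" "f 2 5 6 = - \<theta> 1" "f 2 5 7 = \<theta> 0"
    "f 2 6 7 = \<theta> 3" "f 3 4 5 = - \<theta> 2" "f 3 4 6 = \<theta> 1" "f 3 4 7 = - \<theta> 0" "f 3 5 6 = - \<theta> 0"
    "f 3 5 7 = - \<theta> 1" "f 3 6 7 = - \<theta> 2" "f 4 5 6 = - \<theta> 7" "f 4 5 7 = \<theta> 6" "f 4 6 7 = - \<theta> 5"
    "f 5 6 7 = \<theta> 4"
    unfolding f_def by (simp_all add: eval del: One_nat_def)
  have "\<forall>d<8. \<forall>c<d. \<forall>b<c. \<forall>a<b. (\<Sum>m<8. f a b m * f c d m - f a c m * f b d m + f a d m * f b c m)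
    = 3 * (\<Sum>k<8. \<theta> k * \<theta> k) * P a b c d
      - 3 * (\<theta> a * f b c d - \<theta> b * f a c d + \<theta> c * f a b d - \<theta> d * f a b c)"
    unfolding all_less_numeral sum_lessThan_8
    by (simp add: f_same f_sort f_table table algebra_simps del: One_nat_def)
  then show ?thesis using assms by blast
qed

text \<open>\<open>T\<close> is the torsion of the minimal connection in components. Its metric part
  produces each of the four terms of \<open>\<theta> \<and> f\<close> three times, hence 3/16. Its
  part in \<open>f\<close> contributes -2/16 times twice the combination of
  \<open>contraction_square\<close>, that is -3/4 for \<open>\<Phi>\<close> and another 3/4 for
  \<open>\<theta> \<and> f\<close>, and 15/16 = 3/16 + 3/4.\<close>

lemma torsion_contraction:
  fixes \<theta> :: "nat \<Rightarrow> real"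
  defines "f \<equiv> \<lambda>a b c. \<Sum>k<8. \<theta> k * P k a b c"
  defines "T \<equiv> \<lambda>a b m. ((if b = m then \<theta> a else 0) - (if a = m then \<theta> b else 0) - 2 * f a b m) / 16"
  assumes ord: "a < b" "b < c" "c < d" "d < 8"
  shows "(\<Sum>m<8. T a b m * f m c d - T a c m * f m b d + T a d m * f m b c
      + T b c m * f m a d - T b d m * f m a c + T c d m * f m a b)
    = 15 / 16 * (\<theta> a * f b c d - \<theta> b * f a c d + \<theta> c * f a b d - \<theta> d * f a b c)
      - 3 / 4 * (\<Sum>k<8. \<theta> k * \<theta> k) * P a b c d"
proof -
  have f12: "f b a c = - f a b c" and f23: "f a c b = - f a b c" for a b c
    unfolding f_def skew23[of _ b a c] skew34[of _ a c b] by (simp_all add: sum_negf)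
  have T: "(\<Sum>m<8. T a b m * f m c d) =
      (\<theta> a * f b c d - \<theta> b * f a c d - 2 * (\<Sum>m<8. f a b m * f m c d)) / 16"
    if "a < 8" "b < 8" for a b c d
  proof -
    have "(\<Sum>m<8. T a b m * f m c d) = ((\<Sum>m<8. (if b = m then \<theta> a * f m c d else 0))
        - (\<Sum>m<8. (if a = m then \<theta> b * f m c d else 0)) - 2 * (\<Sum>m<8. f a b m * f m c d)) / 16"
      unfolding T_def sum_distrib_left sum_subtractf[symmetric] sum_divide_distrib
      by (intro sum.cong refl) (auto simp: field_simps)
    then show ?thesis using that by simp
  qed
  define S where "S a b c d = (\<Sum>m<8. f a b m * f c d m)" for a b c d
  have S: "(\<Sum>m<8. f a b m * f m c d) = S a b c d" for a b c d
    unfolding S_def using f12 f23 by metis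
  have S_sym: "S c d a b = S a b c d" for a b c d
    by (simp add: S_def mult.commute)
  have perm: "f c b d = - f b c d" "f d b c = f b c d" "f c a d = - f a c d" "f b a d = - f a b d"
    "f d a c = f a c d" "f b a c = - f a b c" "f d a b = f a b d" "f c a b = f a b c"
    using f12 f23 by metis+
  have sq: "S a b c d - S a c b d + S a d b c = 3 * (\<Sum>k<8. \<theta> k * \<theta> k) * P a b c d
      - 3 * (\<theta> a * f b c d - \<theta> b * f a c d + \<theta> c * f a b d - \<theta> d * f a b c)"
    using contraction_square[OF ord, of \<theta>]
    by (simp add: S_def f_def sum.distrib sum_subtractf)
  have "(\<Sum>m<8. T a b m * f m c d - T a c m * f m b d + T a d m * f m b c
      + T b c m * f m a d - T b d m * f m a c + T c d m * f m a b)
    = 3 / 16 * (\<theta> a * f b c d - \<theta> b * f a c d + \<theta> c * f a b d - \<theta> d * f a b c)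
      - 1 / 4 * (S a b c d - S a c b d + S a d b c)"
    using ord unfolding sum.distrib sum_subtractf
    by (simp add: T S S_sym[of c d a b] S_sym[of b d a c] S_sym[of b c a d] perm) (simp add: field_simps)
  also have "\<dots> = 15 / 16 * (\<theta> a * f b c d - \<theta> b * f a c d + \<theta> c * f a b d - \<theta> d * f a b c)
      - 3 / 4 * (\<Sum>k<8. \<theta> k * \<theta> k) * P a b c d"
    unfolding sq by (simp add: algebra_simps)
  finally show ?thesis .
qed
end

section \<open>Evaluation of wedge products on frame vectors\<close>

lemma wedge1_swap:
  assumes "length T = length xs + length ys + 2"
  shows "wedge1 \<epsilon> T (nth (xs @ b # a # ys)) = - wedge1 \<epsilon> T (nth (xs @ a # b # ys))"
proof -
  let ?n = "length xs"
  have p: "Transposition.transpose ?n (Suc ?n) permutes {..<length T}"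
    using assms by (intro permutes_swap_id) auto
  have "nth (xs @ b # a # ys) = (\<lambda>i. (xs @ a # b # ys) ! Transposition.transpose ?n (Suc ?n) i)"
    by (rule ext) (auto simp: Transposition.transpose_def nth_append nth_Cons' not_less_eq)
  then show ?thesis
    using wedge1_permute[OF p, of \<epsilon> "nth (xs @ a # b # ys)"] by (simp only: sign_swap_id) simp
qed

text \<open>\<open>matching_sign T J\<close> is the determinant of the 0-1 matrix with entries \<open>T ! m = J ! n\<close>. The expansion
  along the first row moves the first column into the place of the deleted one, which costs a sign
  but keeps the lists short.\<close>

fun matching_sign :: "nat list \<Rightarrow> nat list \<Rightarrow> int" where
  "matching_sign [] J = 1"
| "matching_sign (t # T) [] = 0"
| "matching_sign (t # T) (j # J) = (if t = j then matching_sign T J else 0)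
     - (\<Sum>b\<leftarrow>[0..<length J]. if t = J ! b then matching_sign T (J[b := j]) else 0)"

lemma wedge1_coframe:
  assumes e: "orthonormal_frame g e"
  shows "length J = length T \<Longrightarrow> set T \<subseteq> {..<8} \<Longrightarrow> set J \<subseteq> {..<8} \<Longrightarrow>
    wedge1 (coframe g e) T (nth (map e J)) = of_int (matching_sign T J)"
proof (induction T arbitrary: J)
  case Nil
  then show ?case by (simp add: wedge1_Nil)
next
  case (Cons t T)
  obtain j J' where J: "J = j # J'" using Cons.prems by (cases J) auto
  have c: "coframe g e t (e i) = (if t = i then 1 else 0)" if "i < 8" for i
    using e Cons.prems that by (auto simp: orthonormal_frame_def coframe_def)
  have up: "set (J'[b := j]) \<subseteq> {..<8}" for b
    using Cons.prems J set_update_subset_insert[of J' b j] by auto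
  have lt: "J' ! b < 8" if "b < length J'" for b
    using Cons.prems J nth_mem[OF that] by auto
  have l: "length (map e J') = length T" using Cons.prems J by simp
  have "(\<Sum>b<length J'. coframe g e t (map e J' ! b) * wedge1 (coframe g e) T (nth ((map e J')[b := e j])))
     = (\<Sum>b<length J'. of_int (if t = J' ! b then matching_sign T (J'[b := j]) else 0))"
  proof (rule sum.cong[OF refl])
    fix b assume "b \<in> {..<length J'}"
    then show "coframe g e t (map e J' ! b) * wedge1 (coframe g e) T (nth ((map e J')[b := e j]))
      = of_int (if t = J' ! b then matching_sign T (J'[b := j]) else 0)"
      using Cons.IH[of "J'[b := j]"] up[of b] lt[of b] Cons.prems J
      by (simp add: c map_update)
  qed
  then show ?case
    using Cons.IH[of J'] Cons.prems J wedge1_Cons[OF l, of "coframe g e" t "e j"]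
    by (simp add: c interv_sum_list_conv_sum_set_nat atLeast0LessThan)
qed

text \<open>Coefficients in \<open>int\<close> make the sums executable, so that the table of
  components can be checked by evaluation.\<close>

definition spin7_int_terms :: "(int \<times> nat list) list" where
  "spin7_int_terms =
    [( 1, [0,1,2,3]), (-1, [0,1,4,5]), (-1, [0,1,6,7]), (-1, [0,2,4,6]), ( 1, [0,2,5,7]),
     (-1, [0,3,4,7]), (-1, [0,3,5,6]), ( 1, [4,5,6,7]), (-1, [2,3,6,7]), (-1, [2,3,4,5]),
     (-1, [1,3,5,7]), ( 1, [1,3,4,6]), (-1, [1,2,5,6]), (-1, [1,2,4,7])]"

lemma spin7_terms_of_int: "spin7_terms = map (map_prod of_int id) spin7_int_terms"
  by (simp add: spin7_terms_def spin7_int_terms_def)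

text \<open>The second identity is \<open>\<star>\<Phi> = \<Phi>\<close>:
  \<open>matching_sign [0..<8] (T @ J)\<close> vanishes unless \<open>T\<close> and \<open>J\<close>
  are complementary, and then it is the sign relating their coefficients.\<close>

lemma spin7_int_terms_ordered:
  "\<forall>J\<in>set [[a, b, c, d]. d \<leftarrow> [0..<8], c \<leftarrow> [0..<d], b \<leftarrow> [0..<c], a \<leftarrow> [0..<b]].
     (\<Sum>(s, T)\<leftarrow>spin7_int_terms. s * matching_sign T J) = (\<Sum>(s, T)\<leftarrow>spin7_int_terms. if T = J then s else 0) \<and>
     (\<Sum>(s, T)\<leftarrow>spin7_int_terms. s * matching_sign [0..<8] (T @ J)) = (\<Sum>(s, T)\<leftarrow>spin7_int_terms. if T = J then s else 0)"
  by code_simp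

subsection \<open>Spin(7)-structures on a vector space\<close>

definition form4 :: "form \<Rightarrow> vec8 \<Rightarrow> vec8 \<Rightarrow> vec8 \<Rightarrow> vec8 \<Rightarrow> real" where
  "form4 \<alpha> a b c d = \<alpha> (nth [a, b, c, d])"

lemma is_form_nth_update:
  assumes "is_form k \<alpha>" "length xs = k"
  shows "\<alpha> ((nth xs)(i := y)) = \<alpha> (nth (xs[i := y]))"
  by (rule is_form_cong[OF assms(1)]) (use assms(2) in \<open>auto simp: nth_list_update\<close>)

lemma is_form_linear_nth:
  assumes "is_form k \<alpha>" "length xs = k" "i < k"
  shows "linear (\<lambda>y. \<alpha> (nth (xs[i := y])))"
  using is_form_linear[OF assms(1,3), of "nth xs"]
  by (simp add: is_form_nth_update[OF assms(1,2)])

lemma is_form_swap_nth: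
  assumes "is_form k \<alpha>" "k = length xs + length ys + 2"
  shows "\<alpha> (nth (xs @ b # a # ys)) = - \<alpha> (nth (xs @ a # b # ys))"
proof -
  let ?n = "length xs"
  have "nth (xs @ b # a # ys) = (\<lambda>i. (xs @ a # b # ys) ! Transposition.transpose ?n (Suc ?n) i)"
    by (rule ext) (auto simp: Transposition.transpose_def nth_append nth_Cons' not_less_eq)
  then show ?thesis
    using is_form_transpose[OF assms(1), of ?n "Suc ?n" "nth (xs @ a # b # ys)"] assms(2) by simp
qed

lemma form4_linear:
  assumes "is_form 4 \<alpha>"
  shows "linear (\<lambda>x. form4 \<alpha> x b c d)" "linear (\<lambda>x. form4 \<alpha> a x c d)"
    "linear (\<lambda>x. form4 \<alpha> a b x d)" "linear (\<lambda>x. form4 \<alpha> a b c x)"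
  using is_form_linear_nth[OF assms, of "[0, b, c, d]" 0] is_form_linear_nth[OF assms, of "[a, 0, c, d]" 1]
    is_form_linear_nth[OF assms, of "[a, b, 0, d]" 2] is_form_linear_nth[OF assms, of "[a, b, c, 0]" 3]
  by (simp_all add: form4_def eval_nat_numeral)

lemma form4_skew:
  assumes "is_form 4 \<alpha>"
  shows "form4 \<alpha> b a c d = - form4 \<alpha> a b c d" "form4 \<alpha> a c b d = - form4 \<alpha> a b c d"
    "form4 \<alpha> a b d c = - form4 \<alpha> a b c d"
  using is_form_swap_nth[OF assms, of "[]" "[c, d]" b a] is_form_swap_nth[OF assms, of "[a]" "[d]" c b]
    is_form_swap_nth[OF assms, of "[a, b]" "[]" d c]
  by (simp_all add: form4_def)

lemma orthonormal_frame_expansion: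
  assumes g: "bilinear g" and e: "orthonormal_frame g e"
  shows "v = (\<Sum>i<8. g (e i) v *\<^sub>R e i)"
proof -
  have on: "g (e i) (e j) = (if i = j then 1 else 0)" if "i < 8" "j < 8" for i j
    using e that by (auto simp: orthonormal_frame_def)
  have lin: "linear (g x)" for x
    using g by (auto simp: bilinear_def)
  have coeff: "g (e j) (\<Sum>i<8. u i *\<^sub>R e i) = u j" if "j < 8" for u j
    using that by (simp add: linear_sum[OF lin] linear_scale[OF lin] on if_distrib cong: if_cong)
  have inj: "inj_on e {..<8}"
  proof (rule inj_onI)
    fix i j assume "i \<in> {..<8}" "j \<in> {..<8}" "e i = e j"
    then show "i = j" using on[of i j] on[of i i] by (auto split: if_splits)
  qed
  have "independent (e ` {..<8})"
    unfolding dependent_finite[OF finite_imageI[OF finite_lessThan]]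
  proof (safe)
    fix u i assume "(\<Sum>v\<in>e ` {..<8}. u v *\<^sub>R v) = 0" and i: "i < (8::nat)" and "u (e i) \<noteq> 0"
    then have "(\<Sum>i<8. u (e i) *\<^sub>R e i) = 0"
      by (simp add: sum.reindex[OF inj])
    then have "u (e i) = 0"
      using coeff[OF i, of "\<lambda>i. u (e i)"] linear_0[OF lin] by simp
    with \<open>u (e i) \<noteq> 0\<close> show False by simp
  qed
  then have "UNIV \<subseteq> span (e ` {..<8})"
    by (intro card_ge_dim_independent) (auto simp: card_image[OF inj])
  then have "v \<in> span (e ` {..<8})" by auto
  then obtain u where "v = (\<Sum>w\<in>e ` {..<8}. u w *\<^sub>R w)"
    unfolding span_finite[OF finite_imageI[OF finite_lessThan]] by auto
  then have v: "v = (\<Sum>i<8. u (e i) *\<^sub>R e i)"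
    by (simp add: sum.reindex[OF inj])
  have "g (e j) v = u (e j)" if "j < 8" for j
    using coeff[OF that, of "\<lambda>i. u (e i)"] v by simp
  then show ?thesis using v by simp
qed

lemma spin7_terms_cong:
  assumes "\<And>T. length T = 4 \<Longrightarrow> set T \<subseteq> {..<8} \<Longrightarrow> h T = h' T"
  shows "(\<Sum>(s, T)\<leftarrow>spin7_terms. s * h T) = (\<Sum>(s, T)\<leftarrow>spin7_terms. s * h' T)"
  by (simp add: spin7_terms_def assms)

lemma sum_list_minus_terms:
  fixes h :: "'b \<Rightarrow> real"
  shows "(\<Sum>(s, T)\<leftarrow>L. s * (- h T)) = - (\<Sum>(s, T)\<leftarrow>L. s * h T)"
  by (induction L) auto

lemma sum_list_of_int_terms:
  "(\<Sum>(s, T)\<leftarrow>map (map_prod of_int id) L. s * of_int (h T)) = (of_int (\<Sum>(s, T)\<leftarrow>L. s * h T) :: real)"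
  by (induction L) auto

locale spin7_point =
  fixes g :: metric and \<Phi> :: form
  assumes bilinear: "bilinear g" and sym: "g v w = g w v" and form: "is_form 4 \<Phi>"
    and adapted: "\<exists>e. adapted_frame g \<Phi> e"
begin

abbreviation F where "F \<equiv> form4 \<Phi>"

text \<open>The same choice as in \<open>hodge\<close>, so that the Hodge star is taken in the very
  frame that defines the components \<open>P\<close>.\<close>

definition e where "e = (SOME e. adapted_frame g \<Phi> e)"

definition P where "P i j k l = F (e i) (e j) (e k) (e l)"

lemma frame: "adapted_frame g \<Phi> e"
  unfolding e_def by (rule someI_ex[OF adapted])

lemma hodge_eq: "hodge g \<Phi> = hodge_frame g e"
  by (simp add: hodge_def e_def)

lemma orthonormal: "orthonormal_frame g e" and model: "\<Phi> = spin7_model (coframe g e)"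
  using frame by (simp_all add: adapted_frame_def)

lemma g_frame: "i < 8 \<Longrightarrow> j < 8 \<Longrightarrow> g (e i) (e j) = (if i = j then 1 else 0)"
  using orthonormal by (simp add: orthonormal_frame_def)

lemma g_linear: "linear (g v)" "linear (\<lambda>v. g v w)"
  using bilinear by (auto simp: bilinear_def)

lemma expansion: "v = (\<Sum>i<8. g (e i) v *\<^sub>R e i)"
  by (rule orthonormal_frame_expansion[OF bilinear orthonormal])

lemma linear_expansion:
  fixes h :: "vec8 \<Rightarrow> real"
  assumes "linear h"
  shows "h v = (\<Sum>i<8. g (e i) v * h (e i))"
  by (subst expansion[of v]) (simp only: linear_sum[OF assms] linear_scale[OF assms] real_scaleR_def)

lemma linear_eq_0:
  fixes h :: "vec8 \<Rightarrow> real"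
  assumes "linear h" and "\<And>i. i < 8 \<Longrightarrow> h (e i) = 0"
  shows "h v = 0"
  unfolding linear_expansion[OF assms(1), of v] by (simp add: assms(2))

text \<open>Linearity is given in the first slot; skewness brings each slot there in turn, which
  releases the arguments from the frame one at a time.\<close>

lemma alternating_eq_0:
  fixes G :: "vec8 \<Rightarrow> vec8 \<Rightarrow> vec8 \<Rightarrow> vec8 \<Rightarrow> real"
  assumes lin: "\<And>b c d. linear (\<lambda>a. G a b c d)"
    and s12: "\<And>a b c d. G b a c d = - G a b c d"
    and s23: "\<And>a b c d. G a c b d = - G a b c d"
    and s34: "\<And>a b c d. G a b d c = - G a b c d"
    and ordered: "\<And>i j k l. i < j \<Longrightarrow> j < k \<Longrightarrow> k < l \<Longrightarrow> l < 8 \<Longrightarrow> G (e i) (e j) (e k) (e l) = 0"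
  shows "G a b c d = 0"
proof -
  have 1: "G (e i) (e j) (e k) (e l) = 0" if "i < 8" "j < 8" "k < 8" "l < 8" for i j k l
    by (rule skew4_eq_0[where n = 8 and G = "\<lambda>i j k l. G (e i) (e j) (e k) (e l)"])
      (rule s12 s23 s34 ordered that; assumption?)+
  have 2: "G a (e j) (e k) (e l) = 0" if "j < 8" "k < 8" "l < 8" for a j k l
    by (rule linear_eq_0[OF lin]) (use 1 that in auto)
  have 3: "G b a (e k) (e l) = 0" if "k < 8" "l < 8" for a b k l
  proof (rule linear_eq_0[OF lin])
    show "G (e i) a (e k) (e l) = 0" if "i < 8" for i
      using s12[where a = a and b = "e i" and c = "e k" and d = "e l"] 2 that \<open>k < 8\<close> \<open>l < 8\<close> by simp
  qed
  have 4: "G c b a (e l) = 0" if "l < 8" for a b c l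
  proof (rule linear_eq_0[OF lin])
    show "G (e i) b a (e l) = 0" if "i < 8" for i
      using s12[where a = b and b = "e i" and c = a and d = "e l"] 3[OF that \<open>l < 8\<close>, of b a]
        s23[where a = b and b = a and c = "e i" and d = "e l"] by simp
  qed
  show ?thesis
  proof (rule linear_eq_0[OF lin])
    show "G (e i) b c d = 0" if "i < 8" for i
      using s12[where a = b and b = "e i" and c = c and d = d] 4[OF that, of b c d]
        s23[where a = b and b = c and c = "e i" and d = d] s34[where a = b and b = c and c = d and d = "e i"] by simp
  qed
qed

lemma ordered_values:
  assumes "i < j" "j < k" "k < l" "l < 8"
  shows "P i j k l = (\<Sum>(s, I)\<leftarrow>spin7_terms. if I = [i, j, k, l] then s else 0)"
    and "(\<Sum>(s, T)\<leftarrow>spin7_terms. s * wedge1 (coframe g e) [0..<8] (nth (map e (T @ [i, j, k, l])))) = P i j k l"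
proof -
  let ?J = "[i, j, k, l]"
  have J: "?J \<in> set [[a, b, c, d]. d \<leftarrow> [0..<8], c \<leftarrow> [0..<d], b \<leftarrow> [0..<c], a \<leftarrow> [0..<b]]"
    using assms by (auto simp: image_iff intro!: bexI[of _ l] bexI[of _ k] bexI[of _ j])
  note vals = bspec[OF spin7_int_terms_ordered J]
  have ev: "(\<Sum>(s, T)\<leftarrow>spin7_terms. if T = ?J then s else 0) =
      (of_int (\<Sum>(s, T)\<leftarrow>spin7_int_terms. if T = ?J then s else 0) :: real)"
    using sum_list_of_int_terms[of "\<lambda>T. if T = ?J then 1 else 0" spin7_int_terms]
    by (simp add: spin7_terms_of_int if_distrib cong: if_cong)
  have "P i j k l = (\<Sum>(s, T)\<leftarrow>spin7_terms. s * wedge1 (coframe g e) T (nth (map e ?J)))"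
    unfolding P_def form4_def using fun_cong[OF model] by (simp add: spin7_model_def)
  also have "\<dots> = (\<Sum>(s, T)\<leftarrow>spin7_terms. s * of_int (matching_sign T ?J))"
    by (rule spin7_terms_cong, rule wedge1_coframe[OF orthonormal]) (use assms in auto)
  also have "\<dots> = of_int (\<Sum>(s, T)\<leftarrow>spin7_int_terms. s * matching_sign T ?J)"
    unfolding spin7_terms_of_int by (rule sum_list_of_int_terms)
  finally show P: "P i j k l = (\<Sum>(s, I)\<leftarrow>spin7_terms. if I = ?J then s else 0)"
    using vals ev by simp
  have "(\<Sum>(s, T)\<leftarrow>spin7_terms. s * wedge1 (coframe g e) [0..<8] (nth (map e (T @ ?J))))
    = (\<Sum>(s, T)\<leftarrow>spin7_terms. s * of_int (matching_sign [0..<8] (T @ ?J)))"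
    by (rule spin7_terms_cong, rule wedge1_coframe[OF orthonormal]) (use assms in auto)
  also have "\<dots> = of_int (\<Sum>(s, T)\<leftarrow>spin7_int_terms. s * matching_sign [0..<8] (T @ ?J))"
    unfolding spin7_terms_of_int by (rule sum_list_of_int_terms)
  also have "\<dots> = P i j k l"
    unfolding P ev using vals by simp
  finally show "(\<Sum>(s, T)\<leftarrow>spin7_terms. s * wedge1 (coframe g e) [0..<8] (nth (map e (T @ ?J)))) = P i j k l" .
qed

sublocale tensor: spin7_tensor P
proof
  show "P b a c d = - P a b c d" "P a c b d = - P a b c d" "P a b d c = - P a b c d" for a b c d
    unfolding P_def by (rule form4_skew[OF form])+
qed (rule ordered_values)

text \<open>Both sides change sign under adjacent swaps, so the increasing quadruples checked by
  evaluation suffice.\<close>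

lemma self_dual:
  assumes "i < 8" "j < 8" "k < 8" "l < 8"
  shows "(\<Sum>(s, T)\<leftarrow>spin7_terms. s * wedge1 (coframe g e) [0..<8] (nth (map e (T @ [i, j, k, l])))) = P i j k l"
proof -
  define Q where "Q i j k l = (\<Sum>(s, T)\<leftarrow>spin7_terms. s * wedge1 (coframe g e) [0..<8] (nth (map e (T @ [i, j, k, l]))))"
    for i j k l
  have Q12: "Q j i k l = - Q i j k l" for i j k l
    unfolding Q_def sum_list_minus_terms[symmetric]
  proof (rule spin7_terms_cong)
    fix T :: "nat list" assume "length T = 4"
    then have "length [0..<8::nat] = length (map e T) + length [e k, e l] + 2" by simp
    from wedge1_swap[OF this, of "coframe g e" "e j" "e i"]
    show "wedge1 (coframe g e) [0..<8] (nth (map e (T @ [j, i, k, l]))) = - wedge1 (coframe g e) [0..<8] (nth (map e (T @ [i, j, k, l])))"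
      by (simp only: map_append list.map append_assoc append.simps)
  qed
  have Q23: "Q i k j l = - Q i j k l" for i j k l
    unfolding Q_def sum_list_minus_terms[symmetric]
  proof (rule spin7_terms_cong)
    fix T :: "nat list" assume "length T = 4"
    then have "length [0..<8::nat] = length (map e T @ [e i]) + length [e l] + 2" by simp
    from wedge1_swap[OF this, of "coframe g e" "e k" "e j"]
    show "wedge1 (coframe g e) [0..<8] (nth (map e (T @ [i, k, j, l]))) = - wedge1 (coframe g e) [0..<8] (nth (map e (T @ [i, j, k, l])))"
      by (simp only: map_append list.map append_assoc append.simps)
  qed
  have Q34: "Q i j l k = - Q i j k l" for i j k l
    unfolding Q_def sum_list_minus_terms[symmetric]
  proof (rule spin7_terms_cong)
    fix T :: "nat list" assume "length T = 4"
    then have "length [0..<8::nat] = length (map e T @ [e i, e j]) + length ([] :: vec8 list) + 2" by simp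
    from wedge1_swap[OF this, of "coframe g e" "e l" "e k"]
    show "wedge1 (coframe g e) [0..<8] (nth (map e (T @ [i, j, l, k]))) = - wedge1 (coframe g e) [0..<8] (nth (map e (T @ [i, j, k, l])))"
      by (simp only: map_append list.map append_assoc append.simps)
  qed
  have G12: "Q j i k l - P j i k l = - (Q i j k l - P i j k l)" for i j k l
    using Q12[of j i k l] tensor.skew12[of j i k l] by linarith
  have G23: "Q i k j l - P i k j l = - (Q i j k l - P i j k l)" for i j k l
    using Q23[of i k j l] tensor.skew23[of i k j l] by linarith
  have G34: "Q i j l k - P i j l k = - (Q i j k l - P i j k l)" for i j k l
    using Q34[of i j l k] tensor.skew34[of i j l k] by linarith
  have G0: "Q i j k l - P i j k l = 0" if "i < j" "j < k" "k < l" "l < 8" for i j k l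
    unfolding Q_def using ordered_values(2)[OF that] by (simp only: diff_self)
  have "Q i j k l - P i j k l = 0"
    by (rule skew4_eq_0[where n = 8 and G = "\<lambda>i j k l. Q i j k l - P i j k l", OF G12 G23 G34 G0 assms])
  then show ?thesis by (simp add: Q_def)
qed

text \<open>Self-duality turns the volume form, filled with the terms of \<open>\<Phi>\<close>, back
  into a component of \<open>\<Phi>\<close>. The factor 1/2 is 24/48, where 48 =
  \<open>4! * 2!\<close> comes from the wedge product; it compensates for counting each pair
  \<open>k\<close>, \<open>l\<close> twice.\<close>

lemma hodge_wedge_2:
  assumes \<omega>: "is_form 2 \<omega>" and ij: "i < 8" "j < 8"
  shows "hodge g \<Phi> 6 (wedge 4 2 \<Phi> \<omega>) (nth [e i, e j]) =
    (\<Sum>k<8. \<Sum>l<8. P k l i j * \<omega> (nth [e k, e l])) / 2"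
proof -
  let ?S = "{..<6} \<rightarrow>\<^sub>E {..<8::nat}"
  let ?X = "\<lambda>I. \<omega> (\<lambda>m. e (I (4 + m))) *
      wedge1 (coframe g e) [0..<8] (\<lambda>m. if m < 6 then e (I m) else nth [e i, e j] (m - 6))"
  let ?vol = "\<lambda>T k l. wedge1 (coframe g e) [0..<8] (nth (map e T @ [e k, e l, e i, e j]))"
  have "hodge g \<Phi> 6 (wedge 4 2 \<Phi> \<omega>) (nth [e i, e j]) = (\<Sum>I\<in>?S. \<Phi> (\<lambda>m. e (I m)) * ?X I) / 48"
    using hodge_frame_wedge[of 4 2 g e \<Phi> \<omega> "nth [e i, e j]"]
    by (simp add: hodge_eq fact_numeral mult.assoc cong: if_cong)
  also have "(\<Sum>I\<in>?S. \<Phi> (\<lambda>m. e (I m)) * ?X I) =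
      (\<Sum>I\<in>?S. (\<Sum>(s, T)\<leftarrow>spin7_terms. s * wedge1 (coframe g e) T (\<lambda>m. e (I m))) * ?X I)"
    using fun_cong[OF model] by (simp add: spin7_model_def)
  also have "\<dots> = (\<Sum>(s, T)\<leftarrow>spin7_terms. s * (\<Sum>I\<in>?S. wedge1 (coframe g e) T (\<lambda>m. e (I m)) * ?X I))"
    by (rule sum_list_mult_sum)
  also have "\<dots> = (\<Sum>(s, T)\<leftarrow>spin7_terms. s * (\<Sum>(k, l)\<in>{..<8} \<times> {..<8}. ?vol T k l * (24 * \<omega> (nth [e k, e l]))))"
  proof (rule spin7_terms_cong)
    fix T :: "nat list" assume "length T = 4" "set T \<subseteq> {..<8}"
    from hodge_frame_wedge_wedge1[OF orthonormal this \<omega>, of "e i" "e j"]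
    show "(\<Sum>I\<in>?S. wedge1 (coframe g e) T (\<lambda>m. e (I m)) * ?X I) =
      (\<Sum>(k, l)\<in>{..<8} \<times> {..<8}. ?vol T k l * (24 * \<omega> (nth [e k, e l])))"
      by (simp add: sum.cartesian_product[symmetric] sum_distrib_left mult_ac)
  qed
  also have "\<dots> = (\<Sum>(k, l)\<in>{..<8} \<times> {..<8}. (\<Sum>(s, T)\<leftarrow>spin7_terms. s * ?vol T k l) * (24 * \<omega> (nth [e k, e l])))"
    using sum_list_mult_sum[where L = spin7_terms and W = "\<lambda>T (k, l). ?vol T k l"
      and X = "\<lambda>(k, l). 24 * \<omega> (nth [e k, e l])" and A = "{..<8} \<times> {..<8}"]
    by (simp add: split_def)
  also have "\<dots> = 24 * (\<Sum>k<8. \<Sum>l<8. P k l i j * \<omega> (nth [e k, e l]))"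
    using self_dual ij by (simp add: sum.cartesian_product[symmetric] sum_distrib_left mult_ac)
  finally show ?thesis by simp
qed

lemma F_linear: "linear (\<lambda>x. F x b c d)" "linear (\<lambda>x. F a x c d)" "linear (\<lambda>x. F a b x d)" "linear (\<lambda>x. F a b c x)"
  by (rule form4_linear[OF form])+

lemma F_skew: "F b a c d = - F a b c d" "F a c b d = - F a b c d" "F a b d c = - F a b c d"
  by (rule form4_skew[OF form])+

lemmas F_expand = linear_expansion[OF F_linear(1)] linear_expansion[OF F_linear(2)]
  linear_expansion[OF F_linear(3)] linear_expansion[OF F_linear(4)]

lemmas F_lin = F_linear[THEN linear_add] F_linear[THEN linear_scale] F_linear[THEN linear_diff]

lemma eigenform_frame:
  assumes \<omega>: "is_form 2 \<omega>" and eig: "hodge g \<Phi> 6 (wedge 4 2 \<Phi> \<omega>) = (\<lambda>v. c * \<omega> v)" and ij: "i < 8" "j < 8"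
  shows "(\<Sum>k<8. \<Sum>l<8. P k l i j * \<omega> (nth [e k, e l])) = 2 * c * \<omega> (nth [e i, e j])"
  using hodge_wedge_2[OF \<omega> ij] fun_cong[OF eig, of "nth [e i, e j]"] by simp

lemma endo_form_nth: "endo_form g A (nth [v, w]) = g (A v) w"
  by (simp add: endo_form_def)

text \<open>The derivation that an endomorphism induces on an alternating form is again alternating,
  so the component identity \<open>stabilizer\<close> on increasing frame indices suffices. This is
  where \<open>Lambda2_21\<close> becomes the Lie algebra of the stabilizer of
  \<open>\<Phi>\<close>.\<close>

lemma spin7_annihilates:
  assumes A: "linear A" and \<omega>: "endo_form g A \<in> Lambda2_21 g \<Phi>"
  shows "F (A a) b c d + F a (A b) c d + F a b (A c) d + F a b c (A d) = 0"
proof -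
  let ?G = "\<lambda>a b c d. F (A a) b c d + F a (A b) c d + F a b (A c) d + F a b c (A d)"
  have form2: "is_form 2 (endo_form g A)"
    and eig: "hodge g \<Phi> 6 (wedge 4 2 \<Phi> (endo_form g A)) = (\<lambda>v. (- 1) * endo_form g A v)"
    using \<omega> by (auto simp: Lambda2_21_def)
  define w where "w i j = g (A (e i)) (e j)" for i j
  have skew: "w j i = - w i j" for i j
    using is_form_swap_nth[OF form2, of "[]" "[]" "e j" "e i"] by (simp add: endo_form_nth w_def)
  have eig': "(\<Sum>k<8. \<Sum>l<8. P k l i j * w k l) = - 2 * w i j" if "i < 8" "j < 8" for i j
    using eigenform_frame[OF form2 eig that] by (simp add: endo_form_nth w_def)
  have c: "g (e m) (A (e i)) = w i m" for i m
    unfolding w_def by (rule sym)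
  have expand: "F (A (e i)) b c d = (\<Sum>m<8. w i m * F (e m) b c d)" "F b (A (e i)) c d = (\<Sum>m<8. w i m * F b (e m) c d)"
    "F b c (A (e i)) d = (\<Sum>m<8. w i m * F b c (e m) d)" "F b c d (A (e i)) = (\<Sum>m<8. w i m * F b c d (e m))" for i b c d
    unfolding c[symmetric] by (rule F_expand)+
  show ?thesis
  proof (rule alternating_eq_0[where G = ?G])
    show "linear (\<lambda>a. ?G a b c d)" for b c d
      by (rule linearI) (simp_all add: F_lin linear_add[OF A] linear_scale[OF A] algebra_simps)
    show "?G b a c d = - ?G a b c d" for a b c d
      using F_skew(1)[of "A b" a c d] F_skew(1)[of b "A a" c d] F_skew(1)[of b a "A c" d] F_skew(1)[of b a c "A d"]
      by linarith
    show "?G a c b d = - ?G a b c d" for a b c d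
      using F_skew(2)[of "A a" c b d] F_skew(2)[of a "A c" b d] F_skew(2)[of a c "A b" d] F_skew(2)[of a c b "A d"]
      by linarith
    show "?G a b d c = - ?G a b c d" for a b c d
      using F_skew(3)[of "A a" b d c] F_skew(3)[of a "A b" d c] F_skew(3)[of a b "A d" c] F_skew(3)[of a b d "A c"]
      by linarith
    fix i j k l :: nat assume "i < j" "j < k" "k < l" "l < 8"
    from tensor.stabilizer[OF skew eig' this]
    show "?G (e i) (e j) (e k) (e l) = 0"
      unfolding expand P_def sum.distrib .
  qed
qed

text \<open>The defect of the formula is linear in each of \<open>u\<close>, \<open>v\<close>,
  \<open>w\<close>, so \<open>torsion_eq\<close> on frame vectors is enough. \<open>\<xi>\<close>
  and \<open>\<theta>\<close> are kept arbitrary because the lemma will be applied with both signs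
  reversed.\<close>

lemma torsion_determined:
  assumes \<xi>: "bilinear \<xi>" and 7: "\<And>u. endo_form g (\<xi> u) \<in> Lambda2_7 g \<Phi>"
    and \<theta>: "linear \<theta>"
    and d: "\<And>v0 v1 v2 v3 v4. F (\<xi> v0 v1 - \<xi> v1 v0) v2 v3 v4 - F (\<xi> v0 v2 - \<xi> v2 v0) v1 v3 v4
        + F (\<xi> v0 v3 - \<xi> v3 v0) v1 v2 v4 - F (\<xi> v0 v4 - \<xi> v4 v0) v1 v2 v3
        + F (\<xi> v1 v2 - \<xi> v2 v1) v0 v3 v4 - F (\<xi> v1 v3 - \<xi> v3 v1) v0 v2 v4
        + F (\<xi> v1 v4 - \<xi> v4 v1) v0 v2 v3 + F (\<xi> v2 v3 - \<xi> v3 v2) v0 v1 v4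
        - F (\<xi> v2 v4 - \<xi> v4 v2) v0 v1 v3 + F (\<xi> v3 v4 - \<xi> v4 v3) v0 v1 v2
      = \<theta> v0 * F v1 v2 v3 v4 - \<theta> v1 * F v0 v2 v3 v4 + \<theta> v2 * F v0 v1 v3 v4
        - \<theta> v3 * F v0 v1 v2 v4 + \<theta> v4 * F v0 v1 v2 v3"
    and V: "\<And>w. g V w = \<theta> w"
  shows "g (\<xi> u v) w = (g u v * \<theta> w - g u w * \<theta> v - F V u v w) / 16"
proof -
  have form2: "is_form 2 (endo_form g (\<xi> u))"
    and eig: "hodge g \<Phi> 6 (wedge 4 2 \<Phi> (endo_form g (\<xi> u))) = (\<lambda>v. 3 * endo_form g (\<xi> u) v)" for u
    using 7 by (auto simp: Lambda2_7_def)
  have \<xi>_lin: "linear (\<xi> u)" "linear (\<lambda>u. \<xi> u v)" for u v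
    using \<xi> by (auto simp: bilinear_def)
  define x where "x u i j = g (\<xi> (e u) (e i)) (e j)" for u i j
  have skew: "x u j i = - x u i j" for u i j
    using is_form_swap_nth[OF form2[of "e u"], of "[]" "[]" "e j" "e i"] by (simp add: endo_form_nth x_def)
  have eig': "(\<Sum>k<8. \<Sum>l<8. P k l i j * x u k l) = 6 * x u i j" if "i < 8" "j < 8" for u i j
    using eigenform_frame[OF form2[of "e u"] eig that] by (simp add: endo_form_nth x_def)
  have expand: "F (\<xi> (e p) (e q) - \<xi> (e q) (e p)) b c d = (\<Sum>m<8. (x p q m - x q p m) * F (e m) b c d)" for p q b c d
  proof -
    have "g (e m) (\<xi> (e p) (e q) - \<xi> (e q) (e p)) = x p q m - x q p m" for m
      unfolding x_def by (metis sym linear_diff[OF g_linear(2)])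
    then show ?thesis
      unfolding F_expand(1)[of "\<xi> (e p) (e q) - \<xi> (e q) (e p)" b c d] by simp
  qed
  have d': "(\<Sum>m<8. (x p q m - x q p m) * P m r s t - (x p r m - x r p m) * P m q s t
        + (x p s m - x s p m) * P m q r t - (x p t m - x t p m) * P m q r s
        + (x q r m - x r q m) * P m p s t - (x q s m - x s q m) * P m p r t
        + (x q t m - x t q m) * P m p r s + (x r s m - x s r m) * P m p q t
        - (x r t m - x t r m) * P m p q s + (x s t m - x t s m) * P m p q r)
      = \<theta> (e p) * P q r s t - \<theta> (e q) * P p r s t + \<theta> (e r) * P p q s t - \<theta> (e s) * P p q r t + \<theta> (e t) * P p q r s"
    for p q r s t
    using d[of "e p" "e q" "e r" "e s" "e t"] unfolding expand P_def sum.distrib sum_subtractf .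
  have frame_eq: "x u i j = ((if u = i then \<theta> (e j) else 0) - (if u = j then \<theta> (e i) else 0)
    - (\<Sum>k<8. \<theta> (e k) * P k u i j)) / 16" if "u < 8" "i < 8" "j < 8" for u i j
    by (rule tensor.torsion_eq[where \<theta> = "\<lambda>i. \<theta> (e i)", OF skew eig' d' that])
  have cV: "g (e m) V = \<theta> (e m)" for m
    by (metis sym V)
  define H where "H u v w = g (\<xi> u v) w - (g u v * \<theta> w - g u w * \<theta> v - F V u v w) / 16" for u v w
  have H_lin: "linear (\<lambda>u. H u v w)" "linear (\<lambda>v. H u v w)" "linear (\<lambda>w. H u v w)" for u v w
    unfolding H_def
    by (rule linearI; simp add: F_lin linear_add[OF \<xi>_lin(1)] linear_scale[OF \<xi>_lin(1)]
        linear_add[OF \<xi>_lin(2)] linear_scale[OF \<xi>_lin(2)] linear_add[OF \<theta>] linear_scale[OF \<theta>]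
        g_linear[THEN linear_add] g_linear[THEN linear_scale] field_simps)+
  have H1: "H (e u) (e i) (e j) = 0" if "u < 8" "i < 8" "j < 8" for u i j
    using frame_eq[OF that] that unfolding H_def F_expand(1)[of V] cV
    by (simp add: x_def g_frame P_def)
  have H2: "H (e u) (e i) w = 0" if "u < 8" "i < 8" for u i w
    by (rule linear_eq_0[OF H_lin(3)]) (rule H1[OF that])
  have H3: "H (e u) v w = 0" if "u < 8" for u v w
    by (rule linear_eq_0[OF H_lin(2)]) (rule H2[OF that])
  have "H u v w = 0"
    by (rule linear_eq_0[OF H_lin(1)]) (rule H3)
  then show ?thesis by (simp add: H_def)
qed

lemma wedge_form4_eq_0D:
  assumes \<theta>: "linear \<theta>"
    and d: "\<And>v0 v1 v2 v3 v4. \<theta> v0 * F v1 v2 v3 v4 - \<theta> v1 * F v0 v2 v3 v4 + \<theta> v2 * F v0 v1 v3 v4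
        - \<theta> v3 * F v0 v1 v2 v4 + \<theta> v4 * F v0 v1 v2 v3 = 0"
  shows "\<theta> v = 0"
  by (rule linear_eq_0[OF \<theta>])
    (rule tensor.wedge_eq_0D[where \<theta> = "\<lambda>i. \<theta> (e i)"], simp_all add: P_def d)

text \<open>For a connection with torsion \<open>T\<close> that leaves \<open>F V\<close> parallel,
  the left side is the exterior derivative of this three-form. The difference of the two sides is
  alternating, so the frame identity \<open>torsion_contraction\<close> extends to all
  vectors.\<close>

lemma parallel_contraction:
  assumes \<theta>: "linear \<theta>" and V: "\<And>w. g V w = \<theta> w"
    and T: "bilinear T" "\<And>a b. T b a = - T a b"
      "\<And>a b w. g (T a b) w = (g b w * \<theta> a - g a w * \<theta> b - 2 * F V a b w) / 16"
  shows "F V (T a b) c d - F V (T a c) b d + F V (T a d) b c + F V (T b c) a d - F V (T b d) a c + F V (T c d) a b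
    = 15 / 16 * (\<theta> a * F V b c d - \<theta> b * F V a c d + \<theta> c * F V a b d - \<theta> d * F V a b c)
      - 3 / 4 * \<theta> V * F a b c d"
proof -
  let ?L = "\<lambda>a b c d. F V (T a b) c d - F V (T a c) b d + F V (T a d) b c
    + F V (T b c) a d - F V (T b d) a c + F V (T c d) a b"
  let ?R = "\<lambda>a b c d. 15 / 16 * (\<theta> a * F V b c d - \<theta> b * F V a c d + \<theta> c * F V a b d - \<theta> d * F V a b c)
      - 3 / 4 * \<theta> V * F a b c d"
  have T_lin: "linear (T u)" "linear (\<lambda>u. T u v)" for u v
    using T(1) by (auto simp: bilinear_def)
  define f where "f i j k = (\<Sum>n<8. \<theta> (e n) * P n i j k)" for i j k
  have cV: "g (e m) V = \<theta> (e m)" for m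
    by (metis sym V)
  have f: "F V (e i) (e j) (e k) = f i j k" for i j k
    unfolding F_expand(1)[of V] f_def cV P_def ..
  define \<tau> where "\<tau> i j m = ((if j = m then \<theta> (e i) else 0) - (if i = m then \<theta> (e j) else 0) - 2 * f i j m) / 16" for i j m
  have expand: "F V (T (e i) (e j)) (e k) (e l) = (\<Sum>m<8. \<tau> i j m * f m k l)" if "i < 8" "j < 8" for i j k l
  proof -
    have "g (e m) (T (e i) (e j)) = \<tau> i j m" if "m < 8" for m
      unfolding sym[of "e m"] T(3) f \<tau>_def using that \<open>i < 8\<close> \<open>j < 8\<close> by (simp add: g_frame)
    then show ?thesis
      unfolding F_expand(2)[of V "T (e i) (e j)"] f by simp
  qed
  have norm: "\<theta> V = (\<Sum>k<8. \<theta> (e k) * \<theta> (e k))"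
    unfolding linear_expansion[OF \<theta>, of V] by (simp add: cV)
  have F_neg: "F x (- y) c d = - F x y c d" for x y c d
    using linear_neg[OF F_linear(2)] .
  have "?L a b c d - ?R a b c d = 0"
  proof (rule alternating_eq_0[where G = "\<lambda>a b c d. ?L a b c d - ?R a b c d"])
    show "linear (\<lambda>a. ?L a b c d - ?R a b c d)" for b c d
      by (rule linearI) (simp_all add: F_lin linear_add[OF T_lin(2)] linear_scale[OF T_lin(2)]
          linear_add[OF \<theta>] linear_scale[OF \<theta>] algebra_simps)
    show "?L b a c d - ?R b a c d = - (?L a b c d - ?R a b c d)" for a b c d
      using F_skew(3)[of V a b c] F_skew(1)[of b a c d] F_skew(2)[of V b a c] F_skew(2)[of V b a d]
        F_skew(3)[of V "T c d" b a]
      by (simp add: T(2)[of b a] F_neg algebra_simps)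
    show "?L a c b d - ?R a c b d = - (?L a b c d - ?R a b c d)" for a b c d
      using F_skew(2)[of a c b d] F_skew(2)[of V c b d] F_skew(3)[of V a c b]
        F_skew(3)[of V "T a d" c b]
      by (simp add: T(2)[of c b] F_neg algebra_simps)
    show "?L a b d c - ?R a b d c = - (?L a b c d - ?R a b c d)" for a b c d
      using F_skew(3)[of a b d c] F_skew(3)[of V b d c] F_skew(3)[of V a d c]
        F_skew(3)[of V "T a b" d c]
      by (simp add: T(2)[of d c] F_neg algebra_simps)
    fix i j k l :: nat assume ord: "i < j" "j < k" "k < l" "l < 8"
    from tensor.torsion_contraction[OF ord, of "\<lambda>i. \<theta> (e i)", folded f_def \<tau>_def norm]
    show "?L (e i) (e j) (e k) (e l) - ?R (e i) (e j) (e k) (e l) = 0"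
      using ord by (simp add: expand f norm \<tau>_def sum.distrib sum_subtractf P_def[symmetric])
  qed
  then show ?thesis by simp
qed

end

subsection \<open>Smooth functions\<close>

lemma frechet_derivative_cong_open:
  assumes "open S" "x \<in> S" "\<And>y. y \<in> S \<Longrightarrow> f y = h y"
  shows "frechet_derivative f (at x) = frechet_derivative h (at x)"
proof -
  have "(f has_derivative f') (at x) \<longleftrightarrow> (h has_derivative f') (at x)" for f'
    using has_derivative_transform_within_open[OF _ assms(1,2)] assms(3) by metis
  then show ?thesis by (simp add: frechet_derivative_def)
qed

lemma differentiable_cong_open:
  assumes "open S" "x \<in> S" "\<And>y. y \<in> S \<Longrightarrow> f y = h y"
  shows "f differentiable (at x) \<longleftrightarrow> h differentiable (at x)"
  unfolding differentiable_def
  using has_derivative_transform_within_open[OF _ assms(1,2)] assms(3) by metis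

lemma Ck_on_cong:
  assumes "open S" "\<And>x. x \<in> S \<Longrightarrow> f x = h x"
  shows "Ck_on k S f \<longleftrightarrow> Ck_on k S h"
  using assms(2)
proof (induction k arbitrary: f h)
  case 0
  then show ?case by (simp cong: continuous_on_cong)
next
  case (Suc k)
  have "frechet_derivative f (at x) v = frechet_derivative h (at x) v" if "x \<in> S" for x v
    using frechet_derivative_cong_open[OF assms(1) that, of f h] Suc.prems by simp
  then have "Ck_on k S (\<lambda>x. frechet_derivative f (at x) v) \<longleftrightarrow> Ck_on k S (\<lambda>x. frechet_derivative h (at x) v)" for v
    by (rule Suc.IH)
  moreover have "f differentiable (at x) \<longleftrightarrow> h differentiable (at x)" if "x \<in> S" for x
    using differentiable_cong_open[OF assms(1) that, of f h] Suc.prems by simp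
  ultimately show ?case by simp
qed

lemma Ck_on_subset: "Ck_on k S f \<Longrightarrow> T \<subseteq> S \<Longrightarrow> Ck_on k T f"
  by (induction k arbitrary: f) (auto intro: continuous_on_subset)

lemma Ck_on_SucD: "Ck_on (Suc k) S f \<Longrightarrow> Ck_on k S f"
proof (induction k arbitrary: f)
  case 0
  then show ?case
    by (auto intro!: continuous_at_imp_continuous_on differentiable_imp_continuous_within)
next
  case (Suc k)
  then show ?case by (metis Ck_on.simps(2))
qed

lemma frechet_derivative_eq: "(f has_derivative f') (at x) \<Longrightarrow> frechet_derivative f (at x) v = f' v"
  by (simp add: frechet_derivative_at[symmetric])

lemma Ck_on_const: "Ck_on k S (\<lambda>x. c)"
  by (induction k arbitrary: c) simp_all

lemma Ck_on_linear:
  assumes "open S" "bounded_linear L"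
  shows "Ck_on k S f \<Longrightarrow> Ck_on k S (\<lambda>x. L (f x))"
proof (induction k arbitrary: f)
  case 0
  then show ?case using assms(2) by (simp add: bounded_linear.continuous_on)
next
  case (Suc k)
  have d: "((\<lambda>x. L (f x)) has_derivative (\<lambda>v. L (frechet_derivative f (at x) v))) (at x)" if "x \<in> S" for x
    using Suc.prems that bounded_linear.has_derivative[OF assms(2)] by (auto simp: frechet_derivative_works)
  have "Ck_on k S (\<lambda>x. frechet_derivative (\<lambda>x. L (f x)) (at x) v)" for v
    using Suc.IH[of "\<lambda>x. frechet_derivative f (at x) v"] Suc.prems frechet_derivative_eq[OF d]
    by (subst Ck_on_cong[OF assms(1)]) auto
  then show ?case using d by (auto simp: differentiable_def)
qed

lemma Ck_on_add:
  assumes "open S"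
  shows "Ck_on k S f \<Longrightarrow> Ck_on k S h \<Longrightarrow> Ck_on k S (\<lambda>x. f x + h x)"
proof (induction k arbitrary: f h)
  case 0
  then show ?case by (auto intro: continuous_on_add)
next
  case (Suc k)
  have d: "((\<lambda>x. f x + h x) has_derivative (\<lambda>v. frechet_derivative f (at x) v + frechet_derivative h (at x) v)) (at x)"
    if "x \<in> S" for x
    using Suc.prems that by (intro has_derivative_add) (auto simp: frechet_derivative_works)
  have "Ck_on k S (\<lambda>x. frechet_derivative (\<lambda>x. f x + h x) (at x) v)" for v
    using Suc.IH[of "\<lambda>x. frechet_derivative f (at x) v" "\<lambda>x. frechet_derivative h (at x) v"]
      Suc.prems frechet_derivative_eq[OF d]
    by (subst Ck_on_cong[OF assms(1)]) auto
  then show ?case using d by (auto simp: differentiable_def)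
qed

lemma Ck_on_bilinear:
  assumes "open S" and p: "bounded_bilinear p"
  shows "Ck_on k S f \<Longrightarrow> Ck_on k S h \<Longrightarrow> Ck_on k S (\<lambda>x. p (f x) (h x))"
proof (induction k arbitrary: f h)
  case 0
  then show ?case using bounded_bilinear.continuous_on[OF p] by simp
next
  case (Suc k)
  have d: "((\<lambda>x. p (f x) (h x)) has_derivative
      (\<lambda>v. p (f x) (frechet_derivative h (at x) v) + p (frechet_derivative f (at x) v) (h x))) (at x)"
    if "x \<in> S" for x
    using Suc.prems that by (intro bounded_bilinear.FDERIV[OF p]) (auto simp: frechet_derivative_works)
  have "Ck_on k S (\<lambda>x. frechet_derivative (\<lambda>x. p (f x) (h x)) (at x) v)" for v
    using Ck_on_add[OF assms(1) Suc.IH[OF Ck_on_SucD[OF Suc.prems(1)], of "\<lambda>x. frechet_derivative h (at x) v"]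
        Suc.IH[OF _ Ck_on_SucD[OF Suc.prems(2)], of "\<lambda>x. frechet_derivative f (at x) v"]]
      Suc.prems frechet_derivative_eq[OF d]
    by (subst Ck_on_cong[OF assms(1)]) auto
  then show ?case using d by (auto simp: differentiable_def)
qed

lemma smooth_on_cong: "open S \<Longrightarrow> (\<And>x. x \<in> S \<Longrightarrow> f x = h x) \<Longrightarrow> smooth_on S f \<longleftrightarrow> smooth_on S h"
  unfolding smooth_on_def by (metis Ck_on_cong)

lemma smooth_on_subset: "smooth_on S f \<Longrightarrow> T \<subseteq> S \<Longrightarrow> smooth_on T f"
  unfolding smooth_on_def by (metis Ck_on_subset)

lemma smooth_on_const: "smooth_on S (\<lambda>x. c)"
  by (simp add: smooth_on_def Ck_on_const)

lemma smooth_on_linear: "open S \<Longrightarrow> bounded_linear L \<Longrightarrow> smooth_on S f \<Longrightarrow> smooth_on S (\<lambda>x. L (f x))"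
  unfolding smooth_on_def by (metis Ck_on_linear)

lemma smooth_on_add: "open S \<Longrightarrow> smooth_on S f \<Longrightarrow> smooth_on S h \<Longrightarrow> smooth_on S (\<lambda>x. f x + h x)"
  unfolding smooth_on_def by (metis Ck_on_add)

lemma smooth_on_scaleR: "open S \<Longrightarrow> smooth_on S f \<Longrightarrow> smooth_on S h \<Longrightarrow> smooth_on S (\<lambda>x. f x *\<^sub>R h x)"
  unfolding smooth_on_def using Ck_on_bilinear[OF _ bounded_bilinear_scaleR] by blast

lemma smooth_on_mult:
  fixes f h :: "vec8 \<Rightarrow> real"
  shows "open S \<Longrightarrow> smooth_on S f \<Longrightarrow> smooth_on S h \<Longrightarrow> smooth_on S (\<lambda>x. f x * h x)"
  using smooth_on_scaleR[of S f h] by simp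

lemma smooth_on_diff:
  assumes "open S" "smooth_on S f" "smooth_on S h"
  shows "smooth_on S (\<lambda>x. f x - h x)"
  using smooth_on_add[OF assms(1,2) smooth_on_linear[OF assms(1) bounded_linear_minus[OF bounded_linear_ident] assms(3)]]
  by simp

lemma smooth_on_sum:
  assumes "open S" "finite I" "\<And>i. i \<in> I \<Longrightarrow> smooth_on S (f i)"
  shows "smooth_on S (\<lambda>x. \<Sum>i\<in>I. f i x)"
  using assms(2,3) by (induction I rule: finite_induct) (auto intro!: smooth_on_const smooth_on_add assms(1))

lemma smooth_on_differentiable: "smooth_on S f \<Longrightarrow> x \<in> S \<Longrightarrow> f differentiable (at x)"
  unfolding smooth_on_def by (metis Ck_on.simps(2))

lemma smooth_on_has_derivative:
  "smooth_on S f \<Longrightarrow> x \<in> S \<Longrightarrow> (f has_derivative frechet_derivative f (at x)) (at x)"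
  using smooth_on_differentiable frechet_derivative_works by blast

lemma smooth_on_frechet_derivative: "smooth_on S f \<Longrightarrow> smooth_on S (\<lambda>x. frechet_derivative f (at x) v)"
  unfolding smooth_on_def by (metis Ck_on.simps(2))

lemma smooth_on_continuous: "smooth_on S f \<Longrightarrow> continuous_on S f"
  unfolding smooth_on_def by (metis Ck_on.simps(1))

text \<open>The mean value theorem is applied in direction \<open>u\<close> to the increment in
  direction \<open>v\<close>, and then in direction \<open>v\<close>. The second difference is
  symmetric in \<open>u\<close> and \<open>v\<close>, whereas the derivative is taken in a fixed
  order.\<close>

lemma second_difference:
  fixes f :: "vec8 \<Rightarrow> real"
  assumes f: "smooth_on S f" and h: "h > 0"
    and S: "\<And>s t. 0 \<le> s \<Longrightarrow> s \<le> h \<Longrightarrow> 0 \<le> t \<Longrightarrow> t \<le> h \<Longrightarrow> x + s *\<^sub>R u + t *\<^sub>R v \<in> S"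
  shows "\<exists>s t. 0 < s \<and> s < h \<and> 0 < t \<and> t < h \<and>
    f (x + h *\<^sub>R u + h *\<^sub>R v) - f (x + h *\<^sub>R u) - f (x + h *\<^sub>R v) + f x =
    h * h * frechet_derivative (\<lambda>y. frechet_derivative f (at y) u) (at (x + s *\<^sub>R u + t *\<^sub>R v)) v"
proof -
  let ?f' = "\<lambda>y. frechet_derivative f (at y) u"
  have line: "((\<lambda>s. k (p + s *\<^sub>R w)) has_real_derivative frechet_derivative k (at (p + s *\<^sub>R w)) w) (at s)"
    if "smooth_on S k" "p + s *\<^sub>R w \<in> S" for k :: "vec8 \<Rightarrow> real" and p w s
  proof -
    have k: "(k has_derivative frechet_derivative k (at (p + s *\<^sub>R w))) (at (p + s *\<^sub>R w))"
      by (rule smooth_on_has_derivative[OF that])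
    have "((\<lambda>s. p + s *\<^sub>R w) has_derivative (\<lambda>r. r *\<^sub>R w)) (at s)"
      by (auto intro!: derivative_eq_intros)
    from diff_chain_at[OF this k] have "((\<lambda>s. k (p + s *\<^sub>R w)) has_derivative
        (\<lambda>r. frechet_derivative k (at (p + s *\<^sub>R w)) (r *\<^sub>R w))) (at s)"
      by (simp add: o_def)
    then show ?thesis
      unfolding has_field_derivative_def
      by (simp add: linear_scale[OF has_derivative_linear[OF k]] mult_commute_abs)
  qed
  define q where "q s = f (x + s *\<^sub>R u + h *\<^sub>R v) - f (x + s *\<^sub>R u)" for s
  have q: "(q has_real_derivative ?f' (x + s *\<^sub>R u + h *\<^sub>R v) - ?f' (x + s *\<^sub>R u)) (at s)" if "0 \<le> s" "s \<le> h" for s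
  proof -
    have "x + h *\<^sub>R v + s *\<^sub>R u \<in> S" "x + s *\<^sub>R u \<in> S"
      using S[OF that, of h] S[OF that, of 0] h by (simp_all add: add.assoc add.commute[of "h *\<^sub>R v"])
    from line[OF f this(1)] line[OF f this(2)] show ?thesis
      unfolding q_def by (intro DERIV_diff) (simp_all add: add.assoc add.commute[of "h *\<^sub>R v"])
  qed
  obtain s where s: "0 < s" "s < h" "q h - q 0 = (h - 0) * (?f' (x + s *\<^sub>R u + h *\<^sub>R v) - ?f' (x + s *\<^sub>R u))"
    using MVT2[OF h q] by auto
  have p: "((\<lambda>t. ?f' (x + s *\<^sub>R u + t *\<^sub>R v)) has_real_derivative
      frechet_derivative ?f' (at (x + s *\<^sub>R u + t *\<^sub>R v)) v) (at t)" if "0 \<le> t" "t \<le> h" for t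
    by (rule line[OF smooth_on_frechet_derivative[OF f]]) (use S that s in simp)
  obtain t where t: "0 < t" "t < h" "?f' (x + s *\<^sub>R u + h *\<^sub>R v) - ?f' (x + s *\<^sub>R u + 0 *\<^sub>R v) =
      (h - 0) * frechet_derivative ?f' (at (x + s *\<^sub>R u + t *\<^sub>R v)) v"
    using MVT2[OF h p] by auto
  have "q h - q 0 = h * h * frechet_derivative ?f' (at (x + s *\<^sub>R u + t *\<^sub>R v)) v"
    using s(3) t(3) by simp
  then show ?thesis
    using s(1,2) t(1,2) by (intro exI[of _ s] exI[of _ t]) (simp add: q_def)
qed

text \<open>One and the same second difference is \<open>h * h\<close> times a nearby value of
  either mixed derivative. By continuity each value is closer to its limit than half the gap at
  \<open>x\<close>, so there is no gap.\<close>

lemma frechet_derivative_commute: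
  fixes f :: "vec8 \<Rightarrow> real"
  assumes S: "open S" and f: "smooth_on S f" and x: "x \<in> S"
  shows "frechet_derivative (\<lambda>y. frechet_derivative f (at y) u) (at x) v =
    frechet_derivative (\<lambda>y. frechet_derivative f (at y) v) (at x) u"
proof (rule ccontr)
  define A where "A y = frechet_derivative (\<lambda>y. frechet_derivative f (at y) u) (at y) v" for y
  define B where "B y = frechet_derivative (\<lambda>y. frechet_derivative f (at y) v) (at y) u" for y
  assume "\<not> ?thesis"
  then have pos: "\<bar>A x - B x\<bar> / 2 > 0" by (simp add: A_def B_def)
  have "continuous_on S A" "continuous_on S B"
    unfolding A_def B_def
    by (intro smooth_on_continuous smooth_on_frechet_derivative f)+
  then have "isCont A x" "isCont B x"
    using S x by (auto simp: continuous_on_eq_continuous_at)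
  then obtain d1 d2 where d: "d1 > 0" "\<And>y. dist y x < d1 \<Longrightarrow> \<bar>A y - A x\<bar> < \<bar>A x - B x\<bar> / 2"
      "d2 > 0" "\<And>y. dist y x < d2 \<Longrightarrow> \<bar>B y - B x\<bar> < \<bar>A x - B x\<bar> / 2"
    using pos unfolding continuous_at_eps_delta dist_real_def by metis
  obtain d0 where d0: "d0 > 0" "ball x d0 \<subseteq> S"
    using S x by (auto simp: open_contains_ball)
  define \<delta> where "\<delta> = min d0 (min d1 d2)"
  have \<delta>: "\<delta> > 0" using d d0 by (simp add: \<delta>_def)
  \<comment> \<open>The summand 1 keeps \<open>n\<close> positive when \<open>u\<close> and
    \<open>v\<close> both vanish.\<close>
  define n where "n = norm u + norm v + 1"
  have n: "n > 0" by (simp add: n_def add_nonneg_pos)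
  define h where "h = \<delta> / (2 * n)"
  have h: "h > 0" using \<delta> n by (simp add: h_def)
  have near: "dist (x + s *\<^sub>R u + t *\<^sub>R v) x < \<delta>" if "0 \<le> s" "s \<le> h" "0 \<le> t" "t \<le> h" for s t
  proof -
    have "dist (x + s *\<^sub>R u + t *\<^sub>R v) x = norm (s *\<^sub>R u + t *\<^sub>R v)"
      by (simp add: dist_norm)
    also have "\<dots> \<le> s * norm u + t * norm v"
      using norm_triangle_ineq[of "s *\<^sub>R u" "t *\<^sub>R v"] that by simp
    also have "\<dots> \<le> h * norm u + h * norm v"
      using that by (intro add_mono mult_right_mono) auto
    also have "\<dots> \<le> h * n"
      using h by (simp add: n_def algebra_simps)
    also have "\<dots> = \<delta> / 2" using n by (simp add: h_def)
    also have "\<dots> < \<delta>" using \<delta> by simp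
    finally show ?thesis .
  qed
  have inS: "x + s *\<^sub>R u + t *\<^sub>R v \<in> S" if "0 \<le> s" "s \<le> h" "0 \<le> t" "t \<le> h" for s t
    using near[OF that] d0 by (auto simp: \<delta>_def dist_commute)
  have inS': "x + s *\<^sub>R v + t *\<^sub>R u \<in> S" if "0 \<le> s" "s \<le> h" "0 \<le> t" "t \<le> h" for s t
    using inS[OF that(3,4,1,2)] by (simp add: algebra_simps)
  obtain s t where st: "0 < s" "s < h" "0 < t" "t < h"
    "f (x + h *\<^sub>R u + h *\<^sub>R v) - f (x + h *\<^sub>R u) - f (x + h *\<^sub>R v) + f x = h * h * A (x + s *\<^sub>R u + t *\<^sub>R v)"
    using second_difference[OF f h inS] unfolding A_def by blast
  obtain s' t' where st': "0 < s'" "s' < h" "0 < t'" "t' < h"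
    "f (x + h *\<^sub>R v + h *\<^sub>R u) - f (x + h *\<^sub>R v) - f (x + h *\<^sub>R u) + f x = h * h * B (x + s' *\<^sub>R v + t' *\<^sub>R u)"
    using second_difference[OF f h inS'] unfolding B_def by blast
  have "h * h * A (x + s *\<^sub>R u + t *\<^sub>R v) = h * h * B (x + s' *\<^sub>R v + t' *\<^sub>R u)"
    using st(5) st'(5) by (simp add: algebra_simps)
  then have "A (x + s *\<^sub>R u + t *\<^sub>R v) = B (x + s' *\<^sub>R v + t' *\<^sub>R u)" using h by simp
  moreover have "\<bar>A (x + s *\<^sub>R u + t *\<^sub>R v) - A x\<bar> < \<bar>A x - B x\<bar> / 2"
    using near[of s t] st by (intro d(2)) (simp add: \<delta>_def)
  moreover have "\<bar>B (x + s' *\<^sub>R v + t' *\<^sub>R u) - B x\<bar> < \<bar>A x - B x\<bar> / 2"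
    using near[of t' s'] st' by (intro d(4)) (simp add: \<delta>_def algebra_simps)
  ultimately have "\<bar>A x - B x\<bar> < \<bar>A x - B x\<bar> / 2 + \<bar>A x - B x\<bar> / 2"
    by (smt (verit))
  then show False by simp
qed

section \<open>Fields of linear maps applied to moving vectors\<close>

lemma linear_component_expansion:
  fixes h :: "vec8 \<Rightarrow> real"
  assumes "linear h"
  shows "h a = (\<Sum>i\<in>UNIV. a $ i * h (axis i 1))"
  using arg_cong[OF basis_expansion[of a], of h]
  by (simp add: linear_sum[OF assms] linear_scale[OF assms] scalar_mult_eq_scaleR)

text \<open>Regularity of \<open>B\<close> is given for constant arguments only. Linearity resolves
  a moving argument into its eight coordinates, which leaves a finite sum of products.\<close>

lemma smooth_on_apply:
  fixes B :: "vec8 \<Rightarrow> vec8 \<Rightarrow> real"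
  assumes S: "open S" and B: "\<And>w. smooth_on S (\<lambda>y. B y w)" and lin: "\<And>y. y \<in> S \<Longrightarrow> linear (B y)"
    and a: "smooth_on S a"
  shows "smooth_on S (\<lambda>y. B y (a y))"
proof -
  have "smooth_on S (\<lambda>y. \<Sum>i\<in>UNIV. a y $ i * B y (axis i 1))"
    by (intro smooth_on_sum smooth_on_mult S B smooth_on_linear[OF S bounded_linear_vec_nth a]) auto
  then show ?thesis
    by (subst smooth_on_cong[OF S]) (auto intro: linear_component_expansion[OF lin])
qed

lemma has_derivative_apply:
  fixes B :: "vec8 \<Rightarrow> vec8 \<Rightarrow> real"
  assumes S: "open S" "x \<in> S" and B: "\<And>w. (\<lambda>y. B y w) differentiable (at x)"
    and lin: "\<And>y. y \<in> S \<Longrightarrow> linear (B y)" and a: "(a has_derivative a') (at x)"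
  shows "((\<lambda>y. B y (a y)) has_derivative
      (\<lambda>u. frechet_derivative (\<lambda>y. B y (a x)) (at x) u + B x (a' u))) (at x)"
proof -
  define D where "D i = frechet_derivative (\<lambda>y. B y (axis i 1)) (at x)" for i
  have D: "((\<lambda>y. B y (axis i 1)) has_derivative D i) (at x)" for i
    using B frechet_derivative_works unfolding D_def by blast
  \<comment> \<open>Used twice: for the constant \<open>a x\<close>, which identifies the first term
    of the claim, and for \<open>a\<close> itself.\<close>
  have main: "((\<lambda>y. B y (b y)) has_derivative (\<lambda>u. \<Sum>i\<in>UNIV. b x $ i * D i u + b' u $ i * B x (axis i 1))) (at x)"
    if b: "(b has_derivative b') (at x)" for b b'
  proof (rule has_derivative_transform_within_open[OF _ S])
    show "((\<lambda>y. \<Sum>i\<in>UNIV. b y $ i * B y (axis i 1)) has_derivative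
        (\<lambda>u. \<Sum>i\<in>UNIV. b x $ i * D i u + b' u $ i * B x (axis i 1))) (at x)"
      by (intro has_derivative_sum has_derivative_mult D bounded_linear.has_derivative[OF bounded_linear_vec_nth b])
  qed (simp add: linear_component_expansion[OF lin, symmetric])
  have "frechet_derivative (\<lambda>y. B y (a x)) (at x) u = (\<Sum>i\<in>UNIV. a x $ i * D i u)" for u
    using frechet_derivative_eq[OF main[OF has_derivative_const[of "a x"]]] by simp
  moreover have "B x (a' u) = (\<Sum>i\<in>UNIV. a' u $ i * B x (axis i 1))" for u
    by (rule linear_component_expansion[OF lin[OF S(2)]])
  ultimately show ?thesis
    using main[OF a] by (simp add: sum.distrib)
qed

subsection \<open>Exterior derivative and Lee form\<close>

text \<open>Alternating sum over the argument put into the distinguished slot of \<open>H\<close>.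
  With \<open>H\<close> the directional derivative of a four-form it is the exterior derivative,
  with \<open>H\<close> the product of \<open>\<theta>\<close> and \<open>\<Phi>\<close> it is
  \<open>\<theta> \<and> \<Phi>\<close>.\<close>

definition alt5 :: "(vec8 \<Rightarrow> vec8 \<Rightarrow> vec8 \<Rightarrow> vec8 \<Rightarrow> vec8 \<Rightarrow> real) \<Rightarrow> vec8 \<Rightarrow> vec8 \<Rightarrow> vec8 \<Rightarrow> vec8 \<Rightarrow> vec8 \<Rightarrow> real" where
  "alt5 H a b c d e = H a b c d e - H b a c d e + H c a b d e - H d a b c e + H e a b c d"

text \<open>The right side mentions neither the frame nor the form, so \<open>\<Phi>\<close> has
  constant components along every adapted local frame.\<close>

lemma adapted_frame_values:
  assumes "adapted_frame g \<Phi> e" "i < 8" "j < 8" "k < 8" "l < 8"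
  shows "form4 \<Phi> (e i) (e j) (e k) (e l) = (\<Sum>(s, T)\<leftarrow>spin7_terms. s * of_int (matching_sign T [i, j, k, l]))"
proof -
  have on: "orthonormal_frame g e" and \<Phi>: "\<Phi> = spin7_model (coframe g e)"
    using assms(1) by (auto simp: adapted_frame_def)
  have "form4 \<Phi> (e i) (e j) (e k) (e l) = (\<Sum>(s, T)\<leftarrow>spin7_terms. s * wedge1 (coframe g e) T (nth (map e [i, j, k, l])))"
    unfolding form4_def using fun_cong[OF \<Phi>] by (simp add: spin7_model_def)
  also have "\<dots> = (\<Sum>(s, T)\<leftarrow>spin7_terms. s * of_int (matching_sign T [i, j, k, l]))"
    by (rule spin7_terms_cong, rule wedge1_coframe[OF on]) (use assms in auto)
  finally show ?thesis .
qed

lemma linear_mult_const: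
  fixes h :: "'b::real_vector \<Rightarrow> real"
  shows "linear h \<Longrightarrow> linear (\<lambda>w. c * h w)"
  using linear_compose_scale_right[of h c] by simp

lemma linear_wedge1:
  assumes j: "j < length T" and \<epsilon>: "\<And>i. linear (\<epsilon> i)"
  shows "linear (\<lambda>w. wedge1 \<epsilon> T (u(j := w)))"
proof -
  have "linear (\<lambda>w. \<Prod>m<length T. \<epsilon> (T ! m) ((u(j := w)) (\<sigma> m)))"
    if \<sigma>: "\<sigma> permutes {..<length T}" for \<sigma>
  proof -
    have m: "inv \<sigma> j \<in> {..<length T}" "\<sigma> (inv \<sigma> j) = j"
      using \<sigma> j permutes_in_image[OF permutes_inv[OF \<sigma>]] permutes_inverses[OF \<sigma>] by auto
    have "(\<Prod>m<length T. \<epsilon> (T ! m) ((u(j := w)) (\<sigma> m))) =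
      \<epsilon> (T ! inv \<sigma> j) w * (\<Prod>m\<in>{..<length T} - {inv \<sigma> j}. \<epsilon> (T ! m) (u (\<sigma> m)))" for w
    proof -
      have "\<sigma> m \<noteq> j" if "m \<noteq> inv \<sigma> j" for m
        using that permutes_inverses[OF \<sigma>] by metis
      then have "(\<Prod>m\<in>{..<length T} - {inv \<sigma> j}. \<epsilon> (T ! m) ((u(j := w)) (\<sigma> m))) =
        (\<Prod>m\<in>{..<length T} - {inv \<sigma> j}. \<epsilon> (T ! m) (u (\<sigma> m)))"
        by (intro prod.cong) auto
      then show ?thesis
        using prod.remove[OF finite_lessThan m(1), of "\<lambda>m. \<epsilon> (T ! m) ((u(j := w)) (\<sigma> m))"] m(2) by simp
    qed
    then show ?thesis
      by (auto intro!: linearI simp: linear_add[OF \<epsilon>] linear_scale[OF \<epsilon>] distrib_right)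
  qed
  then show ?thesis
    unfolding wedge1_def
    by (intro linear_compose_sum ballI linear_mult_const) auto
qed

lemma hodge_frame_7_linear:
  assumes g: "bilinear g"
  shows "linear (\<lambda>w. hodge_frame g e 7 \<alpha> (\<lambda>_. w))"
    and "hodge_frame g e 7 \<alpha> v = hodge_frame g e 7 \<alpha> (\<lambda>_. v 0)"
proof -
  have cof: "linear (coframe g e i)" for i
    using g by (auto simp: bilinear_def coframe_def[abs_def])
  have slot: "wedge1 (coframe g e) [0..<8] (\<lambda>m. if m < 7 then e (I m) else v (m - 7)) =
      wedge1 (coframe g e) [0..<8] ((\<lambda>m. e (I m))(7 := v 0))" for I v
    unfolding wedge1_def
  proof (intro sum.cong[OF refl] arg_cong2[where f = "(*)"] prod.cong refl)
    fix \<sigma> m assume "\<sigma> \<in> {\<sigma>. \<sigma> permutes {..<length [0..<8::nat]}}" "m \<in> {..<length [0..<8::nat]}"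
    then have "\<sigma> m < 8" using permutes_in_image[of \<sigma> "{..<8}" m] by simp
    then have "\<sigma> m < 7 \<or> \<sigma> m = 7" by linarith
    then show "coframe g e ([0..<8] ! m) (if \<sigma> m < 7 then e (I (\<sigma> m)) else v (\<sigma> m - 7)) =
      coframe g e ([0..<8] ! m) (((\<lambda>m. e (I m))(7 := v 0)) (\<sigma> m))" by auto
  qed
  show "hodge_frame g e 7 \<alpha> v = hodge_frame g e 7 \<alpha> (\<lambda>_. v 0)"
    unfolding hodge_frame_def slot ..
  have lin: "linear (\<lambda>w. wedge1 (coframe g e) [0..<8] ((\<lambda>m. e (I m))(7 := w)))" for I
    by (rule linear_wedge1[OF _ cof]) simp
  show "linear (\<lambda>w. hodge_frame g e 7 \<alpha> (\<lambda>_. w))"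
    unfolding hodge_frame_def slot
    by (rule linearI) (simp_all add: linear_add[OF lin] linear_scale[OF lin] distrib_left sum.distrib
      add_divide_distrib sum_distrib_left mult_ac)
qed

text \<open>The star of degree 7 is a one-form whatever its argument: the vector enters only through
  the last slot of the volume form, and linearly.\<close>

lemma
  assumes "bilinear (g x)"
  shows lee_form_linear: "linear (\<lambda>w. lee_form g \<Phi> x (\<lambda>_. w))"
    and is_form_lee_form: "is_form 1 (lee_form g \<Phi> x)"
proof -
  have ap: "lee_form g \<Phi> x v = lee_form g \<Phi> x (\<lambda>_. v 0)" for v
    unfolding lee_form_def hodge_def using hodge_frame_7_linear(2)[OF assms] by metis
  show lin: "linear (\<lambda>w. lee_form g \<Phi> x (\<lambda>_. w))"
    unfolding lee_form_def hodge_def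
    using linear_compose_scale_right[OF hodge_frame_7_linear(1)[OF assms], of "1 / 7"] by simp
  have "lee_form g \<Phi> x (v(0 := y)) = lee_form g \<Phi> x (\<lambda>_. y)" for v y
    using ap[of "v(0 := y)"] by simp
  then show "is_form 1 (lee_form g \<Phi> x)"
    unfolding is_form_def using lin ap[of "_ :: nat \<Rightarrow> vec8"] by (auto; metis ap)
qed

lemma has_derivative_form4:
  fixes \<Phi> :: "vec8 \<Rightarrow> form"
  assumes S: "open S" "x \<in> S" and \<Phi>: "\<And>y. y \<in> S \<Longrightarrow> is_form 4 (\<Phi> y)" "\<And>v. (\<lambda>y. \<Phi> y v) differentiable (at x)"
    and d: "(a has_derivative a') (at x)" "(b has_derivative b') (at x)"
      "(c has_derivative c') (at x)" "(d has_derivative d') (at x)"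
  shows "((\<lambda>y. form4 (\<Phi> y) (a y) (b y) (c y) (d y)) has_derivative
    (\<lambda>u. frechet_derivative (\<lambda>y. form4 (\<Phi> y) (a x) (b x) (c x) (d x)) (at x) u
      + form4 (\<Phi> x) (a' u) (b x) (c x) (d x) + form4 (\<Phi> x) (a x) (b' u) (c x) (d x)
      + form4 (\<Phi> x) (a x) (b x) (c' u) (d x) + form4 (\<Phi> x) (a x) (b x) (c x) (d' u))) (at x)"
proof -
  note lin = form4_linear[OF \<Phi>(1)]
  have d0: "(\<lambda>y. form4 (\<Phi> y) p q r s) differentiable (at x)" for p q r s
    unfolding form4_def by (rule \<Phi>(2))
  have d1: "((\<lambda>y. form4 (\<Phi> y) p q r (d y)) has_derivative
    (\<lambda>u. frechet_derivative (\<lambda>y. form4 (\<Phi> y) p q r (d x)) (at x) u + form4 (\<Phi> x) p q r (d' u))) (at x)" for p q r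
    by (rule has_derivative_apply[OF S, of "\<lambda>y. form4 (\<Phi> y) p q r" d d']) (auto intro: d0 lin d)
  have d2: "((\<lambda>y. form4 (\<Phi> y) p q (c y) (d y)) has_derivative
    (\<lambda>u. frechet_derivative (\<lambda>y. form4 (\<Phi> y) p q (c x) (d x)) (at x) u + form4 (\<Phi> x) p q (c x) (d' u)
      + form4 (\<Phi> x) p q (c' u) (d x))) (at x)" for p q
    using has_derivative_apply[OF S, of "\<lambda>y w. form4 (\<Phi> y) p q w (d y)" c c'] d1 d(3)
    by (auto simp: frechet_derivative_eq[OF d1] lin differentiable_def)
  have d3: "((\<lambda>y. form4 (\<Phi> y) p (b y) (c y) (d y)) has_derivative
    (\<lambda>u. frechet_derivative (\<lambda>y. form4 (\<Phi> y) p (b x) (c x) (d x)) (at x) u + form4 (\<Phi> x) p (b x) (c x) (d' u)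
      + form4 (\<Phi> x) p (b x) (c' u) (d x) + form4 (\<Phi> x) p (b' u) (c x) (d x))) (at x)" for p
    using has_derivative_apply[OF S, of "\<lambda>y w. form4 (\<Phi> y) p w (c y) (d y)" b b'] d2 d(2)
    by (auto simp: frechet_derivative_eq[OF d2] lin differentiable_def)
  have "((\<lambda>y. form4 (\<Phi> y) (a y) (b y) (c y) (d y)) has_derivative
    (\<lambda>u. frechet_derivative (\<lambda>y. form4 (\<Phi> y) (a x) (b x) (c x) (d x)) (at x) u + form4 (\<Phi> x) (a x) (b x) (c x) (d' u)
      + form4 (\<Phi> x) (a x) (b x) (c' u) (d x) + form4 (\<Phi> x) (a x) (b' u) (c x) (d x) + form4 (\<Phi> x) (a' u) (b x) (c x) (d x))) (at x)"
    using has_derivative_apply[OF S, of "\<lambda>y w. form4 (\<Phi> y) w (b y) (c y) (d y)" a a'] d3 d(1)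
    by (auto simp: frechet_derivative_eq[OF d3] lin differentiable_def)
  then show ?thesis by (simp add: algebra_simps)
qed

lemma smooth_on_form4:
  assumes S: "open S" and \<Phi>: "\<And>y. y \<in> S \<Longrightarrow> is_form 4 (\<Phi> y)" "\<And>v. smooth_on S (\<lambda>y. \<Phi> y v)"
    and d: "smooth_on S a" "smooth_on S b" "smooth_on S c" "smooth_on S d"
  shows "smooth_on S (\<lambda>y. form4 (\<Phi> y) (a y) (b y) (c y) (d y))"
proof -
  note lin = form4_linear[OF \<Phi>(1)]
  have d0: "smooth_on S (\<lambda>y. form4 (\<Phi> y) p q r s)" for p q r s
    unfolding form4_def by (rule \<Phi>(2))
  have d1: "smooth_on S (\<lambda>y. form4 (\<Phi> y) p q r (d y))" for p q r
    by (rule smooth_on_apply[OF S, of "\<lambda>y. form4 (\<Phi> y) p q r" d]) (rule d0 lin d; assumption?)+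
  have d2: "smooth_on S (\<lambda>y. form4 (\<Phi> y) p q (c y) (d y))" for p q
    by (rule smooth_on_apply[OF S, of "\<lambda>y w. form4 (\<Phi> y) p q w (d y)" c]) (rule d1 lin d; assumption?)+
  have d3: "smooth_on S (\<lambda>y. form4 (\<Phi> y) p (b y) (c y) (d y))" for p
    by (rule smooth_on_apply[OF S, of "\<lambda>y w. form4 (\<Phi> y) p w (c y) (d y)" b]) (rule d2 lin d; assumption?)+
  show ?thesis
    by (rule smooth_on_apply[OF S, of "\<lambda>y w. form4 (\<Phi> y) w (b y) (c y) (d y)" a]) (rule d3 lin d; assumption?)+
qed

section \<open>Exterior derivative of a parallel four-form\<close>

text \<open>\<open>H z\<close> is the derivative in direction \<open>z\<close> of a four-form that
  is parallel for the connection \<open>C\<close>. In the alternating sum each \<open>C z w\<close>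
  meets \<open>C w z\<close> with the opposite sign, so only the torsion of \<open>C\<close>
  remains.\<close>

lemma alternating_torsion4:
  fixes G :: "vec8 \<Rightarrow> vec8 \<Rightarrow> vec8 \<Rightarrow> vec8 \<Rightarrow> real"
  assumes lin: "\<And>b c d. linear (\<lambda>a. G a b c d)"
    and s12: "\<And>a b c d. G b a c d = - G a b c d"
    and s23: "\<And>a b c d. G a c b d = - G a b c d"
    and s34: "\<And>a b c d. G a b d c = - G a b c d"
    and H: "\<And>z a b c d. H z a b c d = G (C z a) b c d + G a (C z b) c d + G a b (C z c) d + G a b c (C z d)"
  shows "alt5 H a b c d e =
      G (C a b - C b a) c d e - G (C a c - C c a) b d e + G (C a d - C d a) b c e - G (C a e - C e a) b c d
    + G (C b c - C c b) a d e - G (C b d - C d b) a c e + G (C b e - C e b) a c d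
    + G (C c d - C d c) a b e - G (C c e - C e c) a b d + G (C d e - C e d) a b c"
proof -
  have 2: "G x (C z w) y u = - G (C z w) x y u" for x z w y u by (rule s12)
  have 3: "G x y (C z w) u = G (C z w) x y u" for x z w y u
    using s23[of x y "C z w" u] s12[of x "C z w" y u] by simp
  have 4: "G x y u (C z w) = - G (C z w) x y u" for x z w y u
    using s34[of x y "C z w" u] 3[of x y z w u] s34[of x y u "C z w"] by simp
  show ?thesis
    unfolding alt5_def H 2 3 4 linear_diff[OF lin] by simp
qed

lemma ext_deriv_4:
  assumes D: "open D" "x \<in> D" and \<Phi>: "\<And>y. y \<in> D \<Longrightarrow> is_form 4 (\<Phi> y)"
  shows "ext_deriv 4 \<Phi> x (nth [a, b, c, d, e]) =
    alt5 (\<lambda>z a b c d. frechet_derivative (\<lambda>y. form4 (\<Phi> y) a b c d) (at x) z) a b c d e"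
proof -
  let ?v = "nth [a, b, c, d, e]"
  have cong: "frechet_derivative (\<lambda>y. \<Phi> y (\<lambda>m. if m < i then ?v m else ?v (Suc m))) (at x) =
      frechet_derivative (\<lambda>y. form4 (\<Phi> y) p q r s) (at x)"
    if "\<And>m. m < 4 \<Longrightarrow> (if m < i then ?v m else ?v (Suc m)) = nth [p, q, r, s] m" for i p q r s
    unfolding form4_def
    by (rule frechet_derivative_cong_open[OF D], rule is_form_cong[OF \<Phi>]) (use that in auto)
  have m4: "m < 4 \<Longrightarrow> m = 0 \<or> m = 1 \<or> m = 2 \<or> m = (3::nat)" for m by linarith
  have c0: "frechet_derivative (\<lambda>y. \<Phi> y (\<lambda>m. if m < 0 then ?v m else ?v (Suc m))) (at x) =
      frechet_derivative (\<lambda>y. form4 (\<Phi> y) b c d e) (at x)"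
    by (rule cong) (drule m4, auto)
  have c1: "frechet_derivative (\<lambda>y. \<Phi> y (\<lambda>m. if m < 1 then ?v m else ?v (Suc m))) (at x) =
      frechet_derivative (\<lambda>y. form4 (\<Phi> y) a c d e) (at x)"
    by (rule cong) (drule m4, auto)
  have c2: "frechet_derivative (\<lambda>y. \<Phi> y (\<lambda>m. if m < 2 then ?v m else ?v (Suc m))) (at x) =
      frechet_derivative (\<lambda>y. form4 (\<Phi> y) a b d e) (at x)"
    by (rule cong) (drule m4, auto)
  have c3: "frechet_derivative (\<lambda>y. \<Phi> y (\<lambda>m. if m < 3 then ?v m else ?v (Suc m))) (at x) =
      frechet_derivative (\<lambda>y. form4 (\<Phi> y) a b c e) (at x)"
    by (rule cong) (drule m4, auto)
  have c4: "frechet_derivative (\<lambda>y. \<Phi> y (\<lambda>m. if m < 4 then ?v m else ?v (Suc m))) (at x) =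
      frechet_derivative (\<lambda>y. form4 (\<Phi> y) a b c d) (at x)"
    by (rule cong) (drule m4, auto)
  have "(\<Sum>i\<le>4. h i) = h 0 + h 1 + h 2 + h 3 + h (4::nat)" for h :: "nat \<Rightarrow> real"
    by (simp add: eval_nat_numeral)
  then show ?thesis
    unfolding ext_deriv_def alt5_def using c0 c1 c2 c3 c4 by simp
qed

lemma wedge_1_4:
  assumes \<alpha>: "is_form 1 \<alpha>" and \<beta>: "is_form 4 \<beta>"
  shows "wedge 1 4 \<alpha> \<beta> (nth [a, b, c, d, e]) = alt5 (\<lambda>z p q r s. \<alpha> (\<lambda>_. z) * form4 \<beta> p q r s) a b c d e"
proof -
  let ?v = "nth [a, b, c, d, e]"
  have m4: "m < 4 \<Longrightarrow> m = 0 \<or> m = 1 \<or> m = 2 \<or> m = (3::nat)" for m by linarith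
  have cong: "\<beta> (\<lambda>m. ?v (Transposition.transpose 0 i (Suc m))) = form4 \<beta> p q r s"
    if "\<And>m. m < 4 \<Longrightarrow> ?v (Transposition.transpose 0 i (Suc m)) = nth [p, q, r, s] m" for i p q r s
    unfolding form4_def by (rule is_form_cong[OF \<beta>]) (rule that)
  have c0: "\<beta> (\<lambda>m. ?v (Transposition.transpose 0 0 (Suc m))) = form4 \<beta> b c d e"
    by (rule cong) (drule m4, auto simp: Transposition.transpose_def)
  have c1: "\<beta> (\<lambda>m. ?v (Transposition.transpose 0 1 (Suc m))) = form4 \<beta> a c d e"
    by (rule cong) (drule m4, auto simp: Transposition.transpose_def)
  have c2: "\<beta> (\<lambda>m. ?v (Transposition.transpose 0 2 (Suc m))) = form4 \<beta> b a d e"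
    by (rule cong) (drule m4, auto simp: Transposition.transpose_def)
  have c3: "\<beta> (\<lambda>m. ?v (Transposition.transpose 0 3 (Suc m))) = form4 \<beta> b c a e"
    by (rule cong) (drule m4, auto simp: Transposition.transpose_def)
  have c4: "\<beta> (\<lambda>m. ?v (Transposition.transpose 0 4 (Suc m))) = form4 \<beta> b c d a"
    by (rule cong) (drule m4, auto simp: Transposition.transpose_def)
  have "(\<Sum>i\<le>4. h i) = h 0 + h 1 + h 2 + h 3 + h (4::nat)" for h :: "nat \<Rightarrow> real"
    by (simp add: eval_nat_numeral)
  then show ?thesis
    using form4_skew(1)[OF \<beta>, of a b d e] form4_skew(1)[OF \<beta>, of a b c e] form4_skew(2)[OF \<beta>, of b a c e]
      form4_skew(1)[OF \<beta>, of a b c d] form4_skew(2)[OF \<beta>, of b a c d] form4_skew(3)[OF \<beta>, of b c a d]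
    unfolding wedge_one_form[OF \<alpha> \<beta>] alt5_def using c0 c1 c2 c3 c4 by simp
qed

text \<open>By \<open>alternating_torsion4\<close> this is \<open>dG\<close> for a four-form
  \<open>G\<close> that is parallel for a connection with torsion \<open>T\<close>.\<close>

definition torsion4 ::
  "(vec8 \<Rightarrow> vec8 \<Rightarrow> vec8) \<Rightarrow> (vec8 \<Rightarrow> vec8 \<Rightarrow> vec8 \<Rightarrow> vec8 \<Rightarrow> real) \<Rightarrow> vec8 \<Rightarrow> vec8 \<Rightarrow> vec8 \<Rightarrow> vec8 \<Rightarrow> vec8 \<Rightarrow> real"
  where "torsion4 T G a b c d e =
      G (T a b) c d e - G (T a c) b d e + G (T a d) b c e - G (T a e) b c d
    + G (T b c) a d e - G (T b d) a c e + G (T b e) a c d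
    + G (T c d) a b e - G (T c e) a b d + G (T d e) a b c"

text \<open>The value of the exterior derivative of \<open>F V\<close> predicted by
  \<open>parallel_contraction\<close>.\<close>

definition (in spin7_point) eta :: "(vec8 \<Rightarrow> real) \<Rightarrow> vec8 \<Rightarrow> vec8 \<Rightarrow> vec8 \<Rightarrow> vec8 \<Rightarrow> vec8 \<Rightarrow> real" where
  "eta \<theta> V a b c d = 15 / 16 * (\<theta> a * F V b c d - \<theta> b * F V a c d + \<theta> c * F V a b d - \<theta> d * F V a b c)
      - 3 / 4 * \<theta> V * F a b c d"

text \<open>With \<open>\<theta>\<close> closed,
  \<open>d(\<theta> \<and> \<phi>) = - \<theta> \<and> d\<phi>\<close>, and
  \<open>\<theta> \<and> d\<phi>\<close> keeps only the \<open>\<Phi>\<close>-part of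
  \<open>d\<phi>\<close>, which is -3/4 \<open>|\<theta>|\<^sup>2 \<theta> \<and> \<Phi>\<close>.
  Multiplied by -15/16 it gives 45/64; the \<open>\<Phi>\<close>-part itself gives -3/4 = -48/64.
  The remainder -3/64 is the whole obstruction.\<close>

lemma (in spin7_point) torsion4_eta:
  assumes \<theta>: "linear \<theta>" and V: "\<And>w. g V w = \<theta> w"
    and T: "bilinear T" "\<And>a b. T b a = - T a b"
      "\<And>a b w. g (T a b) w = (g b w * \<theta> a - g a w * \<theta> b - 2 * F V a b w) / 16"
    and d\<Phi>: "\<And>a b c d p. torsion4 T F a b c d p = alt5 (\<lambda>z a b c d. \<theta> z * F a b c d) a b c d p"
  shows "torsion4 T (eta \<theta> V) a b c d p = - 3 / 64 * \<theta> V * alt5 (\<lambda>z a b c d. \<theta> z * F a b c d) a b c d p"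
proof -
  \<comment> \<open>This is \<open>d\<theta> = 0\<close>: at \<open>w = V\<close> the metric terms
    of the torsion cancel and \<open>\<Phi>\<close> has a repeated argument.\<close>
  have \<theta>T: "\<theta> (T a b) = 0" for a b
  proof -
    have "F V a b V = 0"
      using F_skew(1)[of V a b V] F_skew(2)[of a V b V] F_skew(3)[of a b V V] by simp
    then show ?thesis
      using T(3)[of a b V] by (simp add: V[symmetric] sym[of _ V])
  qed
  define PC where "PC a b c d = F V (T a b) c d - F V (T a c) b d + F V (T a d) b c
      + F V (T b c) a d - F V (T b d) a c + F V (T c d) a b" for a b c d
  have PC: "PC a b c d = eta \<theta> V a b c d" for a b c d
    unfolding PC_def eta_def by (rule parallel_contraction[OF \<theta> V T])
  \<comment> \<open>The terms with the torsion inside \<open>\<theta>\<close> drop out; those with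
    the torsion inside \<open>F V\<close> assemble into \<open>- \<theta> \<and> PC\<close>.\<close>
  have "torsion4 T (eta \<theta> V) a b c d p = - 15 / 16 * (\<theta> a * PC b c d p - \<theta> b * PC a c d p
      + \<theta> c * PC a b d p - \<theta> d * PC a b c p + \<theta> p * PC a b c d) - 3 / 4 * \<theta> V * torsion4 T F a b c d p"
    unfolding torsion4_def eta_def PC_def \<theta>T by (simp add: algebra_simps)
  also have "\<dots> = - 3 / 64 * \<theta> V * alt5 (\<lambda>z a b c d. \<theta> z * F a b c d) a b c d p"
    unfolding PC eta_def d\<Phi> alt5_def by (simp add: field_simps)
  finally show ?thesis .
qed

subsection \<open>Locally conformal parallel structures with parallel torsion\<close>

locale lcp_chart =
  fixes D :: "vec8 set" and g :: "vec8 \<Rightarrow> metric" and \<Phi> :: "vec8 \<Rightarrow> form" and \<Gamma> \<Gamma>' :: connection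
  assumes open_D: "open D"
    and metric_bilinear: "x \<in> D \<Longrightarrow> bilinear (g x)"
    and metric_sym: "x \<in> D \<Longrightarrow> g x v w = g x w v"
    and metric_smooth: "smooth_on D (\<lambda>x. g x v w)"
    and form: "x \<in> D \<Longrightarrow> is_form 4 (\<Phi> x)"
    and form_smooth: "smooth_on D (\<lambda>x. \<Phi> x v')"
    and frames: "x \<in> D \<Longrightarrow> \<exists>W e. x \<in> W \<and> W \<subseteq> D \<and> adapted_local_frame W g \<Phi> e"
    and lcp: "x \<in> D \<Longrightarrow> ext_deriv 4 \<Phi> x = wedge 1 4 (lee_form g \<Phi> x) (\<Phi> x)"
    and levi_civita: "levi_civita_on D g \<Gamma>"
    and minimal: "minimal_connection_on D g \<Phi> \<Gamma> \<Gamma>'"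
    and parallel: "x \<in> D \<Longrightarrow> cov_deriv12 \<Gamma>' (\<lambda>x u v. \<Gamma>' x u v - \<Gamma> x u v) x u v w = 0"
begin

abbreviation F where "F x \<equiv> form4 (\<Phi> x)"

definition \<xi> where "\<xi> x u v = \<Gamma>' x u v - \<Gamma> x u v"

definition \<theta> where "\<theta> x w = lee_form g \<Phi> x (\<lambda>_. w)"

text \<open>The frame used here is chosen pointwise and need not vary smoothly.
  \<open>V_frame\<close> exchanges it for any orthonormal frame, which makes the smoothness of
  \<open>V\<close> accessible.\<close>

definition V where "V x = (\<Sum>i<8. \<theta> x (spin7_point.e (g x) (\<Phi> x) i) *\<^sub>R spin7_point.e (g x) (\<Phi> x) i)"

lemma point: "x \<in> D \<Longrightarrow> spin7_point (g x) (\<Phi> x)"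
proof (unfold_locales, goal_cases)
  case 4
  then show ?case using frames[of x] by (auto simp: adapted_local_frame_def)
qed (fact metric_bilinear metric_sym form)+

lemma \<theta>_linear: "x \<in> D \<Longrightarrow> linear (\<theta> x)"
  using lee_form_linear[OF metric_bilinear] by (simp add: \<theta>_def[abs_def])

lemma g_linear: "x \<in> D \<Longrightarrow> linear (g x v)" "x \<in> D \<Longrightarrow> linear (\<lambda>v. g x v w)"
  using metric_bilinear by (auto simp: bilinear_def)

lemma \<Gamma>: "x \<in> D \<Longrightarrow> bilinear (\<Gamma> x)" "x \<in> D \<Longrightarrow> \<Gamma> x u v = \<Gamma> x v u"
  "x \<in> D \<Longrightarrow> frechet_derivative (\<lambda>y. g y v w) (at x) u = g x (\<Gamma> x u v) w + g x v (\<Gamma> x u w)"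
  using levi_civita unfolding levi_civita_on_def by blast+

lemma \<Gamma>'_linear: "x \<in> D \<Longrightarrow> linear (\<Gamma>' x u)" "x \<in> D \<Longrightarrow> linear (\<lambda>u. \<Gamma>' x u v)"
  using minimal by (auto simp: minimal_connection_on_def bilinear_def)

lemma \<Gamma>_linear: "x \<in> D \<Longrightarrow> linear (\<Gamma> x u)" "x \<in> D \<Longrightarrow> linear (\<lambda>u. \<Gamma> x u v)"
  using \<Gamma>(1) by (auto simp: bilinear_def)

lemma \<xi>_bilinear: "x \<in> D \<Longrightarrow> bilinear (\<xi> x)"
  unfolding bilinear_def \<xi>_def
  by (auto intro!: linear_compose_sub \<Gamma>_linear \<Gamma>'_linear)

lemma g_V: "x \<in> D \<Longrightarrow> g x (V x) w = \<theta> x w"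
proof -
  assume x: "x \<in> D"
  interpret pt: spin7_point "g x" "\<Phi> x" by (rule point[OF x])
  show ?thesis
    unfolding V_def pt.linear_expansion[OF \<theta>_linear[OF x], of w]
    by (simp add: linear_sum[OF g_linear(2)[OF x]] linear_scale[OF g_linear(2)[OF x]] mult.commute)
qed

lemma V_frame:
  assumes "x \<in> D" "orthonormal_frame (g x) e"
  shows "V x = (\<Sum>i<8. \<theta> x (e i) *\<^sub>R e i)"
proof -
  have c: "g x (e i) (V x) = \<theta> x (e i)" for i
    using metric_sym g_V assms(1) by metis
  show ?thesis
    using orthonormal_frame_expansion[OF metric_bilinear[OF assms(1)] assms(2), of "V x"] unfolding c .
qed

lemma local_frame:
  assumes "x \<in> D"
  obtains W e where "open W" "x \<in> W" "W \<subseteq> D" "\<And>i. i < 8 \<Longrightarrow> smooth_on W (\<lambda>y. e y i)"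
    "\<And>y. y \<in> W \<Longrightarrow> adapted_frame (g y) (\<Phi> y) (e y)"
    "\<And>u. endo_form (g x) (connection_form g \<Gamma>' e x u) \<in> Lambda2_21 (g x) (\<Phi> x)"
    "\<And>u. endo_form (g x) (\<lambda>Y. connection_form g \<Gamma> e x u Y - connection_form g \<Gamma>' e x u Y) \<in> Lambda2_7 (g x) (\<Phi> x)"
proof -
  obtain W e where We: "x \<in> W" "W \<subseteq> D" "adapted_local_frame W g \<Phi> e"
    using frames[OF assms] by blast
  then have "\<forall>u. endo_form (g x) (connection_form g \<Gamma>' e x u) \<in> Lambda2_21 (g x) (\<Phi> x) \<and>
        endo_form (g x) (\<lambda>Y. connection_form g \<Gamma> e x u Y - connection_form g \<Gamma>' e x u Y) \<in> Lambda2_7 (g x) (\<Phi> x)"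
    using minimal unfolding minimal_connection_on_def by blast
  then show ?thesis
    using We by (intro that[of W e]) (auto simp: adapted_local_frame_def)
qed

text \<open>The difference of two connection forms is tensorial: the derivatives of the frame cancel
  and only the difference of the Christoffel tensors is left.\<close>

lemma \<xi>_Lambda7:
  assumes x: "x \<in> D"
  shows "endo_form (g x) (\<lambda>Y. - \<xi> x u Y) \<in> Lambda2_7 (g x) (\<Phi> x)"
proof -
  obtain W e where W: "open W" "x \<in> W" "W \<subseteq> D" and smooth: "\<And>i. i < 8 \<Longrightarrow> smooth_on W (\<lambda>y. e y i)"
    and frame: "\<And>y. y \<in> W \<Longrightarrow> adapted_frame (g y) (\<Phi> y) (e y)"
    and 21: "\<And>u. endo_form (g x) (connection_form g \<Gamma>' e x u) \<in> Lambda2_21 (g x) (\<Phi> x)"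
    and 7: "\<And>u. endo_form (g x) (\<lambda>Y. connection_form g \<Gamma> e x u Y - connection_form g \<Gamma>' e x u Y) \<in> Lambda2_7 (g x) (\<Phi> x)"
    by (rule local_frame[OF x], rule that)
  have on: "orthonormal_frame (g x) (e x)" using frame[OF W(2)] by (auto simp: adapted_frame_def)
  have "connection_form g \<Gamma> e x u Y - connection_form g \<Gamma>' e x u Y = - \<xi> x u Y" for Y
  proof -
    have "- \<xi> x u Y = - \<xi> x u (\<Sum>j<8. g x (e x j) Y *\<^sub>R e x j)"
      using orthonormal_frame_expansion[OF metric_bilinear[OF x] on, of Y] by simp
    also have "\<dots> = (\<Sum>j<8. g x (e x j) Y *\<^sub>R (\<Gamma> x u (e x j) - \<Gamma>' x u (e x j)))"
      by (simp add: \<xi>_def linear_sum[OF \<Gamma>_linear(1)[OF x]] linear_sum[OF \<Gamma>'_linear(1)[OF x]]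
        linear_scale[OF \<Gamma>_linear(1)[OF x]] linear_scale[OF \<Gamma>'_linear(1)[OF x]] sum_subtractf scaleR_diff_right)
    also have "\<dots> = connection_form g \<Gamma> e x u Y - connection_form g \<Gamma>' e x u Y"
      by (simp add: connection_form_def cov_deriv_def coframe_def sum_subtractf[symmetric] scaleR_diff_right[symmetric])
    finally show ?thesis by simp
  qed
  then show ?thesis using 7[of u] by simp
qed

text \<open>This is \<open>\<nabla>'\<Phi> = 0\<close>, solved for the coordinate derivatives of
  \<open>\<Phi>\<close> with constant arguments.\<close>

lemma \<Phi>_parallel:
  assumes x: "x \<in> D"
  shows "frechet_derivative (\<lambda>y. F y a b c d) (at x) u =
    F x (\<Gamma>' x u a) b c d + F x a (\<Gamma>' x u b) c d + F x a b (\<Gamma>' x u c) d + F x a b c (\<Gamma>' x u d)"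
proof -
  interpret pt: spin7_point "g x" "\<Phi> x" by (rule point[OF x])
  obtain W e where W: "open W" "x \<in> W" "W \<subseteq> D" and smooth: "\<And>i. i < 8 \<Longrightarrow> smooth_on W (\<lambda>y. e y i)"
    and frame: "\<And>y. y \<in> W \<Longrightarrow> adapted_frame (g y) (\<Phi> y) (e y)"
    and 21: "\<And>u. endo_form (g x) (connection_form g \<Gamma>' e x u) \<in> Lambda2_21 (g x) (\<Phi> x)"
    and 7: "\<And>u. endo_form (g x) (\<lambda>Y. connection_form g \<Gamma> e x u Y - connection_form g \<Gamma>' e x u Y) \<in> Lambda2_7 (g x) (\<Phi> x)"
    by (rule local_frame[OF x], rule that)
  have on: "orthonormal_frame (g x) (e x)" using frame[OF W(2)] by (auto simp: adapted_frame_def)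
  \<comment> \<open>Extending the arguments with constant coefficients in an adapted frame makes the value of the
    form constant, while the frame rotates by an endomorphism in \<open>spin(7)\<close>.\<close>
  define ext where "ext a y = (\<Sum>j<8. g x (e x j) a *\<^sub>R e y j)" for a y
  have ext_x: "ext a x = a" for a
    unfolding ext_def by (rule orthonormal_frame_expansion[OF metric_bilinear[OF x] on, symmetric])
  define ext' where "ext' a u = (\<Sum>j<8. g x (e x j) a *\<^sub>R frechet_derivative (\<lambda>y. e y j) (at x) u)" for a u
  have ext': "(ext a has_derivative ext' a) (at x)" for a
    unfolding ext_def[abs_def] ext'_def[abs_def]
    by (intro has_derivative_sum has_derivative_scaleR_right smooth_on_has_derivative[OF smooth W(2)]) auto
  let ?A = "connection_form g \<Gamma>' e x u"
  have A: "linear ?A"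
    unfolding connection_form_def coframe_def
    by (rule linearI) (simp_all add: linear_add[OF g_linear(1)[OF x]] linear_scale[OF g_linear(1)[OF x]]
        scaleR_add_left sum.distrib scaleR_sum_right)
  have A_eq: "?A a = ext' a u + \<Gamma>' x u a" for a
  proof -
    have "\<Gamma>' x u a = (\<Sum>j<8. g x (e x j) a *\<^sub>R \<Gamma>' x u (e x j))"
      using arg_cong[OF orthonormal_frame_expansion[OF metric_bilinear[OF x] on, of a], of "\<Gamma>' x u"]
      by (simp only: linear_sum[OF \<Gamma>'_linear(1)[OF x]] linear_scale[OF \<Gamma>'_linear(1)[OF x]])
    then show ?thesis
      by (simp add: connection_form_def coframe_def cov_deriv_def ext'_def scaleR_add_right sum.distrib)
  qed
  define K where "K = (\<Sum>i<8. g x (e x i) a * (\<Sum>j<8. g x (e x j) b * (\<Sum>k<8. g x (e x k) c * (\<Sum>l<8. g x (e x l) d *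
    (\<Sum>(s, T)\<leftarrow>spin7_terms. s * of_int (matching_sign T [i, j, k, l]))))))"
  have const: "F y (ext a y) (ext b y) (ext c y) (ext d y) = K" if "y \<in> W" for y
  proof -
    have "y \<in> D" using that W by auto
    note lin = form4_linear[OF form[OF this]]
    have ex: "h (ext a y) = (\<Sum>i<8. g x (e x i) a * h (e y i))" if "linear h" for h :: "vec8 \<Rightarrow> real" and a
      by (simp add: ext_def linear_sum[OF that] linear_scale[OF that])
    have exs: "F y (ext a y) p q r = (\<Sum>i<8. g x (e x i) a * F y (e y i) p q r)"
      "F y p (ext b y) q r = (\<Sum>i<8. g x (e x i) b * F y p (e y i) q r)"
      "F y p q (ext c y) r = (\<Sum>i<8. g x (e x i) c * F y p q (e y i) r)"
      "F y p q r (ext d y) = (\<Sum>i<8. g x (e x i) d * F y p q r (e y i))" for p q r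
      by (rule ex, rule lin)+
    have "F y (ext a y) (ext b y) (ext c y) (ext d y) = (\<Sum>i<8. g x (e x i) a * (\<Sum>j<8. g x (e x j) b *
      (\<Sum>k<8. g x (e x k) c * (\<Sum>l<8. g x (e x l) d * F y (e y i) (e y j) (e y k) (e y l)))))"
      by (subst exs(1), subst exs(2), subst exs(3), subst exs(4)) (rule refl)
    also have "\<dots> = K"
      unfolding K_def
      by (intro sum.cong refl arg_cong2[where f = "(*)"] adapted_frame_values[OF frame[OF that]]) auto
    finally show ?thesis .
  qed
  have "((\<lambda>y. F y (ext a y) (ext b y) (ext c y) (ext d y)) has_derivative (\<lambda>u. 0)) (at x)"
    by (rule has_derivative_transform_within_open[OF has_derivative_const[of K] W(1,2)]) (simp add: const)
  moreover have "((\<lambda>y. F y (ext a y) (ext b y) (ext c y) (ext d y)) has_derivative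
    (\<lambda>u. frechet_derivative (\<lambda>y. F y a b c d) (at x) u
      + F x (ext' a u) b c d + F x a (ext' b u) c d + F x a b (ext' c u) d + F x a b c (ext' d u))) (at x)"
    using has_derivative_form4[OF open_D x form smooth_on_differentiable[OF form_smooth x] ext' ext' ext' ext', of a b c d]
    unfolding ext_x .
  ultimately have "(\<lambda>u. frechet_derivative (\<lambda>y. F y a b c d) (at x) u
      + F x (ext' a u) b c d + F x a (ext' b u) c d + F x a b (ext' c u) d + F x a b c (ext' d u)) = (\<lambda>u. 0)"
    using has_derivative_unique by blast
  from fun_cong[OF this, of u]
  have 1: "frechet_derivative (\<lambda>y. F y a b c d) (at x) u
      + F x (ext' a u) b c d + F x a (ext' b u) c d + F x a b (ext' c u) d + F x a b c (ext' d u) = 0" .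
  have "ext' a u = ?A a - \<Gamma>' x u a" for a using A_eq[of a] by simp
  then have "F x (ext' a u) b c d = F x (?A a) b c d - F x (\<Gamma>' x u a) b c d"
    "F x a (ext' b u) c d = F x a (?A b) c d - F x a (\<Gamma>' x u b) c d"
    "F x a b (ext' c u) d = F x a b (?A c) d - F x a b (\<Gamma>' x u c) d"
    "F x a b c (ext' d u) = F x a b c (?A d) - F x a b c (\<Gamma>' x u d)"
    by (simp_all only: pt.F_linear[THEN linear_diff])
  with 1 pt.spin7_annihilates[OF A 21, of a b c d] show ?thesis by linarith
qed

lemma d\<Phi>:
  assumes x: "x \<in> D"
  shows "alt5 (\<lambda>z a b c d. frechet_derivative (\<lambda>y. F y a b c d) (at x) z) a b c d e =
    alt5 (\<lambda>z a b c d. \<theta> x z * F x a b c d) a b c d e"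
proof -
  have "alt5 (\<lambda>z a b c d. frechet_derivative (\<lambda>y. F y a b c d) (at x) z) a b c d e =
      ext_deriv 4 \<Phi> x (nth [a, b, c, d, e])"
    by (rule ext_deriv_4[OF open_D x form, symmetric])
  also have "\<dots> = alt5 (\<lambda>z a b c d. \<theta> x z * F x a b c d) a b c d e"
    unfolding lcp[OF x] \<theta>_def
    by (rule wedge_1_4[OF is_form_lee_form[of g x, OF metric_bilinear[OF x]] form[OF x]])
  finally show ?thesis .
qed

text \<open>Two evaluations of \<open>d\<Phi>\<close> are compared: as a contraction with the
  torsion, since \<open>\<Phi>\<close> is parallel, and as \<open>\<theta> \<and> \<Phi>\<close>.
  The skew part of \<open>\<xi>\<close> is the torsion of \<open>\<nabla>'\<close> because
  \<open>\<Gamma>\<close> is symmetric.\<close>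

lemma torsion_\<Phi>:
  assumes x: "x \<in> D"
  shows "torsion4 (\<lambda>u v. \<xi> x u v - \<xi> x v u) (F x) a b c d e = alt5 (\<lambda>z a b c d. \<theta> x z * F x a b c d) a b c d e"
proof -
  have sk: "\<xi> x u v - \<xi> x v u = \<Gamma>' x u v - \<Gamma>' x v u" for u v
    using \<Gamma>(2)[OF x, of u v] by (simp add: \<xi>_def)
  have "alt5 (\<lambda>z a b c d. frechet_derivative (\<lambda>y. F y a b c d) (at x) z) a b c d e =
      torsion4 (\<lambda>u v. \<xi> x u v - \<xi> x v u) (F x) a b c d e"
    unfolding torsion4_def sk
    by (rule alternating_torsion4[where C = "\<Gamma>' x" and G = "F x"
        and H = "\<lambda>z a b c d. frechet_derivative (\<lambda>y. F y a b c d) (at x) z"])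
      (rule form4_linear(1)[OF form[OF x]] form4_skew[OF form[OF x]] \<Phi>_parallel[OF x])+
  then show ?thesis using d\<Phi>[OF x] by simp
qed

lemma \<xi>_formula:
  assumes x: "x \<in> D"
  shows "g x (\<xi> x u v) w = (g x u v * \<theta> x w - g x u w * \<theta> x v - F x (V x) u v w) / 16"
proof -
  interpret pt: spin7_point "g x" "\<Phi> x" by (rule point[OF x])
  \<comment> \<open>The defining property of the minimal connection puts \<open>-\<xi>\<close> into \<open>\<Lambda>\<^sup>2\<^sub>7\<close>, and closure of this set
    under negation would have to be derived from the Hodge star; negating \<open>\<theta>\<close> and \<open>V\<close> instead is free.\<close>
  have "g x (- \<xi> x u v) w = (g x u v * (- \<theta> x w) - g x u w * (- \<theta> x v) - F x (- V x) u v w) / 16"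
  proof (rule pt.torsion_determined[where \<xi> = "\<lambda>u v. - \<xi> x u v" and \<theta> = "\<lambda>w. - \<theta> x w"])
    show "bilinear (\<lambda>u v. - \<xi> x u v)"
      using \<xi>_bilinear[OF x] by (auto simp: bilinear_def intro!: linear_compose_neg)
    show "endo_form (g x) (\<lambda>Y. - \<xi> x u Y) \<in> Lambda2_7 (g x) (\<Phi> x)" for u
      by (rule \<xi>_Lambda7[OF x])
    show "linear (\<lambda>w. - \<theta> x w)" by (rule linear_compose_neg[OF \<theta>_linear[OF x]])
    show "g x (- V x) w = - \<theta> x w" for w
      using g_V[OF x] by (simp add: linear_neg[OF g_linear(2)[OF x]])
    have neg: "F x (- p - - q) r s t = - F x (p - q) r s t" for p q r s t
      by (simp add: pt.F_lin linear_neg[OF pt.F_linear(1)])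
    show "F x (- \<xi> x v0 v1 - - \<xi> x v1 v0) v2 v3 v4 - F x (- \<xi> x v0 v2 - - \<xi> x v2 v0) v1 v3 v4 +
       F x (- \<xi> x v0 v3 - - \<xi> x v3 v0) v1 v2 v4 - F x (- \<xi> x v0 v4 - - \<xi> x v4 v0) v1 v2 v3 +
       F x (- \<xi> x v1 v2 - - \<xi> x v2 v1) v0 v3 v4 - F x (- \<xi> x v1 v3 - - \<xi> x v3 v1) v0 v2 v4 +
       F x (- \<xi> x v1 v4 - - \<xi> x v4 v1) v0 v2 v3 + F x (- \<xi> x v2 v3 - - \<xi> x v3 v2) v0 v1 v4 -
       F x (- \<xi> x v2 v4 - - \<xi> x v4 v2) v0 v1 v3 + F x (- \<xi> x v3 v4 - - \<xi> x v4 v3) v0 v1 v2 =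
       - \<theta> x v0 * F x v1 v2 v3 v4 - - \<theta> x v1 * F x v0 v2 v3 v4 + - \<theta> x v2 * F x v0 v1 v3 v4 -
       - \<theta> x v3 * F x v0 v1 v2 v4 + - \<theta> x v4 * F x v0 v1 v2 v3" for v0 v1 v2 v3 v4
      using torsion_\<Phi>[OF x, of v0 v1 v2 v3 v4]
      unfolding torsion4_def alt5_def neg by simp
  qed
  then show ?thesis
    by (simp add: linear_neg[OF g_linear(2)[OF x]] linear_neg[OF pt.F_linear(1)] field_simps)
qed

end

section \<open>Smoothness of the Lee form and of the intrinsic torsion\<close>

text \<open>The blocks of \<open>wedge_eq_0D\<close> again, now keeping the value: each
  \<open>\<theta> (e i)\<close> is a single component of
  \<open>\<theta> \<and> \<Phi>\<close>.\<close>

lemma adapted_frame_alt5: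
  assumes e: "adapted_frame g \<Phi> e" and \<Phi>: "is_form 4 \<Phi>"
  shows "i < 4 \<Longrightarrow> alt5 (\<lambda>z a b c d. \<theta> z * form4 \<Phi> a b c d) (e 4) (e 5) (e 6) (e 7) (e i) = \<theta> (e i)"
    and "4 \<le> i \<Longrightarrow> i < 8 \<Longrightarrow> alt5 (\<lambda>z a b c d. \<theta> z * form4 \<Phi> a b c d) (e 0) (e 1) (e 2) (e 3) (e i) = \<theta> (e i)"
proof -
  note vals = adapted_frame_values[OF e] spin7_terms_def
  show "i < 4 \<Longrightarrow> alt5 (\<lambda>z a b c d. \<theta> z * form4 \<Phi> a b c d) (e 4) (e 5) (e 6) (e 7) (e i) = \<theta> (e i)"
  proof -
    assume "i < 4"
    then consider "i = 0" | "i = 1" | "i = 2" | "i = 3" by linarith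
    then show ?thesis by cases (simp_all add: alt5_def vals)
  qed
  show "4 \<le> i \<Longrightarrow> i < 8 \<Longrightarrow> alt5 (\<lambda>z a b c d. \<theta> z * form4 \<Phi> a b c d) (e 0) (e 1) (e 2) (e 3) (e i) = \<theta> (e i)"
  proof -
    assume "4 \<le> i" "i < 8"
    then consider "i = 4" | "i = 5" | "i = 6" | "i = 7" by linarith
    then show ?thesis by cases (simp_all add: alt5_def vals)
  qed
qed

lemma alt5_linear:
  assumes \<theta>: "linear \<theta>" and \<Phi>: "is_form 4 \<Phi>"
  defines "E \<equiv> alt5 (\<lambda>z a b c d. \<theta> z * form4 \<Phi> a b c d)"
  shows "linear (\<lambda>w. E w b c d e)" "linear (\<lambda>w. E a w c d e)" "linear (\<lambda>w. E a b w d e)"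
    "linear (\<lambda>w. E a b c w e)" "linear (\<lambda>w. E a b c d w)"
  unfolding E_def alt5_def
  by (rule linearI; simp add: linear_add[OF \<theta>] linear_scale[OF \<theta>] form4_linear[OF \<Phi>, THEN linear_add]
      form4_linear[OF \<Phi>, THEN linear_scale] algebra_simps)+

context lcp_chart
begin

lemma smooth_alt5:
  assumes W: "open W" "W \<subseteq> D" and s: "smooth_on W a" "smooth_on W b" "smooth_on W c" "smooth_on W d" "smooth_on W e"
  shows "smooth_on W (\<lambda>y. alt5 (\<lambda>z a b c d. \<theta> y z * F y a b c d) (a y) (b y) (c y) (d y) (e y))"
proof -
  define E where "E y = alt5 (\<lambda>z a b c d. \<theta> y z * F y a b c d)" for y
  have lin: "linear (\<lambda>w. E y w q r s t)" "linear (\<lambda>w. E y p w r s t)" "linear (\<lambda>w. E y p q w s t)"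
    "linear (\<lambda>w. E y p q r w t)" "linear (\<lambda>w. E y p q r s w)" if "y \<in> W" for y p q r s t
    unfolding E_def using that W by (auto intro!: alt5_linear \<theta>_linear form)
  have s0: "smooth_on W (\<lambda>y. E y p q r s t)" for p q r s t
  proof -
    have smooth: "smooth_on D (\<lambda>y. F y p q r s)" for p q r s
      unfolding form4_def by (rule form_smooth)
    have "smooth_on D (\<lambda>x. alt5 (\<lambda>z a b c d. frechet_derivative (\<lambda>y. F y a b c d) (at x) z) p q r s t)"
      unfolding alt5_def
      by (intro smooth_on_add smooth_on_diff open_D smooth_on_frechet_derivative smooth)
    then have "smooth_on W (\<lambda>x. alt5 (\<lambda>z a b c d. frechet_derivative (\<lambda>y. F y a b c d) (at x) z) p q r s t)"
      by (rule smooth_on_subset[OF _ W(2)])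
    then show ?thesis
      by (subst smooth_on_cong[OF W(1)]) (use W in \<open>auto simp: E_def d\<Phi>\<close>)
  qed
  have s1: "smooth_on W (\<lambda>y. E y p q r s (e y))" for p q r s
    by (rule smooth_on_apply[OF W(1), of "\<lambda>y w. E y p q r s w" e]) (rule s0 lin s; assumption?)+
  have s2: "smooth_on W (\<lambda>y. E y p q r (d y) (e y))" for p q r
    by (rule smooth_on_apply[OF W(1), of "\<lambda>y w. E y p q r w (e y)" d]) (rule s1 lin s; assumption?)+
  have s3: "smooth_on W (\<lambda>y. E y p q (c y) (d y) (e y))" for p q
    by (rule smooth_on_apply[OF W(1), of "\<lambda>y w. E y p q w (d y) (e y)" c]) (rule s2 lin s; assumption?)+
  have s4: "smooth_on W (\<lambda>y. E y p (b y) (c y) (d y) (e y))" for p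
    by (rule smooth_on_apply[OF W(1), of "\<lambda>y w. E y p w (c y) (d y) (e y)" b]) (rule s3 lin s; assumption?)+
  have "smooth_on W (\<lambda>y. E y (a y) (b y) (c y) (d y) (e y))"
    by (rule smooth_on_apply[OF W(1), of "\<lambda>y w. E y w (b y) (c y) (d y) (e y)" a]) (rule s4 lin s; assumption?)+
  then show ?thesis by (simp add: E_def)
qed

text \<open>Smoothness passes from \<open>d\<Phi>\<close> to the frame components of
  \<open>\<theta>\<close>, from these to \<open>V\<close>, on to \<open>\<theta>\<close> as its
  metric dual, and by \<open>\<xi>_formula\<close> to \<open>\<xi>\<close>.\<close>

lemma smooth_neighbourhood:
  assumes x: "x \<in> D"
  obtains W where "open W" "x \<in> W" "W \<subseteq> D" "smooth_on W V" "\<And>u v. smooth_on W (\<lambda>y. \<xi> y u v)" "\<And>w. smooth_on W (\<lambda>y. \<theta> y w)"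
proof -
  obtain W e where W: "open W" "x \<in> W" "W \<subseteq> D" and smooth: "\<And>i. i < 8 \<Longrightarrow> smooth_on W (\<lambda>y. e y i)"
    and frame: "\<And>y. y \<in> W \<Longrightarrow> adapted_frame (g y) (\<Phi> y) (e y)"
    and 21: "\<And>u. endo_form (g x) (connection_form g \<Gamma>' e x u) \<in> Lambda2_21 (g x) (\<Phi> x)"
    and 7: "\<And>u. endo_form (g x) (\<lambda>Y. connection_form g \<Gamma> e x u Y - connection_form g \<Gamma>' e x u Y) \<in> Lambda2_7 (g x) (\<Phi> x)"
    by (rule local_frame[OF x], rule that)
  have D: "y \<in> D" if "y \<in> W" for y using that W by auto
  have on: "orthonormal_frame (g y) (e y)" if "y \<in> W" for y using frame[OF that] by (simp add: adapted_frame_def)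
  have gW: "smooth_on W (\<lambda>y. g y v w)" for v w
    by (rule smooth_on_subset[OF metric_smooth W(3)])
  have \<Phi>W: "smooth_on W (\<lambda>y. \<Phi> y v)" for v
    by (rule smooth_on_subset[OF form_smooth W(3)])
  have \<theta>e: "smooth_on W (\<lambda>y. \<theta> y (e y i))" if i: "i < 8" for i
  proof (cases "i < 4")
    case True
    have "smooth_on W (\<lambda>y. alt5 (\<lambda>z a b c d. \<theta> y z * F y a b c d) (e y 4) (e y 5) (e y 6) (e y 7) (e y i))"
      by (rule smooth_alt5[OF W(1,3)]) (simp_all add: smooth i)
    then show ?thesis
      by (subst smooth_on_cong[OF W(1)]) (use adapted_frame_alt5(1)[OF frame form] D True in auto)
  next
    case False
    have "smooth_on W (\<lambda>y. alt5 (\<lambda>z a b c d. \<theta> y z * F y a b c d) (e y 0) (e y 1) (e y 2) (e y 3) (e y i))"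
      by (rule smooth_alt5[OF W(1,3)]) (simp_all add: smooth i)
    then show ?thesis
      by (subst smooth_on_cong[OF W(1)]) (use adapted_frame_alt5(2)[OF frame form] D False i in auto)
  qed
  have V: "smooth_on W V"
  proof -
    have "smooth_on W (\<lambda>y. \<Sum>i<8. \<theta> y (e y i) *\<^sub>R e y i)"
      by (intro smooth_on_sum smooth_on_scaleR W(1) \<theta>e smooth) auto
    then show ?thesis
      by (subst smooth_on_cong[OF W(1)]) (use V_frame[OF D on] in auto)
  qed
  have g1: "smooth_on W (\<lambda>y. g y v (h y))" if "smooth_on W h" for v h
    by (rule smooth_on_apply[OF W(1), of "\<lambda>y. g y v" h]) (rule gW g_linear(1) D that; assumption?)+
  have \<theta>W: "smooth_on W (\<lambda>y. \<theta> y w)" for w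
  proof -
    have "smooth_on W (\<lambda>y. g y w (V y))" by (rule g1[OF V])
    moreover have "\<theta> y w = g y w (V y)" if "y \<in> W" for y
      unfolding metric_sym[OF D[OF that], of w] by (rule g_V[OF D[OF that], symmetric])
    ultimately show ?thesis
      using smooth_on_cong[OF W(1), of "\<lambda>y. \<theta> y w" "\<lambda>y. g y w (V y)"] by blast
  qed
  have FW: "smooth_on W (\<lambda>y. F y (V y) u v (e y i))" if "i < 8" for u v i
    by (rule smooth_on_form4[OF W(1)]) (rule form D \<Phi>W V smooth_on_const smooth that; assumption?)+
  have "smooth_on W (\<lambda>y. \<xi> y u v)" for u v
  proof -
    have "smooth_on W (\<lambda>y. \<Sum>i<8. ((1 / 16) * (g y u v * \<theta> y (e y i) - g y u (e y i) * \<theta> y v - F y (V y) u v (e y i))) *\<^sub>R e y i)"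
      by (intro smooth_on_sum smooth_on_scaleR smooth_on_mult smooth_on_diff smooth_on_const W(1) gW \<theta>e g1 \<theta>W FW smooth) auto
    moreover have "\<xi> y u v = (\<Sum>i<8. ((1 / 16) * (g y u v * \<theta> y (e y i) - g y u (e y i) * \<theta> y v - F y (V y) u v (e y i))) *\<^sub>R e y i)"
      if y: "y \<in> W" for y
    proof -
      have c: "g y (e y i) (\<xi> y u v) = (1 / 16) * (g y u v * \<theta> y (e y i) - g y u (e y i) * \<theta> y v - F y (V y) u v (e y i))" for i
        unfolding metric_sym[OF D[OF y], of "e y i" "\<xi> y u v"] \<xi>_formula[OF D[OF y]] by simp
      show ?thesis
        using orthonormal_frame_expansion[OF metric_bilinear[OF D[OF y]] on[OF y], of "\<xi> y u v"] unfolding c .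
    qed
    ultimately show ?thesis
      by (subst smooth_on_cong[OF W(1)]) auto
  qed
  then show ?thesis using that W V \<theta>W by blast
qed

section \<open>Parallel metric, Lee form and dual vector field\<close>

text \<open>By \<open>\<xi>_formula\<close> the endomorphisms \<open>\<xi> x u\<close> are skew, so
  passing from \<open>\<Gamma>\<close> to \<open>\<Gamma>'\<close> preserves compatibility with the
  metric.\<close>

lemma metric_parallel:
  assumes x: "x \<in> D"
  shows "frechet_derivative (\<lambda>y. g y v w) (at x) u = g x (\<Gamma>' x u v) w + g x v (\<Gamma>' x u w)"
proof -
  have "g x (\<xi> x u v) w + g x v (\<xi> x u w) = 0"
    unfolding metric_sym[OF x, of v "\<xi> x u w"] \<xi>_formula[OF x]
    using form4_skew(3)[OF form[OF x], of "V x" u w v] by (simp add: field_simps)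
  moreover have "\<Gamma>' x u v = \<Gamma> x u v + \<xi> x u v" for v by (simp add: \<xi>_def)
  ultimately show ?thesis
    by (simp add: \<Gamma>(3)[OF x] linear_add[OF g_linear(1)[OF x]] linear_add[OF g_linear(2)[OF x]])
qed

lemma eq_0I: "x \<in> D \<Longrightarrow> (\<And>w. g x v w = 0) \<Longrightarrow> v = 0"
proof -
  assume x: "x \<in> D" and 0: "\<And>w. g x v w = 0"
  interpret pt: spin7_point "g x" "\<Phi> x" by (rule point[OF x])
  have "g x (pt.e i) v = 0" for i using 0 metric_sym[OF x] by metis
  then show "v = 0" using pt.expansion[of v] by simp
qed

lemma \<theta>_parallel:
  assumes x: "x \<in> D"
  shows "frechet_derivative (\<lambda>y. \<theta> y w) (at x) z = \<theta> x (\<Gamma>' x z w)"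
proof -
  interpret pt: spin7_point "g x" "\<Phi> x" by (rule point[OF x])
  obtain W where W: "open W" "x \<in> W" "W \<subseteq> D" and "smooth_on W V"
    and \<xi>W: "\<And>u v. smooth_on W (\<lambda>y. \<xi> y u v)" and \<theta>W: "\<And>w. smooth_on W (\<lambda>y. \<theta> y w)"
    by (rule smooth_neighbourhood[OF x], rule that)
  have \<theta>': "((\<lambda>y. \<theta> y w) has_derivative frechet_derivative (\<lambda>y. \<theta> y w) (at x)) (at x)" for w
    by (rule smooth_on_has_derivative[OF \<theta>W W(2)])
  have g': "((\<lambda>y. g y v w) has_derivative (\<lambda>u. g x (\<Gamma>' x u v) w + g x v (\<Gamma>' x u w))) (at x)" for v w
    by (rule has_derivative_eq_rhs[OF smooth_on_has_derivative[OF metric_smooth x]])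
      (simp add: fun_eq_iff metric_parallel[OF x])
  \<comment> \<open>Differentiating the formula for \<open>g (\<xi> u u) w\<close>, in which the Cayley form drops out, and comparing
    orthogonal \<open>u\<close> and \<open>w\<close>.\<close>
  define h where "h w = frechet_derivative (\<lambda>y. \<theta> y w) (at x) z - \<theta> x (\<Gamma>' x z w)" for w
  have key: "g x u u * h w = g x u w * h u" for u w
  proof -
    let ?\<xi>' = "frechet_derivative (\<lambda>y. \<xi> y u u) (at x)"
    have "((\<lambda>y. g y w (\<xi> y u u)) has_derivative
      (\<lambda>z. frechet_derivative (\<lambda>y. g y w (\<xi> x u u)) (at x) z + g x w (?\<xi>' z))) (at x)"
      by (rule has_derivative_apply[OF open_D x, of "\<lambda>y. g y w"])
        (rule smooth_on_differentiable[OF metric_smooth x] g_linear smooth_on_has_derivative[OF \<xi>W W(2)]; assumption?)+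
    from frechet_derivative_eq[OF this, of z]
    have 1: "frechet_derivative (\<lambda>y. g y w (\<xi> y u u)) (at x) z =
        g x (\<Gamma>' x z w) (\<xi> x u u) + g x w (\<Gamma>' x z (\<xi> x u u)) + g x w (?\<xi>' z)"
      by (simp only: metric_parallel[OF x])
    have F0: "F y p u u q = 0" if "y \<in> D" for y p q
      using form4_skew(2)[OF form[OF that], of p u u q] by simp
    have "frechet_derivative (\<lambda>y. g y w (\<xi> y u u)) (at x) =
        frechet_derivative (\<lambda>y. (g y u u * \<theta> y w - g y u w * \<theta> y u) * (1 / 16)) (at x)"
    proof (rule frechet_derivative_cong_open[OF open_D x])
      fix y assume y: "y \<in> D"
      show "g y w (\<xi> y u u) = (g y u u * \<theta> y w - g y u w * \<theta> y u) * (1 / 16)"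
        using \<xi>_formula[OF y, of u u w] F0[OF y] metric_sym[OF y, of w "\<xi> y u u"] by simp
    qed
    moreover have d: "((\<lambda>y. (g y u u * \<theta> y w - g y u w * \<theta> y u) * (1 / 16)) has_derivative
        (\<lambda>z. ((g x u u * frechet_derivative (\<lambda>y. \<theta> y w) (at x) z + (g x (\<Gamma>' x z u) u + g x u (\<Gamma>' x z u)) * \<theta> x w)
          - (g x u w * frechet_derivative (\<lambda>y. \<theta> y u) (at x) z + (g x (\<Gamma>' x z u) w + g x u (\<Gamma>' x z w)) * \<theta> x u)) * (1 / 16))) (at x)"
      by (intro has_derivative_mult_left has_derivative_diff has_derivative_mult g' \<theta>')
    ultimately have 2: "frechet_derivative (\<lambda>y. g y w (\<xi> y u u)) (at x) z =
        ((g x u u * frechet_derivative (\<lambda>y. \<theta> y w) (at x) z + (g x (\<Gamma>' x z u) u + g x u (\<Gamma>' x z u)) * \<theta> x w)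
          - (g x u w * frechet_derivative (\<lambda>y. \<theta> y u) (at x) z + (g x (\<Gamma>' x z u) w + g x u (\<Gamma>' x z w)) * \<theta> x u)) / 16"
      using frechet_derivative_eq[OF d, of z] by simp
    have "?\<xi>' z = - \<Gamma>' x z (\<xi> x u u) + \<xi> x (\<Gamma>' x z u) u + \<xi> x u (\<Gamma>' x z u)"
      using parallel[OF x, of z u u] by (simp add: cov_deriv12_def cov_deriv_def \<xi>_def algebra_simps)
    then have 3: "g x w (?\<xi>' z) = - g x w (\<Gamma>' x z (\<xi> x u u)) + g x (\<xi> x (\<Gamma>' x z u) u) w + g x (\<xi> x u (\<Gamma>' x z u)) w"
      by (simp add: linear_add[OF g_linear(1)[OF x]] linear_neg[OF g_linear(1)[OF x]]
          linear_diff[OF g_linear(2)[OF x]] linear_add[OF g_linear(2)[OF x]] metric_sym[OF x, of w])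
    have 4: "g x (\<Gamma>' x z w) (\<xi> x u u) = g x (\<xi> x u u) (\<Gamma>' x z w)"
      by (rule metric_sym[OF x])
    have 5: "F x (V x) (\<Gamma>' x z u) u w = - F x (V x) u (\<Gamma>' x z u) w"
      by (rule form4_skew(2)[OF form[OF x]])
    have 6: "g x (\<Gamma>' x z u) u = g x u (\<Gamma>' x z u)" by (rule metric_sym[OF x])
    show ?thesis
      using 2 unfolding 1 3 4 \<xi>_formula[OF x] F0[OF x] 5 6 h_def by (simp add: field_simps)
  qed
  have h: "linear h"
  proof -
    have "frechet_derivative (\<lambda>y. \<theta> y (a + b)) (at x) z =
      frechet_derivative (\<lambda>y. \<theta> y a) (at x) z + frechet_derivative (\<lambda>y. \<theta> y b) (at x) z" for a b
      using frechet_derivative_cong_open[OF open_D x, of "\<lambda>y. \<theta> y (a + b)" "\<lambda>y. \<theta> y a + \<theta> y b"]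
        frechet_derivative_eq[OF has_derivative_add[OF \<theta>'[of a] \<theta>'[of b]]]
      by (simp add: linear_add[OF \<theta>_linear])
    moreover have "frechet_derivative (\<lambda>y. \<theta> y (r *\<^sub>R a)) (at x) z = r * frechet_derivative (\<lambda>y. \<theta> y a) (at x) z" for r a
      using frechet_derivative_cong_open[OF open_D x, of "\<lambda>y. \<theta> y (r *\<^sub>R a)" "\<lambda>y. r * \<theta> y a"]
        frechet_derivative_eq[OF has_derivative_mult_right[OF \<theta>'[of a], of r]]
      by (simp add: linear_scale[OF \<theta>_linear])
    ultimately show ?thesis
      unfolding h_def
      by (intro linearI) (simp_all add: linear_add[OF \<theta>_linear[OF x]] linear_scale[OF \<theta>_linear[OF x]]
          linear_add[OF \<Gamma>'_linear(1)[OF x]] linear_scale[OF \<Gamma>'_linear(1)[OF x]] algebra_simps)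
  qed
  have "h w = 0"
  proof (rule pt.linear_eq_0[OF h])
    fix j :: nat assume j: "j < 8"
    \<comment> \<open>Any index other than \<open>j\<close> will do: on orthogonal unit vectors
      \<open>key\<close> says that \<open>h\<close> vanishes on the second one.\<close>
    define i :: nat where "i = (if j = 0 then 1 else 0)"
    have i: "i < 8" "i \<noteq> j" by (auto simp: i_def)
    show "h (pt.e j) = 0"
      using key[of "pt.e i" "pt.e j"] i j by (simp add: pt.g_frame)
  qed
  then show ?thesis by (simp add: h_def)
qed

text \<open>\<open>V\<close> is dual to \<open>\<theta>\<close> with respect to the metric, and both
  the metric and \<open>\<theta>\<close> are parallel.\<close>

lemma V_parallel:
  assumes x: "x \<in> D"
  shows "frechet_derivative V (at x) z = - \<Gamma>' x z (V x)"
proof -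
  obtain W where W: "open W" "x \<in> W" "W \<subseteq> D" and V: "smooth_on W V"
    and \<xi>W: "\<And>u v. smooth_on W (\<lambda>y. \<xi> y u v)" and \<theta>W: "\<And>w. smooth_on W (\<lambda>y. \<theta> y w)"
    by (rule smooth_neighbourhood[OF x], rule that)
  have "g x (frechet_derivative V (at x) z + \<Gamma>' x z (V x)) w = 0" for w
  proof -
    have "((\<lambda>y. g y w (V y)) has_derivative
      (\<lambda>z. frechet_derivative (\<lambda>y. g y w (V x)) (at x) z + g x w (frechet_derivative V (at x) z))) (at x)"
      by (rule has_derivative_apply[OF open_D x, of "\<lambda>y. g y w"])
        (rule smooth_on_differentiable[OF metric_smooth x] g_linear smooth_on_has_derivative[OF V W(2)]; assumption?)+
    from frechet_derivative_eq[OF this, of z]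
    have "frechet_derivative (\<lambda>y. g y w (V y)) (at x) z =
        g x (\<Gamma>' x z w) (V x) + g x w (\<Gamma>' x z (V x)) + g x w (frechet_derivative V (at x) z)"
      by (simp only: metric_parallel[OF x])
    moreover have "frechet_derivative (\<lambda>y. g y w (V y)) (at x) = frechet_derivative (\<lambda>y. \<theta> y w) (at x)"
      by (rule frechet_derivative_cong_open[OF open_D x]) (simp add: g_V metric_sym[of _ w "V _"])
    moreover have "g x (\<Gamma>' x z w) (V x) = \<theta> x (\<Gamma>' x z w)"
      using g_V[OF x] metric_sym[OF x] by metis
    ultimately have "g x w (\<Gamma>' x z (V x)) + g x w (frechet_derivative V (at x) z) = 0"
      using \<theta>_parallel[OF x, of w z] by simp
    then show ?thesis
      using metric_sym[OF x, of w] by (simp add: linear_add[OF g_linear(2)[OF x]])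
  qed
  from eq_0I[OF x this] show ?thesis by (simp add: eq_neg_iff_add_eq_0)
qed

section \<open>The parallel three-form and its exterior derivative\<close>

definition \<phi> where "\<phi> x a b c = F x (V x) a b c"

definition \<eta> where "\<eta> x = spin7_point.eta (\<Phi> x) (\<theta> x) (V x)"

lemma \<eta>_eq: "x \<in> D \<Longrightarrow> \<eta> x a b c d =
    15 / 16 * (\<theta> x a * \<phi> x b c d - \<theta> x b * \<phi> x a c d + \<theta> x c * \<phi> x a b d - \<theta> x d * \<phi> x a b c)
      - 3 / 4 * \<theta> x (V x) * F x a b c d"
  unfolding \<eta>_def \<phi>_def by (rule spin7_point.eta_def[OF point])

text \<open>The Christoffel term that \<open>\<Phi>_parallel\<close> produces in the first slot is
  cancelled by the derivative of \<open>V\<close>, so the three remaining slots express that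
  \<open>\<phi>\<close> is parallel.\<close>

lemma \<phi>_derivative:
  assumes x: "x \<in> D"
  shows "((\<lambda>y. \<phi> y a b c) has_derivative
    (\<lambda>z. \<phi> x (\<Gamma>' x z a) b c + \<phi> x a (\<Gamma>' x z b) c + \<phi> x a b (\<Gamma>' x z c))) (at x)"
proof -
  obtain W where W: "open W" "x \<in> W" "W \<subseteq> D" and V: "smooth_on W V"
    and \<xi>W: "\<And>u v. smooth_on W (\<lambda>y. \<xi> y u v)" and \<theta>W: "\<And>w. smooth_on W (\<lambda>y. \<theta> y w)"
    by (rule smooth_neighbourhood[OF x], rule that)
  note lin = form4_linear[OF form[OF x]]
  have "((\<lambda>y. F y (V y) a b c) has_derivative
    (\<lambda>z. frechet_derivative (\<lambda>y. F y (V x) a b c) (at x) z + F x (frechet_derivative V (at x) z) a b c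
      + F x (V x) 0 b c + F x (V x) a 0 c + F x (V x) a b 0)) (at x)"
    by (rule has_derivative_form4[OF open_D x])
      (rule form smooth_on_differentiable[OF form_smooth x] smooth_on_has_derivative[OF V W(2)] has_derivative_const; assumption?)+
  then show ?thesis
    unfolding \<phi>_def
    by (rule has_derivative_eq_rhs)
      (simp add: fun_eq_iff \<Phi>_parallel[OF x] V_parallel[OF x] lin[THEN linear_0] linear_neg[OF lin(1)])
qed

lemma torsion_bilinear: "x \<in> D \<Longrightarrow> bilinear (\<lambda>u v. \<xi> x u v - \<xi> x v u)"
  using \<xi>_bilinear by (auto simp: bilinear_def intro!: linear_compose_sub)

lemma torsion_formula:
  assumes x: "x \<in> D"
  shows "g x (\<xi> x u v - \<xi> x v u) w = (g x v w * \<theta> x u - g x u w * \<theta> x v - 2 * F x (V x) u v w) / 16"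
  using form4_skew(2)[OF form[OF x], of "V x" v u w]
  by (simp add: linear_diff[OF g_linear(2)[OF x]] \<xi>_formula[OF x] metric_sym[OF x, of v u] field_simps)

text \<open>The analogue of \<open>alternating_torsion4\<close> in degree three: the Christoffel
  terms of the parallel form \<open>\<phi>\<close> combine into the torsion contraction that
  \<open>parallel_contraction\<close> evaluates.\<close>

lemma d\<phi>:
  assumes x: "x \<in> D"
  shows "frechet_derivative (\<lambda>y. \<phi> y b c d) (at x) a - frechet_derivative (\<lambda>y. \<phi> y a c d) (at x) b
    + frechet_derivative (\<lambda>y. \<phi> y a b d) (at x) c - frechet_derivative (\<lambda>y. \<phi> y a b c) (at x) d = \<eta> x a b c d"
proof -
  interpret pt: spin7_point "g x" "\<Phi> x" by (rule point[OF x])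
  let ?T = "\<lambda>u v. \<xi> x u v - \<xi> x v u"
  have sk: "?T u v = \<Gamma>' x u v - \<Gamma>' x v u" for u v
    using \<Gamma>(2)[OF x, of u v] by (simp add: \<xi>_def)
  have 2: "F x (V x) p (\<Gamma>' x z w) q = - F x (V x) (\<Gamma>' x z w) p q" for p q z w
    by (rule form4_skew(2)[OF form[OF x]])
  have 3: "F x (V x) p q (\<Gamma>' x z w) = F x (V x) (\<Gamma>' x z w) p q" for p q z w
    using form4_skew(3)[OF form[OF x], of "V x" p q "\<Gamma>' x z w"] 2[of p z w q] by simp
  have "\<eta> x a b c d = F x (V x) (?T a b) c d - F x (V x) (?T a c) b d + F x (V x) (?T a d) b c
      + F x (V x) (?T b c) a d - F x (V x) (?T b d) a c + F x (V x) (?T c d) a b"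
    unfolding \<eta>_def pt.eta_def
    by (rule pt.parallel_contraction[OF \<theta>_linear[OF x] g_V[OF x] torsion_bilinear[OF x] _ torsion_formula[OF x], symmetric]) simp
  moreover have "frechet_derivative (\<lambda>y. \<phi> y p q r) (at x) z =
      F x (V x) (\<Gamma>' x z p) q r + F x (V x) p (\<Gamma>' x z q) r + F x (V x) p q (\<Gamma>' x z r)" for p q r z
    by (simp only: frechet_derivative_eq[OF \<phi>_derivative[OF x]] \<phi>_def[of x])
  ultimately show ?thesis
    unfolding sk 2 3 pt.F_lin by simp
qed

text \<open>Since \<open>\<eta> = d\<phi>\<close> on all of \<open>D\<close>, this is
  \<open>d(d\<phi>) = 0\<close>, and it reduces to the symmetry of second derivatives of the
  components of \<open>\<phi>\<close>.\<close>

lemma d\<eta>: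
  assumes x: "x \<in> D"
  shows "alt5 (\<lambda>z a b c d. frechet_derivative (\<lambda>y. \<eta> y a b c d) (at x) z) a b c d e = 0"
proof -
  obtain W where W: "open W" "x \<in> W" "W \<subseteq> D" and V: "smooth_on W V"
    and \<xi>W: "\<And>u v. smooth_on W (\<lambda>y. \<xi> y u v)" and \<theta>W: "\<And>w. smooth_on W (\<lambda>y. \<theta> y w)"
    by (rule smooth_neighbourhood[OF x], rule that)
  have \<phi>W: "smooth_on W (\<lambda>y. \<phi> y p q r)" for p q r
    unfolding \<phi>_def
    by (rule smooth_on_form4[OF W(1)])
      (rule form subsetD[OF W(3)] smooth_on_subset[OF form_smooth W(3)] V smooth_on_const; assumption?)+
  let ?d = "\<lambda>p q r u. (\<lambda>y. frechet_derivative (\<lambda>y. \<phi> y p q r) (at y) u)"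
  have dd: "((?d p q r u) has_derivative frechet_derivative (?d p q r u) (at x)) (at x)" for p q r u
    by (rule smooth_on_has_derivative[OF smooth_on_frechet_derivative[OF \<phi>W] W(2)])
  have sym: "frechet_derivative (?d p q r u) (at x) z = frechet_derivative (?d p q r z) (at x) u" for p q r u z
    by (rule frechet_derivative_commute[OF W(1) \<phi>W W(2)])
  have E: "frechet_derivative (\<lambda>y. \<eta> y a b c d) (at x) z =
    frechet_derivative (?d b c d a) (at x) z - frechet_derivative (?d a c d b) (at x) z
    + frechet_derivative (?d a b d c) (at x) z - frechet_derivative (?d a b c d) (at x) z" for a b c d z
  proof -
    have "frechet_derivative (\<lambda>y. \<eta> y a b c d) (at x) =
      frechet_derivative (\<lambda>y. ?d b c d a y - ?d a c d b y + ?d a b d c y - ?d a b c d y) (at x)"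
      by (rule frechet_derivative_cong_open[OF open_D x]) (rule d\<phi>[symmetric])
    moreover have der: "((\<lambda>y. ?d b c d a y - ?d a c d b y + ?d a b d c y - ?d a b c d y) has_derivative
      (\<lambda>z. frechet_derivative (?d b c d a) (at x) z - frechet_derivative (?d a c d b) (at x) z
        + frechet_derivative (?d a b d c) (at x) z - frechet_derivative (?d a b c d) (at x) z)) (at x)"
      by (intro has_derivative_diff has_derivative_add dd)
    ultimately show ?thesis using frechet_derivative_eq[OF der, of z] by simp
  qed
  show ?thesis
    unfolding alt5_def E
    \<comment> \<open>One instance for each of the ten pairs among \<open>a\<close>,
      \<open>b\<close>, \<open>c\<close>, \<open>d\<close>, \<open>e\<close>; the other three
      arguments stay in \<open>\<phi>\<close>.\<close>
    using sym[of c d e a b] sym[of b d e a c] sym[of b c e a d] sym[of b c d a e] sym[of a d e b c]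
      sym[of a c e b d] sym[of a c d b e] sym[of a b e c d] sym[of a b d c e] sym[of a b c d e]
    by linarith
qed

text \<open>By \<open>\<eta>_eq\<close>, \<open>\<eta>\<close> is a polynomial in
  \<open>\<theta>\<close>, \<open>\<phi>\<close>, \<open>\<Phi>\<close> and the function
  \<open>\<theta> (V)\<close>, all of them parallel, so the Leibniz rule applies.\<close>

lemma \<eta>_parallel:
  assumes x: "x \<in> D"
  shows "frechet_derivative (\<lambda>y. \<eta> y a b c d) (at x) z =
    \<eta> x (\<Gamma>' x z a) b c d + \<eta> x a (\<Gamma>' x z b) c d + \<eta> x a b (\<Gamma>' x z c) d + \<eta> x a b c (\<Gamma>' x z d)"
proof -
  obtain W where W: "open W" "x \<in> W" "W \<subseteq> D" and V: "smooth_on W V"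
    and \<xi>W: "\<And>u v. smooth_on W (\<lambda>y. \<xi> y u v)" and \<theta>W: "\<And>w. smooth_on W (\<lambda>y. \<theta> y w)"
    by (rule smooth_neighbourhood[OF x], rule that)
  have \<theta>': "((\<lambda>y. \<theta> y w) has_derivative (\<lambda>z. \<theta> x (\<Gamma>' x z w))) (at x)" for w
    by (rule has_derivative_eq_rhs[OF smooth_on_has_derivative[OF \<theta>W W(2)]])
      (simp add: fun_eq_iff \<theta>_parallel[OF x])
  have F': "((\<lambda>y. F y a b c d) has_derivative (\<lambda>z. F x (\<Gamma>' x z a) b c d + F x a (\<Gamma>' x z b) c d
      + F x a b (\<Gamma>' x z c) d + F x a b c (\<Gamma>' x z d))) (at x)" for a b c d
  proof -
    have "smooth_on D (\<lambda>y. F y a b c d)"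
      unfolding form4_def by (rule form_smooth)
    from smooth_on_has_derivative[OF this x] show ?thesis
      by (rule has_derivative_eq_rhs) (simp add: fun_eq_iff \<Phi>_parallel[OF x])
  qed
  \<comment> \<open>The squared length of \<open>\<theta>\<close> is constant: the derivatives of
    \<open>\<theta>\<close> and of \<open>V\<close> cancel.\<close>
  have \<tau>: "((\<lambda>y. \<theta> y (V y)) has_derivative (\<lambda>z. 0)) (at x)"
  proof -
    have "((\<lambda>y. \<theta> y (V y)) has_derivative
      (\<lambda>z. frechet_derivative (\<lambda>y. \<theta> y (V x)) (at x) z + \<theta> x (frechet_derivative V (at x) z))) (at x)"
      by (rule has_derivative_apply[OF open_D x])
        (rule smooth_on_differentiable[OF \<theta>W W(2)] \<theta>_linear smooth_on_has_derivative[OF V W(2)]; assumption?)+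
    then show ?thesis
      by (rule has_derivative_eq_rhs)
        (simp add: fun_eq_iff \<theta>_parallel[OF x] V_parallel[OF x] linear_neg[OF \<theta>_linear[OF x]])
  qed
  note \<phi>' = \<phi>_derivative[OF x]
  let ?R = "\<lambda>y. 15 / 16 * (\<theta> y a * \<phi> y b c d - \<theta> y b * \<phi> y a c d + \<theta> y c * \<phi> y a b d - \<theta> y d * \<phi> y a b c)
      - 3 / 4 * (\<theta> y (V y) * F y a b c d)"
  have "frechet_derivative (\<lambda>y. \<eta> y a b c d) (at x) = frechet_derivative ?R (at x)"
    by (rule frechet_derivative_cong_open[OF open_D x]) (simp add: \<eta>_eq)
  moreover have der: "(?R has_derivative (\<lambda>z. \<eta> x (\<Gamma>' x z a) b c d + \<eta> x a (\<Gamma>' x z b) c d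
      + \<eta> x a b (\<Gamma>' x z c) d + \<eta> x a b c (\<Gamma>' x z d))) (at x)"
    by (rule has_derivative_eq_rhs,
        (rule has_derivative_diff has_derivative_mult_right has_derivative_add has_derivative_mult \<theta>' \<phi>' F' \<tau>)+)
      (simp add: fun_eq_iff \<eta>_eq[OF x] algebra_simps)
  ultimately show ?thesis using frechet_derivative_eq[OF der, of z] by simp
qed

lemma torsion_free:
  assumes x: "x \<in> D"
  shows "\<xi> x u v = 0"
proof -
  interpret pt: spin7_point "g x" "\<Phi> x" by (rule point[OF x])
  let ?T = "\<lambda>u v. \<xi> x u v - \<xi> x v u"
  let ?dF = "alt5 (\<lambda>z a b c d. \<theta> x z * F x a b c d)"
  have sk: "?T u v = \<Gamma>' x u v - \<Gamma>' x v u" for u v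
    using \<Gamma>(2)[OF x, of u v] by (simp add: \<xi>_def)
  note F_skew = form4_skew[OF form[OF x]]
  \<comment> \<open>\<open>d(d\<phi>) = 0\<close>, turned into a purely algebraic equation at
    \<open>x\<close> because \<open>\<eta>\<close> is parallel.\<close>
  have "torsion4 ?T (\<eta> x) a b c d e = 0" for a b c d e
  proof -
    have "alt5 (\<lambda>z a b c d. frechet_derivative (\<lambda>y. \<eta> y a b c d) (at x) z) a b c d e = torsion4 ?T (\<eta> x) a b c d e"
      unfolding torsion4_def sk
    proof (rule alternating_torsion4[where C = "\<Gamma>' x" and G = "\<eta> x"
        and H = "\<lambda>z a b c d. frechet_derivative (\<lambda>y. \<eta> y a b c d) (at x) z"])
      show "linear (\<lambda>a. \<eta> x a b c d)" for b c d
        unfolding \<eta>_eq[OF x] \<phi>_def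
        by (rule linearI) (simp_all add: linear_add[OF \<theta>_linear[OF x]] linear_scale[OF \<theta>_linear[OF x]] pt.F_lin algebra_simps)
      show "\<eta> x b a c d = - \<eta> x a b c d" for a b c d
        unfolding \<eta>_eq[OF x] \<phi>_def
        using F_skew(1)[of b a c d] F_skew(2)[of "V x" b a c] F_skew(2)[of "V x" b a d] by (simp add: algebra_simps)
      show "\<eta> x a c b d = - \<eta> x a b c d" for a b c d
        unfolding \<eta>_eq[OF x] \<phi>_def
        using F_skew(2)[of a c b d] F_skew(2)[of "V x" c b d] F_skew(3)[of "V x" a c b] by (simp add: algebra_simps)
      show "\<eta> x a b d c = - \<eta> x a b c d" for a b c d
        unfolding \<eta>_eq[OF x] \<phi>_def
        using F_skew(3)[of a b d c] F_skew(3)[of "V x" b d c] F_skew(3)[of "V x" a d c] by (simp add: algebra_simps)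
    qed (rule \<eta>_parallel[OF x])
    then show ?thesis using d\<eta>[OF x] by simp
  qed
  moreover have "torsion4 ?T (\<eta> x) a b c d e = - 3 / 64 * \<theta> x (V x) * ?dF a b c d e" for a b c d e
    unfolding \<eta>_def
    by (rule pt.torsion4_eta[OF \<theta>_linear[OF x] g_V[OF x] torsion_bilinear[OF x] _ torsion_formula[OF x] torsion_\<Phi>[OF x]]) simp
  ultimately have zero: "\<theta> x (V x) = 0 \<or> ?dF a b c d e = 0" for a b c d e
    by simp
  have \<tau>: "\<theta> x (V x) = 0"
  proof (rule ccontr)
    assume "\<theta> x (V x) \<noteq> 0"
    then have "?dF a b c d e = 0" for a b c d e using zero by blast
    then have "\<theta> x (V x) = 0"
      by (intro pt.wedge_form4_eq_0D[OF \<theta>_linear[OF x]]) (simp add: alt5_def)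
    with \<open>\<theta> x (V x) \<noteq> 0\<close> show False by simp
  qed
  \<comment> \<open>In an orthonormal frame \<open>\<theta> (V)\<close> is a sum of squares, so its
    vanishing kills every component of \<open>\<theta>\<close>.\<close>
  have "\<theta> x (V x) = (\<Sum>i<8. \<theta> x (pt.e i) * \<theta> x (pt.e i))"
    unfolding pt.linear_expansion[OF \<theta>_linear[OF x], of "V x"] using g_V[OF x] metric_sym[OF x] by metis
  with \<tau> have "\<theta> x (pt.e i) = 0" if "i < 8" for i
    using that by (simp add: sum_nonneg_eq_0_iff)
  then have \<theta>0: "\<theta> x w = 0" for w
    by (rule pt.linear_eq_0[OF \<theta>_linear[OF x]])
  then have "V x = 0"
    using g_V[OF x] by (intro eq_0I[OF x]) simp
  then have "g x (\<xi> x u v) w = 0" for w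
    by (simp add: \<xi>_formula[OF x] \<theta>0 linear_0[OF pt.F_linear(1)])
  then show ?thesis by (rule eq_0I[OF x])
qed

end

theorem corollary3p2:
  fixes X :: "'a topology"
    and \<A> :: "'a chart set"
    and g :: "'a chart \<Rightarrow> vec8 \<Rightarrow> metric"
    and \<Phi> :: "'a chart \<Rightarrow> vec8 \<Rightarrow> form"
    and \<Gamma> \<Gamma>' :: "'a chart \<Rightarrow> connection"
  assumes "spin7_structure X \<A> g \<Phi>"
    and "compact_space X"
    and "locally_conformal_parallel \<A> g \<Phi>"
    and "levi_civita_connection \<A> g \<Gamma>"
    and "minimal_spin7_connection \<A> g \<Phi> \<Gamma> \<Gamma>'"
    and "\<not> vanishes12 \<A> (intrinsic_torsion \<Gamma> \<Gamma>')"
  shows "\<not> parallel12 \<A> \<Gamma>' (intrinsic_torsion \<Gamma> \<Gamma>')"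
proof
  assume parallel: "parallel12 \<A> \<Gamma>' (intrinsic_torsion \<Gamma> \<Gamma>')"
  have it: "intrinsic_torsion \<Gamma> \<Gamma>' c = (\<lambda>x u v. \<Gamma>' c x u v - \<Gamma> c x u v)" for c
    by (simp add: fun_eq_iff intrinsic_torsion_def)
  have "intrinsic_torsion \<Gamma> \<Gamma>' c x u v = 0" if c: "c \<in> \<A>" and x: "x \<in> chart_image c" for c x u v
  proof -
    interpret lcp_chart "chart_image c" "g c" "\<Phi> c" "\<Gamma> c" "\<Gamma>' c"
    proof (unfold_locales, goal_cases)
      case 1
      then show ?case
        using assms(1) c by (auto simp: spin7_structure_def smooth_manifold_def is_chart_def)
    next
      case (2 x)
      then show ?case using assms(1) c by (auto simp: spin7_structure_def riemannian_metric_def)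
    next
      case (3 x v w)
      then show ?case using assms(1) c unfolding spin7_structure_def riemannian_metric_def by blast
    next
      case (4 v w)
      then show ?case using assms(1) c by (auto simp: spin7_structure_def riemannian_metric_def)
    next
      case (5 x)
      then show ?case using assms(1) c by (auto simp: spin7_structure_def differential_form_def)
    next
      case (6 v)
      then show ?case using assms(1) c by (auto simp: spin7_structure_def differential_form_def)
    next
      case (7 x)
      then show ?case using assms(1) c by (auto simp: spin7_structure_def)
    next
      case (8 x)
      then show ?case using assms(3) c by (auto simp: locally_conformal_parallel_def)
    next
      case 9
      then show ?case using assms(4) c by (auto simp: levi_civita_connection_def)
    next
      case 10
      then show ?case using assms(5) c by (auto simp: minimal_spin7_connection_def)
    next
      case (11 x u v w)
      then show ?case using parallel c by (simp add: parallel12_def it)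
    qed
    show ?thesis
      using torsion_free[OF x] by (simp add: it \<xi>_def)
  qed
  then show False using assms(6) by (simp add: vanishes12_def)
qed

end
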